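(* Let $X$ be a smooth projective toric variety over an algebraically closed field $k$, with $\mathrm{Pic}(X)$-graded Cox ring $S$ and irrelevant ideal $B\subseteq S$. Let $\varphi: F\to G$ be a $\mathrm{Pic}(X)$-graded map of free $S$-modules of finite ranks $f=\mathrm{rank}\,F\ge g=\mathrm{rank}\,G$. Let $i\ge -1$ be an integer and let $$\mathcal{C}^i:\ 0\longrightarrow F_e\overset{\varphi_e}{\longrightarrow}F_{e-1}\overset{\varphi_{e-1}}{\longrightarrow}\cdots\overset{\varphi_2}{\longrightarrow}F_1\overset{\varphi_1}{\longrightarrow}F_0$$ be the $i$-th generalized Eagon-Northcott complex of $\varphi$ (of length $e$). If $$\mathrm{depth}\,(I_m(\varphi):B^\infty)\ \ge\ f-m+1\qquad\text{for every integer } m \text{ with } f-e+1\le m\le g,$$ then $\mathcal{C}^i$ is a virtual resolution.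
   Context: Cox ring: $S=\mathrm{Cox}(X)$ is the polynomial ring $k[x_\rho]$ with one variable for each ray $\rho$ of the fan of $X$, graded by $\mathrm{Pic}(X)$ with $\deg x_\rho=[D_\rho]$, the class of the torus-invariant prime divisor of $\rho$; the irrelevant ideal $B$ is generated by the monomials $\prod_{\rho\not\subset\sigma}x_\rho$ for $\sigma$ ranging over the maximal cones of the fan. Virtual resolution: a complex $\mathcal{C}: \cdots\to F_2\to F_1\to F_0$ of $\mathrm{Pic}(X)$-graded free $S$-modules is a virtual resolution (of a $\mathrm{Pic}(X)$-graded $S$-module $M$) if the corresponding complex $\widetilde{\mathcal{C}}$ of vector bundles on $X$ is a locally free resolution of $\widetilde{M}$. Algebraically, $\mathcal{C}$ is a virtual resolution if for each $j\ge1$ there is $n$ with $B^nH_j(\mathcal{C})=0$. Minors, saturation, depth: $I_m(\varphi)\subseteq S$ is the ideal generated by the $m\times m$ minors of a matrix representing $\varphi$, with $I_m(\varphi)=S$ for $m\le 0$. $(I:B^\infty)=\bigcup_{n\geq 0}(I:B^n)$. The depth of a proper ideal is the maximal length of an $S$-regular sequence contained in it; the depth of the unit ideal is $\infty$. Generalized Eagon-Northcott complexes: let $R$ be a commutative ring and $\varphi:F\to G$ a map of free $R$-modules of ranks $f\ge g$. Write $\bigwedge^pF$ for exterior powers, $\mathrm{Sym}_qG$ for symmetric powers, $(-)^*$ for the dual; exterior and symmetric powers with negative index are $0$. Define the maps $$\delta:\textstyle\bigwedge^pF\otimes \mathrm{Sym}_qG\to\bigwedge^{p-1}F\otimes\mathrm{Sym}_{q+1}G,\quad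 a_1\wedge\cdots\wedge a_p\otimes u\mapsto\sum_t(-1)^{t-1}a_1\wedge\cdots\widehat{a_t}\cdots\wedge a_p\otimes\varphi(a_t)u,$$ $$\partial:\textstyle\bigwedge^pF\otimes(\mathrm{Sym}_qG)^*\to\bigwedge^{p-1}F\otimes(\mathrm{Sym}_{q-1}G)^*,\quad a_1\wedge\cdots\wedge a_p\otimes\lambda\mapsto\sum_t(-1)^{t-1}a_1\wedge\cdots\widehat{a_t}\cdots\wedge a_p\otimes\lambda(\varphi(a_t)\cdot -),$$ and, for $i\ge0$, the splice map $\epsilon:\bigwedge^{g+i}F\otimes(\bigwedge^gG)^*\to\bigwedge^iF$ given by $$a_1\wedge\cdots\wedge a_{g+i}\otimes\mu\mapsto\sum_{T}\pm\,\mu\big(\textstyle\bigwedge_{t\in T}\varphi(a_t)\big)\bigwedge_{t\notin T}a_t,$$ where $T$ ranges over the $g$-element subsets of $\{1,\dots,g+i\}$ and $\pm$ is the sign of the permutation listing $T$ in increasing order followed by its complement in increasing order. - For $-1\le i\le f-g$, $\mathcal{C}^i$ has length $e=f-g+1$, with $F_j=\bigwedge^jF\otimes\mathrm{Sym}_{i-j}G$ for $0\le j\le i$ and $F_j=\bigwedge^{g+j-1}F\otimes(\mathrm{Sym}_{j-i-1}G)^*\otimes(\bigwedge^gG)^*$ for $i+1\le j\le f-g+1$. The differential $\varphi_j$ is $\delta$ for $1\le j\le i$, is $\epsilon$ for $j=i+1$ (when $i\ge0$), and is $\partial$ (tensored with $(\bigwedge^gG)^*$) for $j\ge i+2$. -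 For $i\ge f-g+1$, $\mathcal{C}^i$ has length $e=\min(i,f)$, with $F_j=\bigwedge^jF\otimes\mathrm{Sym}_{i-j}G$ for $0\le j\le e$ and all differentials equal to $\delta$. Thus $\mathcal{C}^0$ is the Eagon-Northcott complex (with $\varphi_1=\bigwedge^g\varphi$) and $\mathcal{C}^1$ is the Buchsbaum-Rim complex (with last map $\varphi$) when $f-g\geq 1$. When $R=S$ and $\varphi$ is $\mathrm{Pic}(X)$-graded, the complexes $\mathcal{C}^i$ are $\mathrm{Pic}(X)$-graded. *)

theory Defs
  imports "HOL-Analysis.Analysis" "HOL-Library.Poly_Mapping" "HOL-Library.Extended_Nat"
    "HOL-Algebra.Ideal_Product" "HOL-Algebra.Free_Abelian_Groups"
    "HOL-Combinatorics.Permutations"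
begin

section \<open>Fans of smooth projective toric varieties\<close>

text \<open>
  A (normal) toric variety is represented by its fan \<open>\<Sigma>\<close>, a collection of cones in
  \<open>N\<^sub>\<real> = span N\<close>.  The lattice \<open>N\<close> may have any rank up to the dimension of the ambient
  Euclidean space, in particular rank \<open>0\<close>, so that the variety consisting of a single point is
  covered.  The dual lattice \<open>M = Hom(N, \<int>)\<close> is identified with a subset of \<open>span N\<close> by means
  of the inner product.
\<close>

definition lattice_basis :: "'v::euclidean_space set \<Rightarrow> 'v set \<Rightarrow> bool" where
  "lattice_basis N b \<longleftrightarrow>
     independent b \<and> N = {\<Sum>v\<in>b. real_of_int (c v) *\<^sub>R v | c :: 'v \<Rightarrow> int. True}"

definition dual_lattice :: "'v::euclidean_space set \<Rightarrow> 'v set" where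
  "dual_lattice N = {m \<in> span N. \<forall>u\<in>N. m \<bullet> u \<in> \<int>}"

definition rational_polyhedral_cone :: "'v::euclidean_space set \<Rightarrow> 'v set \<Rightarrow> bool" where
  "rational_polyhedral_cone N \<sigma> \<longleftrightarrow> (\<exists>G. finite G \<and> G \<subseteq> N \<and> \<sigma> = convex_cone hull G)"

definition strongly_convex :: "'v::euclidean_space set \<Rightarrow> bool" where
  "strongly_convex \<sigma> \<longleftrightarrow> (\<forall>x\<in>\<sigma>. - x \<in> \<sigma> \<longrightarrow> x = 0)"

text \<open>The library relation \<open>face_of\<close> also admits the empty set, which is not a face of a cone.\<close>

definition fan :: "'v::euclidean_space set \<Rightarrow> 'v set set \<Rightarrow> bool" where
  "fan N \<Sigma> \<longleftrightarrow> finite \<Sigma> \<and>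
     (\<forall>\<sigma>\<in>\<Sigma>. rational_polyhedral_cone N \<sigma> \<and> strongly_convex \<sigma>) \<and>
     (\<forall>\<sigma>\<in>\<Sigma>. \<forall>\<tau>. \<tau> face_of \<sigma> \<and> \<tau> \<noteq> {} \<longrightarrow> \<tau> \<in> \<Sigma>) \<and>
     (\<forall>\<sigma>\<in>\<Sigma>. \<forall>\<tau>\<in>\<Sigma>. (\<sigma> \<inter> \<tau>) face_of \<sigma> \<and> (\<sigma> \<inter> \<tau>) face_of \<tau>)"

definition smooth_cone :: "'v::euclidean_space set \<Rightarrow> 'v set \<Rightarrow> bool" where
  "smooth_cone N \<sigma> \<longleftrightarrow> (\<exists>b G. lattice_basis N b \<and> G \<subseteq> b \<and> \<sigma> = convex_cone hull G)"

definition normal_cone :: "'v::euclidean_space set \<Rightarrow> 'v set \<Rightarrow> 'v set \<Rightarrow> 'v set" where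
  "normal_cone N P Q = {u \<in> span N. \<forall>m\<in>Q. \<forall>m'\<in>P. m \<bullet> u \<le> m' \<bullet> u}"

definition normal_fan :: "'v::euclidean_space set \<Rightarrow> 'v set \<Rightarrow> 'v set set" where
  "normal_fan N P = {normal_cone N P Q | Q. Q face_of P \<and> Q \<noteq> {}}"

text \<open>
  The toric variety of a fan is projective iff the fan is the (inner) normal fan of a
  full-dimensional lattice polytope in \<open>M\<^sub>\<real>\<close>.
\<close>

definition projective_fan :: "'v::euclidean_space set \<Rightarrow> 'v set set \<Rightarrow> bool" where
  "projective_fan N \<Sigma> \<longleftrightarrow>
     (\<exists>V. finite V \<and> V \<subseteq> dual_lattice N \<and> aff_dim (convex hull V) = int (dim N) \<and>
          \<Sigma> = normal_fan N (convex hull V))"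

definition smooth_projective_fan :: "'v::euclidean_space set \<Rightarrow> 'v set set \<Rightarrow> bool" where
  "smooth_projective_fan N \<Sigma> \<longleftrightarrow>
     (\<exists>b. lattice_basis N b) \<and> fan N \<Sigma> \<and> (\<forall>\<sigma>\<in>\<Sigma>. smooth_cone N \<sigma>) \<and> projective_fan N \<Sigma>"

definition rays :: "'v::euclidean_space set set \<Rightarrow> 'v set set" where
  "rays \<Sigma> = {\<rho> \<in> \<Sigma>. dim \<rho> = 1}"

definition ray_generator :: "'v::euclidean_space set \<Rightarrow> 'v set \<Rightarrow> 'v" where
  "ray_generator N \<rho> = (THE u. \<rho> \<inter> N = range (\<lambda>n::nat. real n *\<^sub>R u))"

definition maximal_cones :: "'v::euclidean_space set set \<Rightarrow> 'v set set" where
  "maximal_cones \<Sigma> = {\<sigma> \<in> \<Sigma>. \<forall>\<tau>\<in>\<Sigma>. \<sigma> \<subseteq> \<tau> \<longrightarrow> \<tau> = \<sigma>}"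


section \<open>Picard group and Cox ring\<close>

text \<open>
  Torus-invariant divisors form the free abelian group on the rays, and the principal ones are
  \<open>div(\<chi>\<^sup>m) = \<Sum>\<rho>. \<langle>m, u\<^sub>\<rho>\<rangle> D\<^sub>\<rho>\<close> for \<open>m \<in> M\<close>.  On a smooth toric variety every Weil divisor is Cartier,
  so that the Picard group is the quotient.  It is written multiplicatively, as always in
  HOL-Algebra.
\<close>

definition principal_divisors ::
    "'v::euclidean_space set \<Rightarrow> 'v set set \<Rightarrow> ('v set \<Rightarrow>\<^sub>0 int) set" where
  "principal_divisors N \<Sigma> = {D \<in> carrier (free_Abelian_group (rays \<Sigma>)).
     \<exists>m\<in>dual_lattice N. \<forall>\<rho>\<in>rays \<Sigma>.
       real_of_int (Poly_Mapping.lookup D \<rho>) = m \<bullet> ray_generator N \<rho>}"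

definition Pic ::
    "'v::euclidean_space set \<Rightarrow> 'v set set \<Rightarrow> ('v set \<Rightarrow>\<^sub>0 int) set monoid" where
  "Pic N \<Sigma> = free_Abelian_group (rays \<Sigma>) Mod principal_divisors N \<Sigma>"

definition divisor_class ::
    "'v::euclidean_space set \<Rightarrow> 'v set set \<Rightarrow> ('v set \<Rightarrow>\<^sub>0 int) \<Rightarrow> ('v set \<Rightarrow>\<^sub>0 int) set" where
  "divisor_class N \<Sigma> D = principal_divisors N \<Sigma> #>\<^bsub>free_Abelian_group (rays \<Sigma>)\<^esub> D"

text \<open>
  Exponent vectors of monomials are finitely supported functions from the rays to the natural
  numbers; a polynomial is a finitely supported function from exponent vectors to coefficients.
  The Cox ring is the subring of those polynomials in which only the rays of \<open>\<Sigma>\<close> occur as variables.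
\<close>

type_synonym ('v, 'k) cox_poly = "('v set \<Rightarrow>\<^sub>0 nat) \<Rightarrow>\<^sub>0 'k"

definition cox_ring :: "'v::euclidean_space set set \<Rightarrow> ('v, 'k::field) cox_poly ring" where
  "cox_ring \<Sigma> =
     \<lparr>carrier = {p. \<forall>t\<in>Poly_Mapping.keys p. Poly_Mapping.keys t \<subseteq> rays \<Sigma>},
      monoid.mult = (*), monoid.one = 1, ring.zero = 0, ring.add = (+)\<rparr>"

definition cox_var :: "'v::euclidean_space set \<Rightarrow> ('v, 'k::field) cox_poly" where
  "cox_var \<rho> = Poly_Mapping.single (Poly_Mapping.single \<rho> 1) 1"

definition irrelevant_ideal ::
    "'v::euclidean_space set set \<Rightarrow> ('v, 'k::field) cox_poly set" where
  "irrelevant_ideal \<Sigma> = Idl\<^bsub>cox_ring \<Sigma>\<^esub>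
     {\<Prod>\<rho>\<in>{\<rho> \<in> rays \<Sigma>. \<not> \<rho> \<subseteq> \<sigma>}. cox_var \<rho> | \<sigma>. \<sigma> \<in> maximal_cones \<Sigma>}"

definition monomial_degree ::
    "'v::euclidean_space set \<Rightarrow> 'v set set \<Rightarrow> ('v set \<Rightarrow>\<^sub>0 nat) \<Rightarrow> ('v set \<Rightarrow>\<^sub>0 int) set" where
  "monomial_degree N \<Sigma> t = divisor_class N \<Sigma> (Poly_Mapping.map int t)"

definition homogeneous ::
    "'v::euclidean_space set \<Rightarrow> 'v set set \<Rightarrow> ('v set \<Rightarrow>\<^sub>0 int) set \<Rightarrow> ('v, 'k::field) cox_poly \<Rightarrow> bool"
  where
  "homogeneous N \<Sigma> d p \<longleftrightarrow>
     p \<in> carrier (cox_ring \<Sigma>) \<and> (\<forall>t\<in>Poly_Mapping.keys p. monomial_degree N \<Sigma> t = d)"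

text \<open>
  A graded free module of finite rank is given by a finite homogeneous basis together with the
  degrees of its members.  A matrix (first index: row) describes a map of degree zero iff its entry
  in row \<open>r\<close> and column \<open>c\<close> is homogeneous of degree \<open>deg c - deg r\<close>.
\<close>

definition graded_matrix ::
    "'v::euclidean_space set \<Rightarrow> 'v set set \<Rightarrow>
     'r set \<Rightarrow> ('r \<Rightarrow> ('v set \<Rightarrow>\<^sub>0 int) set) \<Rightarrow> 'c set \<Rightarrow> ('c \<Rightarrow> ('v set \<Rightarrow>\<^sub>0 int) set) \<Rightarrow>
     ('r \<Rightarrow> 'c \<Rightarrow> ('v, 'k::field) cox_poly) \<Rightarrow> bool" where
  "graded_matrix N \<Sigma> Rs rdeg Cs cdeg A \<longleftrightarrow>
     finite Rs \<and> finite Cs \<and>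
     (\<forall>r\<in>Rs. rdeg r \<in> carrier (Pic N \<Sigma>)) \<and> (\<forall>c\<in>Cs. cdeg c \<in> carrier (Pic N \<Sigma>)) \<and>
     (\<forall>r\<in>Rs. \<forall>c\<in>Cs.
        homogeneous N \<Sigma> (cdeg c \<otimes>\<^bsub>Pic N \<Sigma>\<^esub> inv\<^bsub>Pic N \<Sigma>\<^esub> rdeg r) (A r c))"


section \<open>Minors, saturation and depth\<close>

definition ring_sign :: "('a, 'b) ring_scheme \<Rightarrow> nat \<Rightarrow> 'a" where
  "ring_sign R n = (\<ominus>\<^bsub>R\<^esub> \<one>\<^bsub>R\<^esub>) [^]\<^bsub>R\<^esub> n"

definition ring_det :: "('a, 'b) ring_scheme \<Rightarrow> nat \<Rightarrow> (nat \<Rightarrow> nat \<Rightarrow> 'a) \<Rightarrow> 'a" where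
  "ring_det R n A = (\<Oplus>\<^bsub>R\<^esub>\<pi>\<in>{\<pi>. \<pi> permutes {..<n}}.
     ring_sign R (if evenperm \<pi> then 0 else 1) \<otimes>\<^bsub>R\<^esub> (\<Otimes>\<^bsub>R\<^esub>p\<in>{..<n}. A p (\<pi> p)))"

definition minor ::
    "('a, 'b) ring_scheme \<Rightarrow> (nat \<Rightarrow> nat \<Rightarrow> 'a) \<Rightarrow> nat set \<Rightarrow> nat set \<Rightarrow> 'a" where
  "minor R A I J = ring_det R (card I)
     (\<lambda>p q. A (sorted_list_of_set I ! p) (sorted_list_of_set J ! q))"

definition minors_ideal ::
    "('a, 'b) ring_scheme \<Rightarrow> nat \<Rightarrow> nat \<Rightarrow> (nat \<Rightarrow> nat \<Rightarrow> 'a) \<Rightarrow> int \<Rightarrow> 'a set" where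
  "minors_ideal R g f A m =
     (if m \<le> 0 then carrier R
      else Idl\<^bsub>R\<^esub> {minor R A I J | I J.
             I \<subseteq> {..<g} \<and> J \<subseteq> {..<f} \<and> int (card I) = m \<and> int (card J) = m})"

primrec ideal_power :: "('a, 'b) ring_scheme \<Rightarrow> 'a set \<Rightarrow> nat \<Rightarrow> 'a set" where
  "ideal_power R I 0 = carrier R"
| "ideal_power R I (Suc n) = ideal_prod R I (ideal_power R I n)"

definition ideal_colon :: "('a, 'b) ring_scheme \<Rightarrow> 'a set \<Rightarrow> 'a set \<Rightarrow> 'a set" where
  "ideal_colon R I J = {r \<in> carrier R. \<forall>s\<in>J. r \<otimes>\<^bsub>R\<^esub> s \<in> I}"

definition saturation :: "('a, 'b) ring_scheme \<Rightarrow> 'a set \<Rightarrow> 'a set \<Rightarrow> 'a set" where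
  "saturation R I J = (\<Union>n. ideal_colon R I (ideal_power R J n))"

definition regular_sequence :: "('a, 'b) ring_scheme \<Rightarrow> 'a list \<Rightarrow> bool" where
  "regular_sequence R xs \<longleftrightarrow>
     set xs \<subseteq> carrier R \<and> Idl\<^bsub>R\<^esub> (set xs) \<noteq> carrier R \<and>
     (\<forall>n<length xs. \<forall>r\<in>carrier R.
        r \<otimes>\<^bsub>R\<^esub> xs ! n \<in> Idl\<^bsub>R\<^esub> (set (take n xs)) \<longrightarrow> r \<in> Idl\<^bsub>R\<^esub> (set (take n xs)))"

definition ideal_depth :: "('a, 'b) ring_scheme \<Rightarrow> 'a set \<Rightarrow> enat" where
  "ideal_depth R I =
     (if I = carrier R then \<infinity>
      else (SUP xs\<in>{xs. regular_sequence R xs \<and> set xs \<subseteq> I}. enat (length xs)))"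


section \<open>Complexes of based free modules\<close>

text \<open>
  \<open>cx_basis C j\<close> is a basis of the \<open>j\<close>-th module \<open>F\<^sub>j\<close>, and \<open>cx_diff C j\<close> (for \<open>j \<ge> 1\<close>) is the matrix
  of \<open>F\<^sub>j \<rightarrow> F\<^sub>j\<^sub>-\<^sub>1\<close> with rows indexed by \<open>cx_basis C (j - 1)\<close> and columns by \<open>cx_basis C j\<close>.
  Values of \<open>cx_diff\<close> outside these index sets, or for \<open>j = 0\<close>, are irrelevant.
\<close>

record ('c, 'a) based_complex =
  cx_basis :: "nat \<Rightarrow> 'c set"
  cx_diff :: "nat \<Rightarrow> 'c \<Rightarrow> 'c \<Rightarrow> 'a"

definition chains :: "('a, 'b) ring_scheme \<Rightarrow> ('c, 'a) based_complex \<Rightarrow> nat \<Rightarrow> ('c \<Rightarrow> 'a) set" where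
  "chains R C j = cx_basis C j \<rightarrow>\<^sub>E carrier R"

definition boundary_map ::
    "('a, 'b) ring_scheme \<Rightarrow> ('c, 'a) based_complex \<Rightarrow> nat \<Rightarrow> ('c \<Rightarrow> 'a) \<Rightarrow> ('c \<Rightarrow> 'a)" where
  "boundary_map R C j z =
     (\<lambda>r\<in>cx_basis C (j - 1). \<Oplus>\<^bsub>R\<^esub>c\<in>cx_basis C j. cx_diff C j r c \<otimes>\<^bsub>R\<^esub> z c)"

definition cycles :: "('a, 'b) ring_scheme \<Rightarrow> ('c, 'a) based_complex \<Rightarrow> nat \<Rightarrow> ('c \<Rightarrow> 'a) set" where
  "cycles R C j =
     {z \<in> chains R C j. boundary_map R C j z = (\<lambda>r\<in>cx_basis C (j - 1). \<zero>\<^bsub>R\<^esub>)}"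

definition boundaries ::
    "('a, 'b) ring_scheme \<Rightarrow> ('c, 'a) based_complex \<Rightarrow> nat \<Rightarrow> ('c \<Rightarrow> 'a) set" where
  "boundaries R C j = boundary_map R C (Suc j) ` chains R C (Suc j)"

definition is_complex :: "('a, 'b) ring_scheme \<Rightarrow> ('c, 'a) based_complex \<Rightarrow> bool" where
  "is_complex R C \<longleftrightarrow>
     (\<forall>j\<ge>1. \<forall>r\<in>cx_basis C (j - 1). \<forall>c\<in>cx_basis C j. cx_diff C j r c \<in> carrier R) \<and>
     (\<forall>j\<ge>1. boundaries R C j \<subseteq> cycles R C j)"

text \<open>\<open>I H\<^sub>j(C) = 0\<close>, where \<open>H\<^sub>j(C)\<close> is the quotient of the cycles by the boundaries (\<open>j \<ge> 1\<close>).\<close>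

definition annihilates_homology ::
    "('a, 'b) ring_scheme \<Rightarrow> 'a set \<Rightarrow> ('c, 'a) based_complex \<Rightarrow> nat \<Rightarrow> bool" where
  "annihilates_homology R I C j \<longleftrightarrow>
     (\<forall>s\<in>I. \<forall>z\<in>cycles R C j. (\<lambda>c\<in>cx_basis C j. s \<otimes>\<^bsub>R\<^esub> z c) \<in> boundaries R C j)"

text \<open>The argument \<open>dg\<close> gives the Picard degrees of the basis elements of the modules in \<open>C\<close>.\<close>

definition virtual_resolution ::
    "'v::euclidean_space set \<Rightarrow> 'v set set \<Rightarrow> ('c, ('v, 'k::field) cox_poly) based_complex \<Rightarrow>
     (nat \<Rightarrow> 'c \<Rightarrow> ('v set \<Rightarrow>\<^sub>0 int) set) \<Rightarrow> bool" where
  "virtual_resolution N \<Sigma> C dg \<longleftrightarrow>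
     (\<forall>j\<ge>1. graded_matrix N \<Sigma> (cx_basis C (j - 1)) (dg (j - 1)) (cx_basis C j) (dg j) (cx_diff C j)) \<and>
     is_complex (cox_ring \<Sigma>) C \<and>
     (\<forall>j\<ge>1. \<exists>n. annihilates_homology (cox_ring \<Sigma>)
                     (ideal_power (cox_ring \<Sigma>) (irrelevant_ideal \<Sigma>) n) C j)"


section \<open>Generalized Eagon-Northcott complexes\<close>

text \<open>
  Let \<open>x\<^sub>0, \<dots>, x\<^sub>f\<^sub>-\<^sub>1\<close> and \<open>y\<^sub>0, \<dots>, y\<^sub>g\<^sub>-\<^sub>1\<close> be bases of \<open>F\<close> and \<open>G\<close>, with \<open>\<phi>(x\<^sub>a) = \<Sum>t<g. \<phi> t a \<cdot> y\<^sub>t\<close>.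
  A pair \<open>(A, w)\<close> of a set and a multiset stands for the basis element consisting of
  \<open>x\<^sub>A\<close>, the wedge of the \<open>x\<^sub>a\<close>, \<open>a \<in> A\<close>, in increasing order, tensored with the monomial
  \<open>y\<^sup>w\<close> of the symmetric power if \<open>j \<le> i\<close>, and otherwise with the element dual to \<open>y\<^sup>w\<close> and the
  element dual to \<open>y\<^sub>0 \<and> \<dots> \<and> y\<^sub>g\<^sub>-\<^sub>1\<close>.  Sizes are compared as integers because exponents may be negative,
  in which case the power is the zero module.
\<close>

definition en_length :: "nat \<Rightarrow> nat \<Rightarrow> int \<Rightarrow> nat" where
  "en_length f g i = (if i \<le> int f - int g then f - g + 1 else min (nat i) f)"

definition en_basis :: "nat \<Rightarrow> nat \<Rightarrow> int \<Rightarrow> nat \<Rightarrow> (nat set \<times> nat multiset) set" where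
  "en_basis f g i j =
     (if j > en_length f g i then {}
      else if int j \<le> i then
        {(A, w). A \<subseteq> {..<f} \<and> set_mset w \<subseteq> {..<g} \<and>
                 card A = j \<and> int (size w) = i - int j}
      else
        {(A, w). A \<subseteq> {..<f} \<and> set_mset w \<subseteq> {..<g} \<and>
                 int (card A) = int g + int j - 1 \<and> int (size w) = int j - i - 1})"

text \<open>The sign \<open>(-1)\<^sup>t\<^sup>-\<^sup>1\<close>, where \<open>a\<close> is the \<open>t\<close>-th smallest element of \<open>A\<close>.\<close>

definition position_sign :: "('a, 'b) ring_scheme \<Rightarrow> nat set \<Rightarrow> nat \<Rightarrow> 'a" where
  "position_sign R A a = ring_sign R (card {a' \<in> A. a' < a})"

text \<open>
  The sign of the permutation listing \<open>T\<close> in increasing order followed by \<open>U\<close> in increasing order,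
  computed from its number of inversions.
\<close>

definition shuffle_sign :: "('a, 'b) ring_scheme \<Rightarrow> nat set \<Rightarrow> nat set \<Rightarrow> 'a" where
  "shuffle_sign R T U = ring_sign R (card {(t, u). t \<in> T \<and> u \<in> U \<and> u < t})"

text \<open>
  Matrices of \<open>\<delta>\<close>, \<open>\<partial>\<close> and \<open>\<epsilon>\<close>: the coefficient at the basis element \<open>(B, v)\<close> of the image of the
  basis element \<open>(A, w)\<close>.  Each double sum has at most one term.  In \<open>\<partial>\<close>, the functional
  \<open>\<lambda>(y\<^sub>t \<cdot> -)\<close>, for \<open>\<lambda>\<close> dual to \<open>y\<^sup>w\<close>, is dual to \<open>y\<^sup>v\<close> if \<open>w = v + {t}\<close>, and zero if there is no such \<open>v\<close>.
\<close>

definition en_delta ::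
    "('a, 'b) ring_scheme \<Rightarrow> nat \<Rightarrow> (nat \<Rightarrow> nat \<Rightarrow> 'a) \<Rightarrow>
     nat set \<times> nat multiset \<Rightarrow> nat set \<times> nat multiset \<Rightarrow> 'a" where
  "en_delta R g \<phi> = (\<lambda>(B, v) (A, w).
     \<Oplus>\<^bsub>R\<^esub>a\<in>{a \<in> A. B = A - {a}}. \<Oplus>\<^bsub>R\<^esub>t\<in>{t \<in> {..<g}. v = add_mset t w}.
       position_sign R A a \<otimes>\<^bsub>R\<^esub> \<phi> t a)"

definition en_partial ::
    "('a, 'b) ring_scheme \<Rightarrow> nat \<Rightarrow> (nat \<Rightarrow> nat \<Rightarrow> 'a) \<Rightarrow>
     nat set \<times> nat multiset \<Rightarrow> nat set \<times> nat multiset \<Rightarrow> 'a" where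
  "en_partial R g \<phi> = (\<lambda>(B, v) (A, w).
     \<Oplus>\<^bsub>R\<^esub>a\<in>{a \<in> A. B = A - {a}}. \<Oplus>\<^bsub>R\<^esub>t\<in>{t \<in> {..<g}. w = add_mset t v}.
       position_sign R A a \<otimes>\<^bsub>R\<^esub> \<phi> t a)"

definition en_splice ::
    "('a, 'b) ring_scheme \<Rightarrow> nat \<Rightarrow> (nat \<Rightarrow> nat \<Rightarrow> 'a) \<Rightarrow>
     nat set \<times> nat multiset \<Rightarrow> nat set \<times> nat multiset \<Rightarrow> 'a" where
  "en_splice R g \<phi> = (\<lambda>(B, v) (A, w).
     if B \<subseteq> A then shuffle_sign R (A - B) B \<otimes>\<^bsub>R\<^esub> minor R \<phi> {..<g} (A - B) else \<zero>\<^bsub>R\<^esub>)"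

definition en_complex ::
    "('a, 'b) ring_scheme \<Rightarrow> nat \<Rightarrow> nat \<Rightarrow> (nat \<Rightarrow> nat \<Rightarrow> 'a) \<Rightarrow> int \<Rightarrow>
     (nat set \<times> nat multiset, 'a) based_complex" where
  "en_complex R f g \<phi> i =
     \<lparr>cx_basis = en_basis f g i,
      cx_diff = (\<lambda>j. if int j \<le> i then en_delta R g \<phi>
                     else if int j = i + 1 then en_splice R g \<phi>
                     else en_partial R g \<phi>)\<rparr>"

text \<open>
  The induced grading, where \<open>xdeg\<close> and \<open>ydeg\<close> are the degrees of the bases of \<open>F\<close> and \<open>G\<close>;
  \<open>P\<close> is the grading group, in multiplicative notation.
\<close>

definition en_degree ::
    "('d, 'e) monoid_scheme \<Rightarrow> nat \<Rightarrow> (nat \<Rightarrow> 'd) \<Rightarrow> (nat \<Rightarrow> 'd) \<Rightarrow> int \<Rightarrow>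
     nat \<Rightarrow> nat set \<times> nat multiset \<Rightarrow> 'd" where
  "en_degree P g xdeg ydeg i j = (\<lambda>(A, w).
     let xA = (\<Otimes>\<^bsub>P\<^esub>a\<in>A. xdeg a); yw = (\<Otimes>\<^bsub>P\<^esub>t\<in>set_mset w. ydeg t [^]\<^bsub>P\<^esub> count w t)
     in if int j \<le> i then xA \<otimes>\<^bsub>P\<^esub> yw
        else xA \<otimes>\<^bsub>P\<^esub> inv\<^bsub>P\<^esub> yw \<otimes>\<^bsub>P\<^esub> inv\<^bsub>P\<^esub> (\<Otimes>\<^bsub>P\<^esub>t\<in>{..<g}. ydeg t))"

end

theory Submission
  imports Defs "HOL-Library.Function_Algebras" "Jordan_Normal_Form.Determinant"
begin

text \<open>
  It suffices to invert one monomial generator \<open>b\<close> of the irrelevant ideal at a time, keeping track of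
  powers of \<open>b\<close> uniformly; the depth conditions then concern the ideals \<open>I\<^sub>m(\<phi>)\<close> themselves, since an
  element of the saturation of \<open>I\<^sub>m(\<phi>)\<close> lies in \<open>I\<^sub>m(\<phi>)\<close> after multiplication by a power of \<open>b\<close>.  By the
  acyclicity lemma, a complex of free modules of length \<open>e\<close> is acyclic as soon as its homology is
  killed by powers of the members of a regular sequence of length \<open>e\<close>.

  If \<open>i \<le> f - g\<close>, a maximal minor \<open>\<Delta>\<close> of \<open>\<phi>\<close> provides vectors mapped by \<open>\<phi>\<close> to \<open>\<Delta>\<close> times the basis
  vectors of \<open>G\<close>.  Wedging with them and contracting with the rows of \<open>\<phi>\<close> satisfy Clifford relations,
  which yield characteristic-free contracting homotopies, so that \<open>\<Delta>\<^sup>g\<close> kills the homology.  If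
  \<open>i > f - g\<close>, the complex is a strand of a Koszul complex over \<open>Sym G\<close>.  Over the locus where an entry
  \<open>a\<close> of \<open>\<phi>\<close> is invertible, it has the homology of the strand belonging to the Schur complement of \<open>a\<close>,
  a matrix with one row and one column less, whose ideals of minors have index one less; hence
  induction on \<open>g\<close> shows that the entries, and all the more \<open>I\<^sub>f\<^sub>-\<^sub>e\<^sub>+\<^sub>1(\<phi>)\<close>, act nilpotently on the homology.
\<close>


section \<open>Ideals, radicals and weakly regular sequences\<close>

text \<open>The algebra takes place in the ring of all polynomials, whose operations are total; the
  Cox ring is a subring over which it is free. Freeness keeps sequences weakly regular upstairs, and
  the coordinate of the monomial 1 carries a bounding chain back down. Localisations are never
  formed: "zero after inverting b" becomes membership of b in the radical of an annihilator, with
  one exponent for all cycles. The acyclicity lemma wants as many elements as there are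
  differentials, e, and the hypothesis for m = f-e+1 supplies just e; this is the origin of the
  smallest admissible m. For i \<le> f-g it is m = g, and maximal minors are at hand. For larger i
  the depth comes in general from smaller minors, which do not make \<phi> surjective once inverted;
  so an entry is inverted instead, at the price of shrinking the matrix, and the conditions for
  larger m are what the smaller matrices require. The usual homotopy on symmetric powers divides by
  the degree, which positive characteristic forbids. Eliminating the g variables of Sym G one at a
  time costs one factor \<Delta> each, hence \<Delta>^g.\<close>

interpretation ideal: Modules.module "(*) :: 'a::comm_ring_1 \<Rightarrow> 'a \<Rightarrow> 'a"
  by unfold_locales (simp_all add: algebra_simps)

declare ideal.scale_scale [simp del]

definition radical :: "'a::comm_ring_1 set \<Rightarrow> 'a set" where
  "radical I = {r. \<exists>n. r ^ n \<in> I}"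

lemma ideal_mult: "ideal.subspace I \<Longrightarrow> x \<in> I \<Longrightarrow> x * c \<in> I"
  using ideal.subspace_scale[of I x c] by (simp add: mult.commute)

lemma ideal_power_mono: "ideal.subspace I \<Longrightarrow> r ^ n \<in> I \<Longrightarrow> n \<le> m \<Longrightarrow> r ^ m \<in> I"
  by (metis ideal.subspace_scale le_add_diff_inverse2 power_add)

lemma radicalI: "r ^ n \<in> I \<Longrightarrow> r \<in> radical I"
  by (auto simp: radical_def)

lemma radical_mono: "I \<subseteq> J \<Longrightarrow> radical I \<subseteq> radical J"
  by (auto simp: radical_def)

lemma ideal_radical:
  assumes I: "ideal.subspace I"
  shows "ideal.subspace (radical I)"
proof (rule ideal.subspaceI)
  show "0 \<in> radical I"
    using ideal.subspace_0[OF I] by (auto simp: radical_def intro: exI[of _ 1])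
next
  fix x y assume "x \<in> radical I" "y \<in> radical I"
  then obtain m n where mn: "x ^ m \<in> I" "y ^ n \<in> I" by (auto simp: radical_def)
  have "x ^ k * y ^ (m + n - k) \<in> I" if "k \<le> m + n" for k
  proof (cases "k \<ge> m")
    case True
    then show ?thesis using ideal_power_mono[OF I mn(1)] ideal_mult[OF I] by blast
  next
    case False
    then have "y ^ (m + n - k) \<in> I" by (intro ideal_power_mono[OF I mn(2)]) auto
    then show ?thesis using ideal.subspace_scale[OF I] by blast
  qed
  then have "of_nat ((m + n) choose k) * (x ^ k * y ^ (m + n - k)) \<in> I" if "k \<in> {..m + n}" for k
    by (rule ideal.subspace_scale[OF I]) (use that in simp)
  then have "(x + y) ^ (m + n) \<in> I"
    unfolding binomial_ring mult.assoc by (rule ideal.subspace_sum[OF I])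
  then show "x + y \<in> radical I" by (rule radicalI)
next
  fix c x assume "x \<in> radical I"
  then show "c * x \<in> radical I"
    by (auto simp: radical_def power_mult_distrib intro: ideal.subspace_scale[OF I])
qed

lemma radical_power: "x ^ n \<in> radical I \<Longrightarrow> x \<in> radical I"
  by (auto simp: radical_def simp flip: power_mult)

text \<open>Unlike in \<open>regular_sequence\<close>, the ideal generated may be the whole ring.
  Thus the constant sequence 1, ..., 1 qualifies, which serves when a saturation is the unit ideal
  and has infinite depth.\<close>

definition weakly_regular :: "'a::comm_ring_1 list \<Rightarrow> bool" where
  "weakly_regular xs \<longleftrightarrow> (\<forall>n<length xs. \<forall>r.
     r * xs ! n \<in> ideal.span (set (take n xs)) \<longrightarrow> r \<in> ideal.span (set (take n xs)))"

lemma weakly_regular_take: "weakly_regular xs \<Longrightarrow> weakly_regular (take n xs)"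
  by (auto simp: weakly_regular_def min_def)


section \<open>Acyclicity of bounded complexes of free modules\<close>

definition smul :: "'a::comm_ring_1 \<Rightarrow> ('i \<Rightarrow> 'a) \<Rightarrow> 'i \<Rightarrow> 'a" where
  "smul c u = (\<lambda>p. c * u p)"

lemma smul_apply [simp]: "smul c u p = c * u p"
  by (simp add: smul_def)

interpretation chain: Modules.module "smul :: 'a::comm_ring_1 \<Rightarrow> ('i \<Rightarrow> 'a) \<Rightarrow> 'i \<Rightarrow> 'a"
proof
qed (rule ext, simp only: smul_apply plus_fun_apply algebra_simps mult_1_left)+

abbreviation linear_map :: "(('i \<Rightarrow> 'a::comm_ring_1) \<Rightarrow> ('j \<Rightarrow> 'a)) \<Rightarrow> bool" where
  "linear_map \<equiv> module_hom smul smul"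

lemma linear_mapI:
  assumes "\<And>u v. f (u + v) = f u + f v" "\<And>c u. f (smul c u) = smul c (f u)"
  shows "linear_map f"
  using assms by unfold_locales auto

text \<open>For an ideal \<open>I\<close> this is \<open>I\<close> times the free module with basis
  \<open>X\<close>. Keeping \<open>I\<close> as a parameter expresses congruences modulo
  \<open>I\<close> without quotient modules.\<close>

definition coeffs_in :: "'i set \<Rightarrow> 'a::comm_ring_1 set \<Rightarrow> ('i \<Rightarrow> 'a) set" where
  "coeffs_in X I = {u. (\<forall>p. u p \<in> I) \<and> (\<forall>p. p \<notin> X \<longrightarrow> u p = 0)}"

abbreviation free_mod :: "'i set \<Rightarrow> ('i \<Rightarrow> 'a::comm_ring_1) set" where
  "free_mod X \<equiv> coeffs_in X UNIV"

lemma coeffs_in_subspace: "ideal.subspace I \<Longrightarrow> chain.subspace (coeffs_in X I)"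
  by (rule chain.subspaceI)
    (auto simp: coeffs_in_def ideal.subspace_0 ideal.subspace_add ideal.subspace_scale)

text \<open>\<open>d j\<close> acts on all functions, where linearity alone controls neither
  supports nor coefficients. The condition \<open>d_coeffs\<close>, demanded for every ideal, makes
  \<open>d\<close> compatible with reduction modulo \<open>I\<close>; for \<open>I = UNIV\<close> it
  says that \<open>d (Suc j)\<close> maps into the next module.\<close>

locale free_complex =
  fixes X :: "nat \<Rightarrow> 'i set" and d :: "nat \<Rightarrow> ('i \<Rightarrow> 'a::comm_ring_1) \<Rightarrow> ('i \<Rightarrow> 'a)"
  assumes linear: "linear_map (d j)"
    and d_coeffs: "ideal.subspace I \<Longrightarrow> u \<in> coeffs_in (X (Suc j)) I \<Longrightarrow>
          d (Suc j) u \<in> coeffs_in (X j) I"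
    and d_d: "u \<in> free_mod (X (Suc (Suc j))) \<Longrightarrow> d (Suc j) (d (Suc (Suc j)) u) = 0"
begin

definition Z :: "nat \<Rightarrow> ('i \<Rightarrow> 'a) set" where
  "Z j = {z \<in> free_mod (X j). d j z = 0}"

definition B :: "nat \<Rightarrow> ('i \<Rightarrow> 'a) set" where
  "B j = d (Suc j) ` free_mod (X (Suc j))"

definition annihilator :: "nat \<Rightarrow> 'a set" where
  "annihilator j = {r. \<forall>z\<in>Z j. smul r z \<in> B j}"

sublocale d: module_hom smul smul "d j" for j
  by (rule linear)

lemma free_mod_subspace: "chain.subspace (free_mod (X j))"
  by (rule coeffs_in_subspace) simp

lemma Z_subspace: "chain.subspace (Z j)"
  unfolding Z_def
  by (rule chain.subspaceI)
    (auto simp: d.add d.scale intro: chain.subspace_add[OF free_mod_subspace]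
       chain.subspace_scale[OF free_mod_subspace] chain.subspace_0[OF free_mod_subspace])

lemma B_subspace: "chain.subspace (B j)"
  unfolding B_def by (rule d.subspace_image[OF free_mod_subspace])

lemma annihilator_ideal: "ideal.subspace (annihilator j)"
proof (rule ideal.subspaceI)
  show "0 \<in> annihilator j"
    by (auto simp: annihilator_def chain.subspace_0[OF B_subspace])
next
  fix x y assume "x \<in> annihilator j" "y \<in> annihilator j"
  then show "x + y \<in> annihilator j"
    by (auto simp: annihilator_def chain.scale_left_distrib intro: chain.subspace_add[OF B_subspace])
next
  fix c x assume "x \<in> annihilator j"
  then show "c * x \<in> annihilator j"
    by (auto simp flip: chain.scale_scale simp: annihilator_def intro: chain.subspace_scale[OF B_subspace])
qed

text \<open>The preimage in the free module of the boundaries of the complex reduced modulo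
  \<open>I\<close>.\<close>

definition B_mod :: "'a set \<Rightarrow> nat \<Rightarrow> ('i \<Rightarrow> 'a) set" where
  "B_mod I k = {v + w |v w. v \<in> B k \<and> w \<in> coeffs_in (X k) I}"

lemma B_mod_subspace:
  assumes "ideal.subspace I" shows "chain.subspace (B_mod I k)"
proof -
  have eq: "B_mod I k = chain.span (B k \<union> coeffs_in (X k) I)"
    unfolding B_mod_def chain.span_Un chain.span_eq_iff[THEN iffD2, OF B_subspace]
      chain.span_eq_iff[THEN iffD2, OF coeffs_in_subspace[OF assms]] ..
  show ?thesis unfolding eq by (rule chain.subspace_span)
qed

lemma B_mod_iff: "u \<in> B_mod I k \<longleftrightarrow> (\<exists>w\<in>free_mod (X (Suc k)). u - d (Suc k) w \<in> coeffs_in (X k) I)"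
  unfolding B_mod_def B_def by (force simp: algebra_simps)

lemma B_mod_zero: "B_mod {0} k = B k"
proof -
  have "coeffs_in (X k) {0::'a} = {0}" by (auto simp: coeffs_in_def fun_eq_iff)
  then show ?thesis by (simp add: B_mod_def)
qed

end

lemma coeffs_in_mono: "I \<subseteq> J \<Longrightarrow> coeffs_in X I \<subseteq> coeffs_in X J"
  by (auto simp: coeffs_in_def)

lemma coeffs_in_span_insert:
  assumes "u \<in> coeffs_in X (ideal.span (insert x S))"
  obtains v where "v \<in> free_mod X" "u - smul x v \<in> coeffs_in X (ideal.span S)"
proof -
  have "\<forall>p. \<exists>k. u p - k * x \<in> ideal.span S"
    using assms by (auto simp: coeffs_in_def ideal.span_breakdown_eq)
  then obtain k where k: "\<And>p. u p - k p * x \<in> ideal.span S" by metis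
  let ?v = "\<lambda>p. if p \<in> X then k p else 0"
  have "?v \<in> free_mod X" by (auto simp: coeffs_in_def)
  moreover have "u - smul x ?v \<in> coeffs_in X (ideal.span S)"
    using k assms by (auto simp: coeffs_in_def ideal.span_zero mult.commute)
  ultimately show ?thesis by (rule that)
qed

lemma smul_coeffs_in_span: "v \<in> free_mod X \<Longrightarrow> smul x v \<in> coeffs_in X (ideal.span (insert x S))"
  by (auto simp: coeffs_in_def mult.commute[of x] intro: ideal.span_scale ideal.span_base)

lemma smul_free_mod: "u \<in> free_mod X \<Longrightarrow> smul c u \<in> free_mod X"
  by (auto simp: coeffs_in_def)

context free_complex
begin

context
  fixes b :: 'a and xs :: "'a list" and j :: nat
  assumes reg: "weakly_regular xs"
    and bound: "\<And>k. k > length xs \<Longrightarrow> X k = {}"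
    and j: "j \<ge> 1"
begin

definition J where "J s = ideal.span (set (take s xs))"

lemma J_ideal: "ideal.subspace (J s)" by (simp add: J_def)

lemma J_Suc: "s < length xs \<Longrightarrow> J (Suc s) = ideal.span (insert (xs ! s) (set (take s xs)))"
  by (simp add: J_def take_Suc_conv_app_nth)

lemma J_mono: "s < length xs \<Longrightarrow> J s \<subseteq> J (Suc s)"
  unfolding J_def by (rule ideal.span_mono) (simp add: set_take_subset_set_take)

lemma regular_coeffs:
  assumes "s < length xs" "u \<in> free_mod (X k)" "smul (xs ! s) u \<in> coeffs_in (X k) (J s)"
  shows "u \<in> coeffs_in (X k) (J s)"
proof -
  have "u p \<in> J s" for p
  proof -
    have "u p * xs ! s \<in> J s"
      using assms(3) by (simp add: coeffs_in_def mult.commute[of "u p"])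
    then show ?thesis using reg assms(1) unfolding weakly_regular_def J_def by blast
  qed
  then show ?thesis using assms(2) by (simp add: coeffs_in_def)
qed

text \<open>The homology at \<open>k\<close> of the complex modulo the first \<open>s\<close>
  elements of \<open>xs\<close> is killed by a power of \<open>b\<close>, the exponent being chosen
  before the cycle.\<close>

definition exact_mod :: "nat \<Rightarrow> nat \<Rightarrow> bool" where
  "exact_mod s k \<longleftrightarrow> (\<exists>N. \<forall>u\<in>free_mod (X k). d k u \<in> coeffs_in (X (k - 1)) (J s) \<longrightarrow>
     smul (b ^ N) u \<in> B_mod (J s) k)"

text \<open>The long exact sequence of 0 -> C/J_s -> C/J_s -> C/J_(s+1) -> 0, whose first map is
  multiplication by \<open>xs ! s\<close>, puts H_(k+1)(C/J_(s+1)) between H_(k+1)(C/J_s) and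
  H_k(C/J_s); the two exponents add up.\<close>

lemma exact_mod_Suc:
  assumes s: "s < length xs" and ex: "exact_mod s (Suc k)" "exact_mod s k" and k: "k \<ge> 1"
  shows "exact_mod (Suc s) (Suc k)"
proof -
  let ?x = "xs ! s"
  from ex obtain N M where
    N: "\<And>u. u \<in> free_mod (X (Suc k)) \<Longrightarrow> d (Suc k) u \<in> coeffs_in (X k) (J s) \<Longrightarrow>
          smul (b ^ N) u \<in> B_mod (J s) (Suc k)" and
    M: "\<And>u. u \<in> free_mod (X k) \<Longrightarrow> d k u \<in> coeffs_in (X (k - 1)) (J s) \<Longrightarrow>
          smul (b ^ M) u \<in> B_mod (J s) k"
    unfolding exact_mod_def by force
  obtain k' where k': "k = Suc k'" using k by (cases k) auto
  have "smul (b ^ (N + M)) u \<in> B_mod (J (Suc s)) (Suc k)"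
    if u: "u \<in> free_mod (X (Suc k))" and du: "d (Suc k) u \<in> coeffs_in (X k) (J (Suc s))" for u
  proof -
    from du obtain v where v: "v \<in> free_mod (X k)" "d (Suc k) u - smul ?x v \<in> coeffs_in (X k) (J s)"
      unfolding J_Suc[OF s] using coeffs_in_span_insert unfolding J_def by metis
    have "d k (d (Suc k) u - smul ?x v) \<in> coeffs_in (X k') (J s)"
      using v(2) d_coeffs[OF J_ideal] k' by auto
    moreover have "d k (d (Suc k) u) = 0" using d_d u k' by auto
    ultimately have "- smul ?x (d k v) \<in> coeffs_in (X k') (J s)"
      by (simp add: d.diff d.scale)
    then have "smul ?x (d k v) \<in> coeffs_in (X k') (J s)"
      using chain.subspace_neg[OF coeffs_in_subspace[OF J_ideal]] by fastforce
    \<comment> \<open>\<open>?x\<close> is regular modulo \<open>J s\<close>, so \<open>v\<close>,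
      which represents the image of \<open>u\<close> under the connecting homomorphism, is a cycle
      modulo \<open>J s\<close>.\<close>
    then have "d k v \<in> coeffs_in (X k') (J s)"
      using regular_coeffs[OF s, of "d k v" k'] v(1) d_coeffs[of UNIV v k'] k' by auto
    then have "smul (b ^ M) v \<in> B_mod (J s) k" using M v(1) k' by auto
    then obtain w where w: "w \<in> free_mod (X (Suc k))"
      "smul (b ^ M) v - d (Suc k) w \<in> coeffs_in (X k) (J s)"
      by (auto simp: B_mod_iff)
    have fm: "smul (b ^ M) u - smul ?x w \<in> free_mod (X (Suc k))"
      using u w(1) by (auto simp: coeffs_in_def)
    have "d (Suc k) (smul (b ^ M) u - smul ?x w)
      = smul (b ^ M) (d (Suc k) u - smul ?x v) + smul ?x (smul (b ^ M) v - d (Suc k) w)"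
      by (simp add: d.diff d.scale fun_eq_iff algebra_simps)
    also have "\<dots> \<in> coeffs_in (X k) (J s)"
      by (intro chain.subspace_add chain.subspace_scale coeffs_in_subspace J_ideal v w)
    finally have "smul (b ^ N) (smul (b ^ M) u - smul ?x w) \<in> B_mod (J s) (Suc k)"
      using N fm by blast
    then obtain y where y: "y \<in> free_mod (X (Suc (Suc k)))"
      "smul (b ^ N) (smul (b ^ M) u - smul ?x w) - d (Suc (Suc k)) y \<in> coeffs_in (X (Suc k)) (J s)"
      by (auto simp: B_mod_iff)
    have "smul (b ^ (N + M)) u - d (Suc (Suc k)) y =
       (smul (b ^ N) (smul (b ^ M) u - smul ?x w) - d (Suc (Suc k)) y) + smul ?x (smul (b ^ N) w)"
      by (simp add: fun_eq_iff algebra_simps power_add)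
    also have "\<dots> \<in> coeffs_in (X (Suc k)) (J (Suc s))"
    proof (intro chain.subspace_add coeffs_in_subspace J_ideal)
      show "smul (b ^ N) (smul (b ^ M) u - smul ?x w) - d (Suc (Suc k)) y \<in> coeffs_in (X (Suc k)) (J (Suc s))"
        using y(2) coeffs_in_mono[OF J_mono[OF s]] by blast
      show "smul ?x (smul (b ^ N) w) \<in> coeffs_in (X (Suc k)) (J (Suc s))"
        unfolding J_Suc[OF s] by (intro smul_coeffs_in_span smul_free_mod w)
    qed
    finally show ?thesis using y(1) by (auto simp: B_mod_iff)
  qed
  then show ?thesis unfolding exact_mod_def by auto
qed

lemma exact_mod_zero: "exact_mod 0 k \<longleftrightarrow> (\<exists>N. b ^ N \<in> annihilator k)"
proof -
  have "coeffs_in Y {0::'a} = {0}" for Y :: "'i set"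
    by (auto simp: coeffs_in_def fun_eq_iff)
  then show ?thesis
    by (simp add: exact_mod_def annihilator_def Z_def J_def B_mod_zero imp_conjL Ball_def)
qed

text \<open>Each further element of the sequence loses one degree, since
  \<open>exact_mod_Suc\<close> also uses exactness one degree lower; hence the bound
  \<open>j + s\<close>.\<close>

lemma exact_mod_above:
  assumes ex: "\<And>k. k > j \<Longrightarrow> b \<in> radical (annihilator k)"
  shows "s \<le> length xs \<Longrightarrow> k > j + s \<Longrightarrow> exact_mod s k"
proof (induction s arbitrary: k)
  case 0
  then show ?case using ex by (auto simp: exact_mod_zero radical_def)
next
  case (Suc s)
  then obtain k' where k': "k = Suc k'" by (cases k) auto
  show ?case unfolding k'
    by (rule exact_mod_Suc) (use Suc k' in auto)
qed

text \<open>
  Descending in \<open>s\<close>, a class killed by \<open>x\<^sub>s, \<dots>, x\<^sub>d\<close> in degree \<open>j + s\<close> modulo \<open>x\<^sub>0, \<dots>, x\<^sub>s\<^sub>-\<^sub>1\<close> is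
  traded for one in degree \<open>j + s + 1\<close> modulo one more element, until the complex ends.
\<close>

lemma killed_class_vanishes:
  assumes ex: "\<And>k. k > j \<Longrightarrow> b \<in> radical (annihilator k)"
  shows "s \<le> length xs \<Longrightarrow> \<exists>N. \<forall>u\<in>free_mod (X (j + s)). d (j + s) u \<in> coeffs_in (X (j + s - 1)) (J s) \<longrightarrow>
    (\<forall>t. s \<le> t \<and> t < length xs \<longrightarrow> smul (b ^ n * xs ! t) u \<in> B_mod (J s) (j + s)) \<longrightarrow>
    smul (b ^ N) u \<in> B_mod (J s) (j + s)"
proof (induction "length xs - s" arbitrary: s n)
  case 0
  \<comment> \<open>Here \<open>s = length xs\<close>, and \<open>j + s\<close> exceeds it because
    \<open>j\<close> is positive: the complex has ended.\<close>
  then have "X (j + s) = {}" using bound[of "j + s"] j by auto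
  then have "u = 0" if "u \<in> free_mod (X (j + s))" for u
    using that by (auto simp: coeffs_in_def fun_eq_iff)
  then show ?case
    by (intro exI[of _ 0]) (auto intro: chain.subspace_0[OF B_mod_subspace[OF J_ideal]])
next
  case (Suc l)
  then have s: "s < length xs" by auto
  let ?x = "xs ! s" and ?k = "j + s"
  obtain k' where k': "?k = Suc k'" using j by (cases j) auto
  have "exact_mod s (Suc ?k)" by (rule exact_mod_above[OF ex]) (use s in auto)
  then obtain N1 where
    N1: "\<And>u. u \<in> free_mod (X (Suc ?k)) \<Longrightarrow> d (Suc ?k) u \<in> coeffs_in (X ?k) (J s) \<Longrightarrow>
          smul (b ^ N1) u \<in> B_mod (J s) (Suc ?k)"
    unfolding exact_mod_def by force
  have "l = length xs - Suc s" "Suc s \<le> length xs" using Suc(2) s by auto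
  from Suc(1)[OF this, of N1, unfolded add_Suc_right diff_Suc_1] obtain N2 where
    N2: "\<forall>u\<in>free_mod (X (Suc ?k)). d (Suc ?k) u \<in> coeffs_in (X ?k) (J (Suc s)) \<longrightarrow>
      (\<forall>t. Suc s \<le> t \<and> t < length xs \<longrightarrow>
         smul (b ^ N1 * xs ! t) u \<in> B_mod (J (Suc s)) (Suc ?k)) \<longrightarrow>
      smul (b ^ N2) u \<in> B_mod (J (Suc s)) (Suc ?k)"
    by (elim exE)
  have "smul (b ^ (N2 + n)) u \<in> B_mod (J s) ?k"
    if u: "u \<in> free_mod (X ?k)" and du: "d ?k u \<in> coeffs_in (X (?k - 1)) (J s)"
    and kill: "\<And>t. s \<le> t \<Longrightarrow> t < length xs \<Longrightarrow> smul (b ^ n * xs ! t) u \<in> B_mod (J s) ?k" for u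
  proof -
    have "\<forall>t. \<exists>w. s \<le> t \<and> t < length xs \<longrightarrow> w \<in> free_mod (X (Suc ?k)) \<and>
          smul (b ^ n * xs ! t) u - d (Suc ?k) w \<in> coeffs_in (X ?k) (J s)"
      using kill B_mod_iff by blast
    then obtain w where w: "\<And>t. s \<le> t \<Longrightarrow> t < length xs \<Longrightarrow> w t \<in> free_mod (X (Suc ?k))"
      "\<And>t. s \<le> t \<Longrightarrow> t < length xs \<Longrightarrow>
          smul (b ^ n * xs ! t) u - d (Suc ?k) (w t) \<in> coeffs_in (X ?k) (J s)"
      by metis
    note ws = w(1)[OF order_refl s] w(2)[OF order_refl s]
    note cl = chain.subspace_diff[OF coeffs_in_subspace[OF J_ideal]]
      chain.subspace_add[OF coeffs_in_subspace[OF J_ideal]]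
      chain.subspace_scale[OF coeffs_in_subspace[OF J_ideal]]
    \<comment> \<open>\<open>w s\<close> bounds \<open>b ^ n * xs ! s\<close> times \<open>u\<close>
      modulo \<open>J s\<close>. Modulo the additional element \<open>xs ! s\<close> it is a cycle
      one degree higher, the class traded for that of \<open>u\<close>.\<close>
    have "d (Suc ?k) (w s) = smul ?x (smul (b ^ n) u) - (smul (b ^ n * ?x) u - d (Suc ?k) (w s))"
      by (simp add: fun_eq_iff algebra_simps)
    also have "\<dots> \<in> coeffs_in (X ?k) (J (Suc s))"
    proof (rule cl(1))
      show "smul ?x (smul (b ^ n) u) \<in> coeffs_in (X ?k) (J (Suc s))"
        unfolding J_Suc[OF s] by (intro smul_coeffs_in_span smul_free_mod u)
      show "smul (b ^ n * ?x) u - d (Suc ?k) (w s) \<in> coeffs_in (X ?k) (J (Suc s))"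
        using ws(2) coeffs_in_mono[OF J_mono[OF s]] by blast
    qed
    finally have dw: "d (Suc ?k) (w s) \<in> coeffs_in (X ?k) (J (Suc s))" .
    \<comment> \<open>\<open>xs ! t\<close> times \<open>w s\<close> minus \<open>xs ! s\<close>
      times \<open>w t\<close> is a cycle modulo \<open>J s\<close>, hence a boundary there up to
      \<open>b ^ N1\<close>, and its second term vanishes modulo \<open>J (Suc s)\<close>.\<close>
    have "smul (b ^ N1 * xs ! t) (w s) \<in> B_mod (J (Suc s)) (Suc ?k)"
      if t: "Suc s \<le> t" "t < length xs" for t
    proof -
      note wt = w(1)[OF _ t(2)] w(2)[OF _ t(2)]
      have fm: "smul (xs ! t) (w s) - smul ?x (w t) \<in> free_mod (X (Suc ?k))"
        using wt(1) ws(1) t by (auto simp: coeffs_in_def)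
      have "d (Suc ?k) (smul (xs ! t) (w s) - smul ?x (w t)) =
        smul ?x (smul (b ^ n * xs ! t) u - d (Suc ?k) (w t)) -
        smul (xs ! t) (smul (b ^ n * ?x) u - d (Suc ?k) (w s))"
        by (simp add: d.diff d.scale fun_eq_iff algebra_simps)
      also have "\<dots> \<in> coeffs_in (X ?k) (J s)"
        by (rule cl(1)[OF cl(3)[OF wt(2)] cl(3)[OF ws(2)]]) (use t in simp)
      finally have "smul (b ^ N1) (smul (xs ! t) (w s) - smul ?x (w t)) \<in> B_mod (J s) (Suc ?k)"
        using N1 fm by blast
      then obtain y where y: "y \<in> free_mod (X (Suc (Suc ?k)))"
        "smul (b ^ N1) (smul (xs ! t) (w s) - smul ?x (w t)) - d (Suc (Suc ?k)) y
           \<in> coeffs_in (X (Suc ?k)) (J s)"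
        by (auto simp: B_mod_iff)
      have "smul (b ^ N1 * xs ! t) (w s) - d (Suc (Suc ?k)) y =
         (smul (b ^ N1) (smul (xs ! t) (w s) - smul ?x (w t)) - d (Suc (Suc ?k)) y) +
         smul ?x (smul (b ^ N1) (w t))"
        by (simp add: fun_eq_iff algebra_simps)
      also have "\<dots> \<in> coeffs_in (X (Suc ?k)) (J (Suc s))"
      proof (rule cl(2))
        show "smul (b ^ N1) (smul (xs ! t) (w s) - smul ?x (w t)) - d (Suc (Suc ?k)) y
           \<in> coeffs_in (X (Suc ?k)) (J (Suc s))"
          using y(2) coeffs_in_mono[OF J_mono[OF s]] by blast
        show "smul ?x (smul (b ^ N1) (w t)) \<in> coeffs_in (X (Suc ?k)) (J (Suc s))"
          unfolding J_Suc[OF s] by (intro smul_coeffs_in_span smul_free_mod wt(1)) (use t in simp)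
      qed
      finally show ?thesis using y(1) by (auto simp: B_mod_iff)
    qed
    then have "smul (b ^ N2) (w s) \<in> B_mod (J (Suc s)) (Suc ?k)"
      by (intro N2[rule_format, OF ws(1) dw]) (elim conjE)
    then obtain y where y: "y \<in> free_mod (X (Suc (Suc ?k)))"
      "smul (b ^ N2) (w s) - d (Suc (Suc ?k)) y \<in> coeffs_in (X (Suc ?k)) (J (Suc s))"
      by (auto simp: B_mod_iff)
    then obtain v where v: "v \<in> free_mod (X (Suc ?k))"
      "smul (b ^ N2) (w s) - d (Suc (Suc ?k)) y - smul ?x v \<in> coeffs_in (X (Suc ?k)) (J s)"
      unfolding J_Suc[OF s] using coeffs_in_span_insert unfolding J_def by metis
    have ddy: "d (Suc ?k) (d (Suc (Suc ?k)) y) = 0" using d_d y(1) by auto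
    have fm: "smul (b ^ (N2 + n)) u - d (Suc ?k) v \<in> free_mod (X ?k)"
      using u d_coeffs[of UNIV v ?k] v(1)
      by (intro chain.subspace_diff[OF free_mod_subspace]) (auto intro: smul_free_mod)
    \<comment> \<open>Up to \<open>b ^ N2\<close>, \<open>w s\<close> is a boundary plus
      \<open>xs ! s\<close> times \<open>v\<close> modulo \<open>J s\<close>. Applying
      \<open>d\<close> shows that \<open>xs ! s\<close> kills the difference of the scaled
      \<open>u\<close> and the boundary of \<open>v\<close> modulo \<open>J s\<close>, and
      \<open>xs ! s\<close> can be cancelled.\<close>
    have "smul ?x (smul (b ^ (N2 + n)) u - d (Suc ?k) v) =
       smul (b ^ N2) (smul (b ^ n * ?x) u - d (Suc ?k) (w s)) +
       d (Suc ?k) (smul (b ^ N2) (w s) - d (Suc (Suc ?k)) y - smul ?x v)"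
      by (simp add: d.diff d.scale ddy) (simp add: fun_eq_iff algebra_simps power_add)
    also have "\<dots> \<in> coeffs_in (X ?k) (J s)"
      by (rule cl(2)[OF cl(3)[OF ws(2)] d_coeffs[OF J_ideal v(2)]])
    finally have "smul (b ^ (N2 + n)) u - d (Suc ?k) v \<in> coeffs_in (X ?k) (J s)"
      by (rule regular_coeffs[OF s fm])
    then show ?thesis using v(1) by (auto simp: B_mod_iff)
  qed
  then show ?case by blast
qed

lemma killed_cycle_vanishes:
  assumes ex: "\<And>k. k > j \<Longrightarrow> b \<in> radical (annihilator k)"
  shows "\<exists>N. \<forall>z\<in>Z j. (\<forall>t<length xs. smul (b ^ n * xs ! t) z \<in> B j) \<longrightarrow> smul (b ^ N) z \<in> B j"
proof -
  have J0: "J 0 = {0}" by (simp add: J_def)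
  have "coeffs_in Y {0::'a} = {0}" for Y :: "'i set"
    by (auto simp: coeffs_in_def fun_eq_iff)
  then show ?thesis
    using killed_class_vanishes[OF ex, of 0 n]
    by (simp add: J0 B_mod_zero Z_def imp_conjL Ball_def)
qed

text \<open>This bypasses the regularity of powers of a regular sequence. By induction on the sum of
  the exponents, the statement with the exponent of \<open>t0\<close> lowered applies to
  \<open>xs ! t0\<close> times \<open>z\<close>; so each of these multiples is killed by a power of
  \<open>b\<close>, and \<open>killed_cycle_vanishes\<close> applies.\<close>

lemma killed_cycle_vanishes_powers:
  assumes ex: "\<And>k. k > j \<Longrightarrow> b \<in> radical (annihilator k)"
  shows "(\<Sum>t<length xs. p t) = l \<Longrightarrow>
    \<exists>N. \<forall>z\<in>Z j. (\<forall>t<length xs. smul (b ^ n * xs ! t ^ p t) z \<in> B j) \<longrightarrow> smul (b ^ N) z \<in> B j"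
proof (induction l arbitrary: p n rule: less_induct)
  case (less l)
  show ?case
  proof (cases "\<exists>t<length xs. p t = 0")
    case True
    then show ?thesis by (intro exI[of _ n]) auto
  next
    case pos: False
    have "\<exists>N. \<forall>z\<in>Z j. (\<forall>t<length xs. smul (b ^ n * xs ! t ^ (p(t0 := p t0 - 1)) t) z \<in> B j) \<longrightarrow>
          smul (b ^ N) z \<in> B j" if t0: "t0 < length xs" for t0
    proof (rule less(1)[OF _ refl])
      have "(\<Sum>t<length xs. (p(t0 := p t0 - 1)) t) < (\<Sum>t<length xs. p t)"
        using pos t0 by (intro sum_strict_mono_ex1) (auto intro!: bexI[of _ t0])
      then show "(\<Sum>t<length xs. (p(t0 := p t0 - 1)) t) < l" using less(2) by simp
    qed
    then obtain N where N: "\<And>t0 z. t0 < length xs \<Longrightarrow> z \<in> Z j \<Longrightarrow>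
        (\<And>t. t < length xs \<Longrightarrow> smul (b ^ n * xs ! t ^ (p(t0 := p t0 - 1)) t) z \<in> B j) \<Longrightarrow>
        smul (b ^ N t0) z \<in> B j"
      by metis
    define M where "M = (\<Sum>t<length xs. N t)"
    obtain K where K: "\<And>z. z \<in> Z j \<Longrightarrow> (\<And>t. t < length xs \<Longrightarrow> smul (b ^ M * xs ! t) z \<in> B j) \<Longrightarrow>
        smul (b ^ K) z \<in> B j"
      using killed_cycle_vanishes[OF ex, of M] by blast
    have "smul (b ^ K) z \<in> B j"
      if z: "z \<in> Z j" and kill: "\<And>t. t < length xs \<Longrightarrow> smul (b ^ n * xs ! t ^ p t) z \<in> B j" for z
    proof (rule K[OF z])
      fix t0 assume t0: "t0 < length xs"
      have "smul (b ^ N t0) (smul (xs ! t0) z) \<in> B j"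
      proof (rule N[OF t0])
        show "smul (xs ! t0) z \<in> Z j" by (rule chain.subspace_scale[OF Z_subspace z])
      next
        fix t assume t: "t < length xs"
        show "smul (b ^ n * xs ! t ^ (p(t0 := p t0 - 1)) t) (smul (xs ! t0) z) \<in> B j"
        proof (cases "t = t0")
          case True
          have "xs ! t0 ^ p t0 = xs ! t0 ^ (p t0 - 1) * xs ! t0"
            using pos t0 by (metis power_minus_mult gr0I)
          then show ?thesis using kill[OF t0] True
            by (simp only: fun_upd_same chain.scale_scale mult.assoc)
        next
          case False
          then show ?thesis
            using chain.subspace_scale[OF B_subspace kill[OF t], of "xs ! t0"]
            by (simp only: fun_upd_other chain.scale_scale mult.commute[of "xs ! t0"] not_False_eq_True)
        qed
      qed
      then have "smul (b ^ (M - N t0)) (smul (b ^ N t0) (smul (xs ! t0) z)) \<in> B j"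
        by (rule chain.subspace_scale[OF B_subspace])
      moreover have "b ^ (M - N t0) * (b ^ N t0 * xs ! t0) = b ^ M * xs ! t0"
      proof -
        have "N t0 \<le> M" unfolding M_def using t0 by (intro member_le_sum) auto
        then show ?thesis by (simp flip: power_add mult.assoc)
      qed
      ultimately show "smul (b ^ M * xs ! t0) z \<in> B j"
        by (simp only: chain.scale_scale)
    qed
    then show ?thesis by blast
  qed
qed

end

text \<open>A uniform version of the acyclicity lemma of Peskine and Szpiro, after inverting \<open>b\<close>.\<close>

theorem acyclicity:
  assumes reg: "weakly_regular xs"
    and bound: "\<And>k. k > length xs \<Longrightarrow> X k = {}"
    and kill: "\<And>x k. x \<in> set xs \<Longrightarrow> k \<ge> 1 \<Longrightarrow> b * x \<in> radical (annihilator k)"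
    and j: "j \<ge> 1"
  shows "b \<in> radical (annihilator j)"
  using j
\<comment> \<open>Downward induction on the degree, since the argument in degree \<open>j\<close>
  uses exactness in all higher degrees.\<close>
proof (induction "Suc (length xs) - j" arbitrary: j rule: less_induct)
  case less
  have ex: "b \<in> radical (annihilator k)" if "k > j" for k
  proof (cases "k > length xs")
    case True
    then have "Z k \<subseteq> {0}" using bound by (auto simp: Z_def coeffs_in_def fun_eq_iff)
    then have "b ^ 0 \<in> annihilator k" by (auto simp: annihilator_def chain.subspace_0[OF B_subspace])
    then show ?thesis by (rule radicalI)
  next
    case False
    then show ?thesis using less that by auto
  qed
  have "\<forall>t. \<exists>p. t < length xs \<longrightarrow> (b * xs ! t) ^ p \<in> annihilator j"
    using kill[OF _ less(2)] by (auto simp: radical_def)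
  then obtain p where p: "\<And>t. t < length xs \<Longrightarrow> (b * xs ! t) ^ p t \<in> annihilator j" by metis
  define n where "n = (\<Sum>t<length xs. p t)"
  have "b ^ n * xs ! t ^ p t \<in> annihilator j" if t: "t < length xs" for t
  proof -
    have "p t \<le> n" unfolding n_def using t by (intro member_le_sum) auto
    then have "b ^ n * xs ! t ^ p t = b ^ (n - p t) * (b * xs ! t) ^ p t"
      by (simp add: power_mult_distrib flip: power_add mult.assoc)
    then show ?thesis using p[OF t] ideal.subspace_scale[OF annihilator_ideal] by metis
  qed
  moreover obtain N where "\<And>z. z \<in> Z j \<Longrightarrow>
      (\<forall>t<length xs. smul (b ^ n * xs ! t ^ p t) z \<in> B j) \<Longrightarrow> smul (b ^ N) z \<in> B j"
    using killed_cycle_vanishes_powers[OF reg bound less(2) ex refl, where p = p and n = n] by blast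
  ultimately have "b ^ N \<in> annihilator j" by (auto simp: annihilator_def)
  then show ?case by (rule radicalI)
qed

end


section \<open>Exterior algebra with coefficients in polynomials or inverse polynomials\<close>

text \<open>
  The value at \<open>(A, w)\<close> is the coefficient of \<open>x\<^sub>A\<close> tensored with \<open>y\<^sup>w\<close> or with its dual; supports are not
  restricted.  Multiplication by \<open>y\<^sub>t\<close> is \<open>mulvar t\<close> on symmetric powers, and its transpose \<open>shift t\<close>
  on their duals.
\<close>

type_synonym 'a chain = "nat set \<times> nat multiset \<Rightarrow> 'a"

text \<open>For \<open>a\<close> not in \<open>B\<close>, the sign produced by sorting the wedge of
  x_a with x_B.\<close>

definition insertion_sign :: "nat set \<Rightarrow> nat \<Rightarrow> 'a::comm_ring_1" where
  "insertion_sign B a = (- 1) ^ card {x \<in> B. x < a}"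

text \<open>Interior multiplication by the functional sending x_a to \<open>l a\<close>, written on
  coefficients: the one at \<open>B\<close> receives contributions from all sets
  \<open>insert a B\<close>.\<close>

definition contract :: "nat set \<Rightarrow> (nat \<Rightarrow> 'a::comm_ring_1) \<Rightarrow> 'a chain \<Rightarrow> 'a chain" where
  "contract F l u = (\<lambda>(B, v). \<Sum>a\<in>F - B. insertion_sign B a * l a * u (insert a B, v))"

definition wedge :: "nat \<Rightarrow> 'a::comm_ring_1 chain \<Rightarrow> 'a chain" where
  "wedge c u = (\<lambda>(A, v). if c \<in> A then insertion_sign A c * u (A - {c}, v) else 0)"

definition mulvar :: "nat \<Rightarrow> 'a::comm_ring_1 chain \<Rightarrow> 'a chain" where
  "mulvar t u = (\<lambda>(B, v). if t \<in># v then u (B, v - {#t#}) else 0)"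

definition shift :: "nat \<Rightarrow> 'a::comm_ring_1 chain \<Rightarrow> 'a chain" where
  "shift t u = (\<lambda>(B, v). u (B, add_mset t v))"

text \<open>The projection to the terms free of y_t. It measures how far \<open>mulvar t\<close> and
  \<open>shift t\<close> are from being mutually inverse, and allows elimination of one variable at
  a time.\<close>

definition omit :: "nat \<Rightarrow> 'a::comm_ring_1 chain \<Rightarrow> 'a chain" where
  "omit t u = (\<lambda>(B, v). if t \<in># v then 0 else u (B, v))"

lemma contract_apply: "contract F l u (B, v) = (\<Sum>a\<in>F - B. insertion_sign B a * l a * u (insert a B, v))"
  and wedge_apply: "wedge c u (B, v) = (if c \<in> B then insertion_sign B c * u (B - {c}, v) else 0)"
  and mulvar_apply: "mulvar t u (B, v) = (if t \<in># v then u (B, v - {#t#}) else 0)"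
  and shift_apply: "shift t u (B, v) = u (B, add_mset t v)"
  and omit_apply: "omit t u (B, v) = (if t \<in># v then 0 else u (B, v))"
  by (simp_all add: contract_def wedge_def mulvar_def shift_def omit_def)

lemmas chain_apply = contract_apply wedge_apply mulvar_apply shift_apply omit_apply

lemma chain_eqI: "(\<And>B v. u (B, v) = w (B, v)) \<Longrightarrow> u = (w :: 'a chain)"
  by auto

lemma linear_contract: "linear_map (contract F l)"
  by (rule linear_mapI; rule chain_eqI)
    (simp_all add: contract_apply distrib_left sum.distrib sum_distrib_left mult_ac)

lemma linear_wedge: "linear_map (wedge c)"
  by (rule linear_mapI; rule chain_eqI) (simp_all add: wedge_apply algebra_simps)

lemma linear_mulvar: "linear_map (mulvar t)"
  by (rule linear_mapI; rule chain_eqI) (simp_all add: mulvar_apply)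

lemma linear_shift: "linear_map (shift t)"
  by (rule linear_mapI; rule chain_eqI) (simp_all add: shift_apply)

lemma linear_omit: "linear_map (omit t)"
  by (rule linear_mapI; rule chain_eqI) (simp_all add: omit_apply)

interpretation contract: module_hom smul smul "contract F l" by (rule linear_contract)
interpretation wedge: module_hom smul smul "wedge c" by (rule linear_wedge)
interpretation mulvar: module_hom smul smul "mulvar t" by (rule linear_mulvar)
interpretation shift: module_hom smul smul "shift t" by (rule linear_shift)
interpretation omit: module_hom smul smul "omit t" by (rule linear_omit)

lemma contract_add_left: "contract F (\<lambda>a. l a + m a) u = contract F l u + contract F m u"
  by (rule chain_eqI) (simp add: contract_apply algebra_simps sum.distrib)

lemma contract_diff_left: "contract F (\<lambda>a. l a - m a) u = contract F l u - contract F m u"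
  by (rule chain_eqI) (simp add: contract_apply algebra_simps sum_subtractf)

lemma contract_scale_left: "contract F (\<lambda>a. c * l a) u = smul c (contract F l u)"
  by (rule chain_eqI) (simp add: contract_apply sum_distrib_left mult_ac)

text \<open>Vanishing on the diagonal is a separate hypothesis because antisymmetry does not imply
  it in characteristic 2.\<close>

lemma sum_alternating:
  fixes f :: "'b \<Rightarrow> 'b \<Rightarrow> 'c::ab_group_add"
  assumes "finite G" "\<And>s. s \<in> G \<Longrightarrow> f s s = 0"
    "\<And>s t. s \<in> G \<Longrightarrow> t \<in> G \<Longrightarrow> s \<noteq> t \<Longrightarrow> f s t = - f t s"
  shows "(\<Sum>s\<in>G. \<Sum>t\<in>G. f s t) = 0"
  using assms
proof (induction G rule: finite_induct)
  case (insert x G)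
  have "(\<Sum>s\<in>G. f s x) = (\<Sum>s\<in>G. - f x s)"
    using insert.hyps by (intro sum.cong insert.prems refl) auto
  moreover have "(\<Sum>s\<in>insert x G. \<Sum>t\<in>insert x G. f s t) =
      f x x + (\<Sum>t\<in>G. f x t) + ((\<Sum>s\<in>G. f s x) + (\<Sum>s\<in>G. \<Sum>t\<in>G. f s t))"
    using insert.hyps by (simp add: sum.distrib)
  moreover have "(\<Sum>s\<in>G. \<Sum>t\<in>G. f s t) = 0"
  proof (rule insert.IH)
    show "f s s = 0" if "s \<in> G" for s
      by (rule insert.prems(1)) (rule insertI2[OF that])
    show "f s t = - f t s" if "s \<in> G" "t \<in> G" "s \<noteq> t" for s t
      by (rule insert.prems(2)) (rule insertI2[OF that(1)] insertI2[OF that(2)] that(3))+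
  qed
  moreover have "f x x = 0" by (rule insert.prems) simp
  ultimately show ?case by (simp add: sum_negf)
next
  case empty
  show ?case by simp
qed

lemma insertion_sign_square: "insertion_sign B a * (insertion_sign B a * x) = (x :: 'a::comm_ring_1)"
proof -
  have "insertion_sign B a * insertion_sign B a = (1 :: 'a)"
    unfolding insertion_sign_def power_mult_distrib[symmetric] by simp
  then show ?thesis by (simp only: mult.assoc[symmetric] mult_1_left)
qed

lemma insertion_sign_insert:
  "insertion_sign (insert a B) b =
     (if a < b \<and> a \<notin> B then - insertion_sign B b else (insertion_sign B b :: 'a::comm_ring_1))"
proof (cases "a < b \<and> a \<notin> B")
  case True
  then have "{x \<in> insert a B. x < b} = insert a {x \<in> B. x < b}" by auto
  then show ?thesis using True by (simp add: insertion_sign_def)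
next
  case False
  then have "{x \<in> insert a B. x < b} = {x \<in> B. x < b}" by auto
  then show ?thesis using False by (auto simp: insertion_sign_def)
qed

lemma insertion_sign_swap:
  assumes "a \<notin> B" "b \<notin> B" "a \<noteq> b"
  shows "insertion_sign B a * insertion_sign (insert a B) b =
    - (insertion_sign B b * insertion_sign (insert b B) a :: 'a::comm_ring_1)"
  using assms by (cases a b rule: linorder_cases) (auto simp: insertion_sign_insert mult.commute)

lemma insertion_sign_remove: "insertion_sign (A - {c}) c = insertion_sign A c"
proof -
  have "{x \<in> A - {c}. x < c} = {x \<in> A. x < c}" by auto
  then show ?thesis by (simp add: insertion_sign_def)
qed

text \<open>Both indices are made to range over the same set, with zero diagonal, to fit
  \<open>sum_alternating\<close>.\<close>

lemma contract_contract_apply: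
  assumes "finite F"
  shows "contract F l (contract F m u) (B, v) =
    (\<Sum>a\<in>F - B. \<Sum>b\<in>F - B. if a = b then 0 else
       insertion_sign B a * insertion_sign (insert a B) b * l a * m b * u (insert b (insert a B), v))"
  unfolding contract_apply[of F l] contract_apply[of F m]
proof (rule sum.cong[OF refl])
  fix a assume a: "a \<in> F - B"
  have "(\<Sum>b\<in>F - B. if a = b then 0 else
      insertion_sign B a * insertion_sign (insert a B) b * l a * m b * u (insert b (insert a B), v))
    = (\<Sum>b\<in>(F - B) - {a}. insertion_sign B a * insertion_sign (insert a B) b * l a * m b *
          u (insert b (insert a B), v))"
    using assms a by (intro sum.mono_neutral_cong_right) auto
  also have "(F - B) - {a} = F - insert a B" by auto
  finally show "insertion_sign B a * l a *
      (\<Sum>b\<in>F - insert a B. insertion_sign (insert a B) b * m b * u (insert b (insert a B), v)) =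
    (\<Sum>b\<in>F - B. if a = b then 0 else
      insertion_sign B a * insertion_sign (insert a B) b * l a * m b * u (insert b (insert a B), v))"
    by (simp add: sum_distrib_left mult_ac)
qed

lemma contract_contract_self:
  assumes "finite F" shows "contract F l (contract F l u) = 0"
proof (rule chain_eqI)
  fix B v
  have "insertion_sign B a * insertion_sign (insert a B) b * l a * l b * u (insert b (insert a B), v) =
      - (insertion_sign B b * insertion_sign (insert b B) a * l b * l a * u (insert a (insert b B), v))"
    if "a \<in> F - B" "b \<in> F - B" "a \<noteq> b" for a b
  proof -
    have "(insertion_sign B a * insertion_sign (insert a B) b) * (l a * l b * u (insert b (insert a B), v)) =
        - (insertion_sign B b * insertion_sign (insert b B) a) * (l b * l a * u (insert a (insert b B), v))"
      using that by (subst insertion_sign_swap) (simp_all only: insert_commute mult.commute[of "l a"] Diff_iff simp_thms)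
    then show ?thesis by (simp only: mult.assoc mult_minus_left)
  qed
  note swap = this
  show "contract F l (contract F l u) (B, v) = 0 (B, v)"
    unfolding contract_contract_apply[OF assms] zero_fun_apply
  proof (rule sum_alternating)
    fix a b assume "a \<in> F - B" "b \<in> F - B" "a \<noteq> b"
    from swap[OF this] \<open>a \<noteq> b\<close> \<open>a \<noteq> b\<close>[symmetric]
    show "(if a = b then 0 else insertion_sign B a * insertion_sign (insert a B) b * l a * l b *
        u (insert b (insert a B), v)) =
      - (if b = a then 0 else insertion_sign B b * insertion_sign (insert b B) a * l b * l a *
        u (insert a (insert b B), v))"
      by (simp only: if_False)
  qed (use assms in simp_all)
qed

text \<open>Polarisation of \<open>contract_contract_self\<close>.\<close>

lemma contract_anticommute:
  assumes "finite F" shows "contract F l (contract F m u) = - contract F m (contract F l u)"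
proof -
  have "contract F (\<lambda>a. l a + m a) (contract F (\<lambda>a. l a + m a) u) = 0"
    by (rule contract_contract_self[OF assms])
  then have "contract F l (contract F m u) + contract F m (contract F l u) = 0"
    unfolding contract_add_left contract.add
    by (simp add: contract_contract_self[OF assms] add.commute)
  then show ?thesis by (simp add: eq_neg_iff_add_eq_0)
qed

text \<open>Interior multiplication is an antiderivation. If \<open>c\<close> is outside
  \<open>B\<close>, only the summand \<open>a = c\<close> survives on the left. If \<open>c\<close>
  is in \<open>B\<close>, that summand occurs in the wedge of the contraction instead, and the
  others cancel by \<open>insertion_sign_swap\<close>.\<close>

lemma contract_wedge:
  assumes "finite F" "c \<in> F"
  shows "contract F l (wedge c u) = smul (l c) u - wedge c (contract F l u)"
proof (rule chain_eqI)
  fix B v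
  show "contract F l (wedge c u) (B, v) = (smul (l c) u - wedge c (contract F l u)) (B, v)"
  proof (cases "c \<in> B")
    case False
    have "contract F l (wedge c u) (B, v) =
        (\<Sum>a\<in>F - B. if a = c then l c * u (B, v) else 0)"
      unfolding contract_apply
    proof (intro sum.cong refl)
      fix a assume "a \<in> F - B"
      then show "insertion_sign B a * l a * wedge c u (insert a B, v) =
          (if a = c then l c * u (B, v) else 0)"
        using False
        by (auto simp: wedge_apply insertion_sign_insert insertion_sign_square mult_ac)
    qed
    also have "\<dots> = l c * u (B, v)" using assms False by (simp add: sum.delta)
    finally show ?thesis using False by (simp add: wedge_apply)
  next
    case True
    have "wedge c (contract F l u) (B, v) = insertion_sign B c *
        (\<Sum>a\<in>insert c (F - B). insertion_sign (B - {c}) a * l a * u (insert a (B - {c}), v))"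
    proof -
      have "F - (B - {c}) = insert c (F - B)" using assms by auto
      then show ?thesis using True by (simp add: wedge_apply contract_apply)
    qed
    also have "\<dots> = l c * u (B, v) +
        insertion_sign B c * (\<Sum>a\<in>F - B. insertion_sign (B - {c}) a * l a * u (insert a (B - {c}), v))"
      using assms True
      by (simp add: distrib_left insertion_sign_remove insertion_sign_square insert_absorb mult.assoc)
    also have "(\<Sum>a\<in>F - B. insertion_sign (B - {c}) a * l a * u (insert a (B - {c}), v)) =
        - (\<Sum>a\<in>F - B. insertion_sign B c * (insertion_sign B a * l a * wedge c u (insert a B, v)))"
      unfolding sum_negf[symmetric]
    proof (intro sum.cong refl)
      fix a assume a: "a \<in> F - B"
      have "insertion_sign (B - {c}) a * insertion_sign (insert a (B - {c})) c =
        - (insertion_sign (B - {c}) c * insertion_sign (insert c (B - {c})) a :: 'a)"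
        using a True by (intro insertion_sign_swap) auto
      then have eq: "insertion_sign (B - {c}) a * insertion_sign (insert a B) c =
        - (insertion_sign B c * insertion_sign B a :: 'a)"
        using True a insertion_sign_remove[of "insert a B" c, where 'a = 'a]
        by (cases "a = c") (simp_all add: insertion_sign_remove insert_absorb insert_Diff_if)
      have "insertion_sign B c * (insertion_sign B a * (insertion_sign (insert a B) c * (l a * x))) =
          - (insertion_sign (B - {c}) a * (l a * x))" for x
      proof -
        have "insertion_sign B c * (insertion_sign B a * (insertion_sign (insert a B) c * (l a * x))) =
          (insertion_sign B c * insertion_sign B a) * (insertion_sign (insert a B) c * (l a * x))"
          by (simp add: mult_ac)
        also have "\<dots> = - (insertion_sign (B - {c}) a * insertion_sign (insert a B) c) *
            (insertion_sign (insert a B) c * (l a * x))"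
          by (simp add: eq)
        also have "\<dots> = - (insertion_sign (B - {c}) a * (insertion_sign (insert a B) c *
            (insertion_sign (insert a B) c * (l a * x))))"
          by (simp add: mult_ac)
        finally show ?thesis by (simp add: insertion_sign_square)
      qed
      from this[of "u (insert a (B - {c}), v)"]
      have "insertion_sign (B - {c}) a * (l a * u (insert a (B - {c}), v)) =
          - (insertion_sign B c * (insertion_sign B a * (insertion_sign (insert a B) c *
              (l a * u (insert a (B - {c}), v)))))" by simp
      moreover have "insert a B - {c} = insert a (B - {c})" using a True by auto
      ultimately show "insertion_sign (B - {c}) a * l a * u (insert a (B - {c}), v) =
          - (insertion_sign B c * (insertion_sign B a * l a * wedge c u (insert a B, v)))"
        using True by (simp only: wedge_apply insert_iff mult_ac simp_thms if_True prod.case)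
    qed
    finally have "wedge c (contract F l u) (B, v) = l c * u (B, v) - contract F l (wedge c u) (B, v)"
      by (simp add: contract_apply insertion_sign_square flip: sum_distrib_left)
    then show ?thesis by simp
  qed
qed

lemma mulvar_contract: "mulvar t (contract F l u) = contract F l (mulvar t u)"
  by (rule chain_eqI) (auto simp: chain_apply)

lemma shift_contract: "shift t (contract F l u) = contract F l (shift t u)"
  by (rule chain_eqI) (auto simp: chain_apply)

lemma omit_contract: "omit t (contract F l u) = contract F l (omit t u)"
  by (rule chain_eqI) (auto simp: chain_apply)

lemma mulvar_wedge: "mulvar t (wedge c u) = wedge c (mulvar t u)"
  by (rule chain_eqI) (auto simp: chain_apply)

lemma shift_wedge: "shift t (wedge c u) = wedge c (shift t u)"
  by (rule chain_eqI) (auto simp: chain_apply)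

lemma mulvar_commute: "mulvar s (mulvar t u) = mulvar t (mulvar s u)"
  by (rule chain_eqI)
    (auto simp: chain_apply in_diff_count add_mset_commute)

lemma shift_commute: "shift s (shift t u) = shift t (shift s u)"
  by (rule chain_eqI) (auto simp: chain_apply add_mset_commute)

lemma shift_mulvar_self [simp]: "shift t (mulvar t u) = u"
  by (rule chain_eqI) (auto simp: chain_apply)

lemma shift_mulvar: "s \<noteq> t \<Longrightarrow> shift s (mulvar t u) = mulvar t (shift s u)"
  by (rule chain_eqI) (auto simp: chain_apply)

lemma mulvar_shift_self: "mulvar t (shift t u) = u - omit t u"
  by (rule chain_eqI) (auto simp: chain_apply)

section \<open>Exterior degree and polynomial degree of chains\<close>

definition basis :: "nat set \<Rightarrow> nat set \<Rightarrow> nat \<Rightarrow> nat \<Rightarrow> (nat set \<times> nat multiset) set" where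
  "basis F G p q = {(A, w). A \<subseteq> F \<and> set_mset w \<subseteq> G \<and> card A = p \<and> size w = q}"

lemma basis_iff: "(A, w) \<in> basis F G p q \<longleftrightarrow> A \<subseteq> F \<and> set_mset w \<subseteq> G \<and> card A = p \<and> size w = q"
  by (simp add: basis_def)

lemma coeffs_inI:
  assumes "\<And>B v. u (B, v) \<in> I" "\<And>B v. u (B, v) \<noteq> 0 \<Longrightarrow> (B, v) \<in> basis F G p q"
  shows "u \<in> coeffs_in (basis F G p q) I"
  using assms by (force simp: coeffs_in_def)

lemma coeffs_inD:
  assumes "u \<in> coeffs_in (basis F G p q) I"
  shows "u (B, v) \<in> I" "u (B, v) \<noteq> 0 \<Longrightarrow> (B, v) \<in> basis F G p q"
  using assms by (auto simp: coeffs_in_def)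

lemma contract_basis:
  assumes F: "finite F" and I: "ideal.subspace I" and u: "u \<in> coeffs_in (basis F G (Suc p) q) I"
  shows "contract F l u \<in> coeffs_in (basis F G p q) I"
proof (rule coeffs_inI)
  fix B v
  show "contract F l u (B, v) \<in> I"
    unfolding contract_apply
    by (intro ideal.subspace_sum[OF I] ideal.subspace_scale[OF I] coeffs_inD[OF u])
  assume "contract F l u (B, v) \<noteq> 0"
  then obtain a where a: "a \<in> F - B" "u (insert a B, v) \<noteq> 0"
    unfolding contract_apply by (metis (no_types, lifting) mult_zero_right sum.neutral)
  have "(insert a B, v) \<in> basis F G (Suc p) q" by (rule coeffs_inD(2)[OF u a(2)])
  then show "(B, v) \<in> basis F G p q"
    using a(1) finite_subset[OF _ F, of B] by (auto simp: basis_iff)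
qed

lemma contract_basis_0:
  assumes "finite F" "u \<in> free_mod (basis F G 0 q)"
  shows "contract F l u = 0"
proof (rule chain_eqI)
  fix B v
  have "u (insert a B, v) = 0" if "a \<in> F" for a
    using coeffs_inD(2)[OF assms(2), of "insert a B" v] finite_subset[OF _ assms(1), of B] that
    by (auto simp: basis_iff card_eq_0_iff)
  then show "contract F l u (B, v) = 0 (B, v)" by (simp add: contract_apply)
qed

lemma wedge_basis:
  assumes F: "finite F" and I: "ideal.subspace I" and c: "c \<in> F" and u: "u \<in> coeffs_in (basis F G p q) I"
  shows "wedge c u \<in> coeffs_in (basis F G (Suc p) q) I"
proof (rule coeffs_inI)
  fix B v
  show "wedge c u (B, v) \<in> I"
    by (simp add: wedge_apply ideal.subspace_0[OF I] ideal.subspace_scale[OF I] coeffs_inD[OF u])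
  assume "wedge c u (B, v) \<noteq> 0"
  then have *: "c \<in> B" "u (B - {c}, v) \<noteq> 0" by (auto simp: wedge_apply split: if_splits)
  have b: "(B - {c}, v) \<in> basis F G p q" by (rule coeffs_inD(2)[OF u *(2)])
  then have "finite B" using finite_subset[OF _ F, of "B - {c}"] by (auto simp: basis_iff)
  then have "card B = Suc (card (B - {c}))" by (simp only: card_Suc_Diff1[OF _ *(1)])
  moreover have "B \<subseteq> insert c (B - {c})" by blast
  ultimately show "(B, v) \<in> basis F G (Suc p) q"
    using b c unfolding basis_iff by blast
qed

lemma mulvar_basis:
  assumes I: "ideal.subspace I" and t: "t \<in> G" and u: "u \<in> coeffs_in (basis F G p q) I"
  shows "mulvar t u \<in> coeffs_in (basis F G p (Suc q)) I"
proof (rule coeffs_inI)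
  fix B v
  show "mulvar t u (B, v) \<in> I"
    by (simp add: mulvar_apply ideal.subspace_0[OF I] coeffs_inD[OF u])
  assume "mulvar t u (B, v) \<noteq> 0"
  then have *: "t \<in># v" "u (B, v - {#t#}) \<noteq> 0" by (auto simp: mulvar_apply split: if_splits)
  obtain v' where v': "v = add_mset t v'" using *(1) by (metis mset_add)
  show "(B, v) \<in> basis F G p (Suc q)"
    using coeffs_inD(2)[OF u *(2)] t v' by (auto simp: basis_iff)
qed

lemma shift_basis:
  assumes u: "u \<in> coeffs_in (basis F G p (Suc q)) I"
  shows "shift t u \<in> coeffs_in (basis F G p q) I"
proof (rule coeffs_inI)
  fix B v
  show "shift t u (B, v) \<in> I" by (simp add: shift_apply coeffs_inD[OF u])
  assume "shift t u (B, v) \<noteq> 0"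
  then have "(B, add_mset t v) \<in> basis F G p (Suc q)"
    by (auto simp: shift_apply intro: coeffs_inD[OF u])
  then show "(B, v) \<in> basis F G p q" by (auto simp: basis_iff)
qed

lemma shift_basis_0: "u \<in> free_mod (basis F G p 0) \<Longrightarrow> shift t u = 0"
  using coeffs_inD(2)[of u F G p 0 UNIV] by (intro chain_eqI) (force simp: shift_apply basis_iff)


section \<open>The two Koszul differentials\<close>

text \<open>The defining sum is regrouped by the basis vectors of G. Multiplications commute and
  contractions anticommute, so the square of the map is an alternating double sum.\<close>

definition delta :: "nat set \<Rightarrow> nat set \<Rightarrow> (nat \<Rightarrow> nat \<Rightarrow> 'a::comm_ring_1) \<Rightarrow> 'a chain \<Rightarrow> 'a chain" where
  "delta F G \<phi> u = (\<Sum>t\<in>G. mulvar t (contract F (\<phi> t) u))"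

definition partial :: "nat set \<Rightarrow> nat set \<Rightarrow> (nat \<Rightarrow> nat \<Rightarrow> 'a::comm_ring_1) \<Rightarrow> 'a chain \<Rightarrow> 'a chain" where
  "partial F G \<phi> u = (\<Sum>t\<in>G. shift t (contract F (\<phi> t) u))"

lemma linear_delta: "linear_map (delta F G \<phi>)"
  by (rule linear_mapI) (simp_all add: delta_def contract.add contract.scale mulvar.add mulvar.scale
      sum.distrib chain.scale_sum_right)

lemma linear_partial: "linear_map (partial F G \<phi>)"
  by (rule linear_mapI) (simp_all add: partial_def contract.add contract.scale shift.add shift.scale
      sum.distrib chain.scale_sum_right)

interpretation delta: module_hom smul smul "delta F G \<phi>" by (rule linear_delta)
interpretation partial: module_hom smul smul "partial F G \<phi>" by (rule linear_partial)

lemma delta_delta: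
  assumes "finite F" "finite G" shows "delta F G \<phi> (delta F G \<phi> u) = 0"
  unfolding delta_def contract.sum mulvar.sum
proof (rule sum_alternating[OF assms(2)])
  fix s t
  show "mulvar s (contract F (\<phi> s) (mulvar s (contract F (\<phi> s) u))) = 0"
    by (simp add: mulvar_contract[symmetric] contract_contract_self[OF assms(1)])
  show "mulvar s (contract F (\<phi> s) (mulvar t (contract F (\<phi> t) u))) =
    - mulvar t (contract F (\<phi> t) (mulvar s (contract F (\<phi> s) u)))"
    using contract_anticommute[OF assms(1), of "\<phi> s" "\<phi> t" u]
    by (simp add: mulvar_contract[symmetric] mulvar_commute[of s t] mulvar.neg)
qed

lemma partial_partial:
  assumes "finite F" "finite G" shows "partial F G \<phi> (partial F G \<phi> u) = 0"
  unfolding partial_def contract.sum shift.sum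
proof (rule sum_alternating[OF assms(2)])
  fix s t
  show "shift s (contract F (\<phi> s) (shift s (contract F (\<phi> s) u))) = 0"
    by (simp add: shift_contract[symmetric] contract_contract_self[OF assms(1)])
  show "shift s (contract F (\<phi> s) (shift t (contract F (\<phi> t) u))) =
    - shift t (contract F (\<phi> t) (shift s (contract F (\<phi> s) u)))"
    using contract_anticommute[OF assms(1), of "\<phi> s" "\<phi> t" u]
    by (simp add: shift_contract[symmetric] shift_commute[of s t] shift.neg)
qed

lemma delta_basis:
  assumes "finite F" "ideal.subspace I" "u \<in> coeffs_in (basis F G (Suc p) q) I"
  shows "delta F G \<phi> u \<in> coeffs_in (basis F G p (Suc q)) I"
  unfolding delta_def
  by (intro chain.subspace_sum[OF coeffs_in_subspace] mulvar_basis contract_basis assms)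

lemma partial_basis:
  assumes "finite F" "ideal.subspace I" "u \<in> coeffs_in (basis F G (Suc p) (Suc q)) I"
  shows "partial F G \<phi> u \<in> coeffs_in (basis F G p q) I"
  unfolding partial_def
  by (intro chain.subspace_sum[OF coeffs_in_subspace] shift_basis contract_basis assms)


section \<open>Iterated contractions and determinantal ideals\<close>

definition contracts :: "nat set \<Rightarrow> (nat \<Rightarrow> nat \<Rightarrow> 'a::comm_ring_1) \<Rightarrow> nat list \<Rightarrow> 'a chain \<Rightarrow> 'a chain" where
  "contracts F \<phi> ts = foldr (\<lambda>t. contract F (\<phi> t)) ts"

lemma contracts_simps [simp]:
  "contracts F \<phi> [] u = u"
  "contracts F \<phi> (t # ts) u = contract F (\<phi> t) (contracts F \<phi> ts u)"
  by (simp_all add: contracts_def)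

lemma linear_contracts: "linear_map (contracts F \<phi> ts)"
proof (induction ts)
  case Nil
  show ?case by (rule linear_mapI) (simp_all only: contracts_simps)
next
  case (Cons t ts)
  then show ?case
    by (intro linear_mapI) (simp_all only: contracts_simps module_hom.add[OF Cons.IH]
        module_hom.scale[OF Cons.IH] contract.add contract.scale)
qed

interpretation contracts: module_hom smul smul "contracts F \<phi> ts" by (rule linear_contracts)

lemma contracts_append: "contracts F \<phi> (ts @ ss) u = contracts F \<phi> ts (contracts F \<phi> ss u)"
  by (induction ts) auto

lemma contract_contracts:
  assumes "finite F"
  shows "contract F l (contracts F \<phi> ts u) = smul ((- 1) ^ length ts) (contracts F \<phi> ts (contract F l u))"
proof (induction ts)
  case Nil
  show ?case by (simp only: contracts_simps list.size power_0 chain.scale_one)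
next
  case (Cons t ts)
  show ?case
    by (simp only: contracts_simps contract_anticommute[OF assms, of l "\<phi> t"] Cons.IH contract.scale
        list.size add_Suc_right add_0_right power_Suc mult_minus_left mult_1_left chain.scale_minus_left)
qed

lemma contract_contracts_member:
  assumes "finite F" "t \<in> set ts" shows "contract F (\<phi> t) (contracts F \<phi> ts u) = 0"
proof -
  obtain us vs where "ts = us @ t # vs" using assms(2) by (meson split_list)
  then show ?thesis
    by (simp add: contracts_append contract_contracts[OF assms(1), of _ _ us]
        contract_contract_self[OF assms(1)])
qed

lemma contracts_not_distinct:
  assumes "finite F" "\<not> distinct ts" shows "contracts F \<phi> ts u = 0"
  using assms(2)
proof (induction ts)
  case (Cons t ts)
  show ?case
  proof (cases "t \<in> set ts")
    case True
    then show ?thesis by (simp only: contracts_simps contract_contracts_member[OF assms(1)])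
  next
    case False
    then have "contracts F \<phi> ts u = 0" using Cons by (simp only: distinct.simps simp_thms)
    then show ?thesis by (simp only: contracts_simps contract.zero)
  qed
qed simp

lemma contracts_basis:
  assumes "finite F" "ideal.subspace I"
  shows "u \<in> coeffs_in (basis F G (length ts + p) q) I \<Longrightarrow> contracts F \<phi> ts u \<in> coeffs_in (basis F G p q) I"
proof (induction ts arbitrary: p)
  case (Cons t ts)
  then show ?case using contract_basis[OF assms] by simp
qed simp

text \<open>Each term of \<open>partial\<close> contributes a contraction with a row already in
  \<open>ts\<close>, so a row is repeated. The sign from moving it outward is removed by applying it
  twice.\<close>

lemma contracts_partial:
  assumes "finite F" "finite G" "set ts = G"
  shows "contracts F \<phi> ts (partial F G \<phi> u) = 0"
  unfolding partial_def contracts.sum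
proof (rule sum.neutral, rule ballI)
  fix t assume "t \<in> G"
  have "smul ((- 1) ^ length ts) (contracts F \<phi> ts (contract F (\<phi> t) (shift t u))) = 0"
    using contract_contracts[OF assms(1), of "\<phi> t" \<phi> ts "shift t u"]
      contract_contracts_member[OF assms(1), of t ts \<phi> "shift t u"] \<open>t \<in> G\<close> assms(3) by simp
  then have "smul ((- 1) ^ length ts) (smul ((- 1) ^ length ts) (contracts F \<phi> ts (contract F (\<phi> t) (shift t u)))) = 0"
    by simp
  then show "contracts F \<phi> ts (shift t (contract F (\<phi> t) u)) = 0"
    unfolding shift_contract
    by (simp flip: power_mult_distrib)
qed

lemma delta_contracts:
  assumes "finite F" "set ts = G"
  shows "delta F G \<phi> (contracts F \<phi> ts u) = 0"
  unfolding delta_def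
  using assms by (intro sum.neutral ballI) (simp only: contract_contracts_member mulvar.zero)

text \<open>The coefficient at the empty set of an \<open>m\<close>-fold contraction is a
  combination of \<open>m\<close>-minors in the rows \<open>ts\<close>; taking for \<open>u\<close>
  the indicator of a set of columns yields each of them. In this form Laplace expansions become
  identities between contractions.\<close>

definition determinantal_ideal ::
    "nat set \<Rightarrow> nat set \<Rightarrow> (nat \<Rightarrow> nat \<Rightarrow> 'a::comm_ring_1) \<Rightarrow> nat \<Rightarrow> 'a set" where
  "determinantal_ideal F G \<phi> m =
     ideal.span {contracts F \<phi> ts u ({}, {#}) | ts u. set ts \<subseteq> G \<and> length ts = m}"

lemma ideal_determinantal: "ideal.subspace (determinantal_ideal F G \<phi> m)"
  by (simp add: determinantal_ideal_def)

lemma determinantal_idealI: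
  "set ts \<subseteq> G \<Longrightarrow> length ts = m \<Longrightarrow> contracts F \<phi> ts u ({}, {#}) \<in> determinantal_ideal F G \<phi> m"
  unfolding determinantal_ideal_def by (rule ideal.span_base) blast


section \<open>Contracting homotopies over the locus where a maximal minor is invertible\<close>

text \<open>
  \<open>\<psi> t\<close> is a vector which \<open>\<phi>\<close> maps to \<open>\<Delta>\<close> times the \<open>t\<close>-th basis vector.  Wedging with it and
  contracting with the rows of \<open>\<phi>\<close> satisfy the relations of a Clifford algebra.
\<close>

locale dual_vectors =
  fixes F G :: "nat set" and \<phi> \<psi> :: "nat \<Rightarrow> nat \<Rightarrow> 'a::comm_ring_1" and \<Delta> :: 'a
  assumes F: "finite F" and G: "finite G"
    and dual: "s \<in> G \<Longrightarrow> t \<in> G \<Longrightarrow> (\<Sum>c\<in>F. \<phi> s c * \<psi> t c) = (if s = t then \<Delta> else 0)"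
begin

abbreviation D :: "nat \<Rightarrow> 'a chain \<Rightarrow> 'a chain" where
  "D t \<equiv> contract F (\<phi> t)"

definition E :: "nat \<Rightarrow> 'a chain \<Rightarrow> 'a chain" where
  "E t u = (\<Sum>c\<in>F. smul (\<psi> t c) (wedge c u))"

lemma linear_E: "linear_map (E t)"
  by (rule linear_mapI) (simp_all add: E_def wedge.add wedge.scale chain.scale_right_distrib
      sum.distrib chain.scale_sum_right mult.commute)

sublocale E: module_hom smul smul "E t" for t by (rule linear_E)

lemma D_E:
  assumes "s \<in> G" "t \<in> G"
  shows "D s (E t u) = (if s = t then smul \<Delta> u else 0) - E t (D s u)"
proof -
  have "D s (E t u) = (\<Sum>c\<in>F. smul (\<phi> s c * \<psi> t c) u - smul (\<psi> t c) (wedge c (D s u)))"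
    unfolding E_def contract.sum contract.scale
    by (intro sum.cong refl)
      (simp add: contract_wedge[OF F] chain.scale_right_diff_distrib mult.commute)
  also have "\<dots> = smul (\<Sum>c\<in>F. \<phi> s c * \<psi> t c) u - E t (D s u)"
    by (simp only: sum_subtractf E_def chain.scale_sum_left)
  also have "\<dots> = (if s = t then smul \<Delta> u else 0) - E t (D s u)"
    unfolding dual[OF assms] by (simp split: if_split)
  finally show ?thesis .
qed

lemma mulvar_E: "mulvar s (E t u) = E t (mulvar s u)"
  by (simp only: E_def mulvar.sum mulvar.scale mulvar_wedge)

lemma shift_E: "shift s (E t u) = E t (shift s u)"
  by (simp only: E_def shift.sum shift.scale shift_wedge)

lemma E_basis: "u \<in> free_mod (basis F G' p q) \<Longrightarrow> E t u \<in> free_mod (basis F G' (Suc p) q)"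
  unfolding E_def
  by (intro chain.subspace_sum[OF coeffs_in_subspace] chain.subspace_scale[OF coeffs_in_subspace]
      wedge_basis F ideal.subspace_UNIV)

lemma D_basis: "u \<in> free_mod (basis F G' (Suc p) q) \<Longrightarrow> D t u \<in> free_mod (basis F G' p q)"
  by (intro contract_basis F ideal.subspace_UNIV)

text \<open>The candidate homotopy is \<open>E t\<close> after \<open>shift t\<close>, which lowers
  the polynomial degree and raises the exterior one. For \<open>s \<noteq> t\<close> the cross terms
  cancel by the Clifford relations; for \<open>s = t\<close> the failure of \<open>shift t\<close>
  to invert \<open>mulvar t\<close> leaves the term with \<open>omit t\<close>.\<close>

lemma delta_homotopy:
  assumes t: "t \<in> G"
  shows "smul \<Delta> u = D t (E t (omit t u)) + delta F G \<phi> (E t (shift t u)) + E t (shift t (delta F G \<phi> u))"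
proof -
  let ?\<delta> = "delta F G \<phi>"
  have 1: "?\<delta> (E t (shift t u)) = smul \<Delta> (u - omit t u) - (\<Sum>s\<in>G. E t (mulvar s (shift t (D s u))))"
  proof -
    have "?\<delta> (E t (shift t u)) =
        (\<Sum>s\<in>G. (if s = t then smul \<Delta> (u - omit t u) else 0) - E t (mulvar s (shift t (D s u))))"
      unfolding delta_def
    proof (rule sum.cong[OF refl])
      fix s assume s: "s \<in> G"
      show "mulvar s (D s (E t (shift t u))) =
          (if s = t then smul \<Delta> (u - omit t u) else 0) - E t (mulvar s (shift t (D s u)))"
        by (cases "s = t")
          (simp_all only: D_E[OF s t] D_E[OF t t] mulvar.diff mulvar.scale mulvar_E mulvar_shift_self shift_contract
            mulvar.zero if_True if_False simp_thms)
    qed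
    then show ?thesis using t G by (simp add: sum_subtractf)
  qed
  have 2: "E t (shift t (?\<delta> u)) - (\<Sum>s\<in>G. E t (mulvar s (shift t (D s u)))) = E t (D t (omit t u))"
  proof -
    have "E t (shift t (?\<delta> u)) - (\<Sum>s\<in>G. E t (mulvar s (shift t (D s u)))) =
      (\<Sum>s\<in>G. E t (shift t (mulvar s (D s u)) - mulvar s (shift t (D s u))))"
      by (simp only: delta_def shift.sum E.sum E.diff sum_subtractf)
    also have "\<dots> = (\<Sum>s\<in>G. if s = t then E t (omit t (D t u)) else 0)"
    proof (rule sum.cong[OF refl])
      fix s show "E t (shift t (mulvar s (D s u)) - mulvar s (shift t (D s u))) =
          (if s = t then E t (omit t (D t u)) else 0)"
        by (cases "s = t") (simp_all add: shift_mulvar mulvar_shift_self)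
    qed
    finally show ?thesis using t G by (simp add: omit_contract)
  qed
  have 3: "D t (E t (omit t u)) = smul \<Delta> (omit t u) - E t (D t (omit t u))"
    by (simp only: D_E[OF t t] if_True simp_thms)
  show ?thesis
    using 2 unfolding 1 3 chain.scale_right_diff_distrib by (simp add: algebra_simps)
qed

text \<open>The same with \<open>mulvar t\<close> and \<open>shift t\<close> exchanged. As
  \<open>shift t\<close> after \<open>mulvar t\<close> is the identity, the defect now comes from
  the opposite composite, and \<open>E t\<close> and \<open>D t\<close> appear in the other
  order.\<close>

lemma partial_homotopy:
  assumes t: "t \<in> G"
  shows "smul \<Delta> u = E t (D t (omit t u)) + partial F G \<phi> (E t (mulvar t u)) + E t (mulvar t (partial F G \<phi> u))"
proof -
  let ?\<delta> = "partial F G \<phi>"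
  have 1: "?\<delta> (E t (mulvar t u)) = smul \<Delta> u - (\<Sum>s\<in>G. E t (shift s (mulvar t (D s u))))"
  proof -
    have "?\<delta> (E t (mulvar t u)) =
        (\<Sum>s\<in>G. (if s = t then smul \<Delta> u else 0) - E t (shift s (mulvar t (D s u))))"
      unfolding partial_def
    proof (rule sum.cong[OF refl])
      fix s assume s: "s \<in> G"
      show "shift s (D s (E t (mulvar t u))) =
          (if s = t then smul \<Delta> u else 0) - E t (shift s (mulvar t (D s u)))"
        by (cases "s = t")
          (simp_all only: D_E[OF s t] D_E[OF t t] shift.diff shift.scale shift_E shift_mulvar_self mulvar_contract
            shift.zero if_True if_False simp_thms)
    qed
    then show ?thesis using t G by (simp add: sum_subtractf)
  qed
  have 2: "(\<Sum>s\<in>G. E t (shift s (mulvar t (D s u)))) - E t (mulvar t (?\<delta> u)) = E t (D t (omit t u))"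
  proof -
    have "(\<Sum>s\<in>G. E t (shift s (mulvar t (D s u)))) - E t (mulvar t (?\<delta> u)) =
      (\<Sum>s\<in>G. E t (shift s (mulvar t (D s u)) - mulvar t (shift s (D s u))))"
      by (simp only: partial_def mulvar.sum E.sum E.diff sum_subtractf)
    also have "\<dots> = (\<Sum>s\<in>G. if s = t then E t (omit t (D t u)) else 0)"
    proof (rule sum.cong[OF refl])
      fix s show "E t (shift s (mulvar t (D s u)) - mulvar t (shift s (D s u))) =
          (if s = t then E t (omit t (D t u)) else 0)"
        by (cases "s = t") (simp_all add: shift_mulvar mulvar_shift_self)
    qed
    finally show ?thesis using t G by (simp add: omit_contract)
  qed
  show ?thesis
    using 2 unfolding 1 by (simp add: algebra_simps)
qed

section \<open>Exactness up to a power of the minor\<close>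

lemma omit_basis_remove:
  "u \<in> free_mod (basis F H p q) \<Longrightarrow> omit t u \<in> free_mod (basis F (H - {t}) p q)"
  by (rule coeffs_inI) (auto simp: omit_apply basis_iff dest!: coeffs_inD(2) split: if_splits)

lemma basis_empty_Suc: "u \<in> free_mod (basis F {} p (Suc q)) \<Longrightarrow> u = 0"
  by (rule chain_eqI) (auto simp: coeffs_in_def basis_iff)

lemma free_mod_mono: "X \<subseteq> Y \<Longrightarrow> u \<in> free_mod X \<Longrightarrow> u \<in> free_mod Y"
  by (auto simp: coeffs_in_def)

lemma basis_mono: "H \<subseteq> G' \<Longrightarrow> basis F H p q \<subseteq> basis F G' p q"
  by (auto simp: basis_def)

text \<open>\<open>delta_homotopy\<close> for \<open>t\<close> replaces the cycle by one free of
  y_t, at the cost of one factor \<open>\<Delta>\<close>. The residue left after treating all of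
  \<open>G\<close> has positive polynomial degree but no variables, so it is 0.\<close>

lemma delta_exact:
  assumes u: "u \<in> free_mod (basis F G p (Suc q))" and cyc: "delta F G \<phi> u = 0"
  shows "\<exists>w\<in>free_mod (basis F G (Suc p) q). smul (\<Delta> ^ card G) u = delta F G \<phi> w"
proof -
  have "\<exists>w\<in>free_mod (basis F G (Suc p) q). \<exists>\<rho>\<in>free_mod (basis F (G - H) p (Suc q)).
      delta F G \<phi> \<rho> = 0 \<and> smul (\<Delta> ^ card H) u = \<rho> + delta F G \<phi> w" if "finite H" "H \<subseteq> G" for H
    using that
  proof (induction H rule: finite_induct)
    case empty
    show ?case
      by (rule bexI[of _ 0], rule bexI[of _ u])
        (simp_all only: delta.zero card.empty power_0 chain.scale_one add_0_right Diff_empty cyc u simp_thms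
          chain.subspace_0[OF coeffs_in_subspace] ideal.subspace_UNIV)
  next
    case (insert t H)
    then obtain w \<rho> where w: "w \<in> free_mod (basis F G (Suc p) q)"
      and \<rho>: "\<rho> \<in> free_mod (basis F (G - H) p (Suc q))" "delta F G \<phi> \<rho> = 0"
      and eq: "smul (\<Delta> ^ card H) u = \<rho> + delta F G \<phi> w" by blast
    have t: "t \<in> G" using insert by blast
    let ?\<rho> = "D t (E t (omit t \<rho>))" and ?w = "smul \<Delta> w + E t (shift t \<rho>)"
    have h: "smul \<Delta> \<rho> = ?\<rho> + delta F G \<phi> (E t (shift t \<rho>))"
      using delta_homotopy[OF t, of \<rho>] \<rho>(2) by (simp only: shift.zero E.zero add_0_right)
    have "smul (\<Delta> ^ card (insert t H)) u = smul \<Delta> (smul (\<Delta> ^ card H) u)"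
      using insert.hyps by simp
    also have "\<dots> = ?\<rho> + delta F G \<phi> ?w"
      unfolding eq chain.scale_right_distrib h delta.add delta.scale by (simp add: algebra_simps)
    finally have "smul (\<Delta> ^ card (insert t H)) u = ?\<rho> + delta F G \<phi> ?w" .
    moreover have "delta F G \<phi> ?\<rho> = 0"
    proof -
      have "?\<rho> = smul \<Delta> \<rho> - delta F G \<phi> (E t (shift t \<rho>))" using h by simp
      then show ?thesis by (simp only: delta.diff delta.scale \<rho>(2) delta_delta[OF F G] chain.scale_zero_right diff_self)
    qed
    moreover have "?\<rho> \<in> free_mod (basis F (G - insert t H) p (Suc q))"
    proof -
      have "G - insert t H = G - H - {t}" by blast
      then show ?thesis using \<rho>(1) by (auto intro!: D_basis E_basis omit_basis_remove)
    qed
    moreover have "?w \<in> free_mod (basis F G (Suc p) q)"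
    proof -
      have "\<rho> \<in> free_mod (basis F G p (Suc q))"
        using \<rho>(1) by (rule free_mod_mono[OF basis_mono, rotated]) blast
      then show ?thesis
        by (intro chain.subspace_add chain.subspace_scale coeffs_in_subspace w E_basis shift_basis)
          simp_all
    qed
    ultimately show ?case by blast
  qed
  from this[OF G order_refl, unfolded Diff_cancel] obtain w \<rho> where
    w: "w \<in> free_mod (basis F G (Suc p) q)" and \<rho>: "\<rho> \<in> free_mod (basis F {} p (Suc q))"
    and eq: "smul (\<Delta> ^ card G) u = \<rho> + delta F G \<phi> w"
    by blast
  show ?thesis
    by (rule bexI[OF _ w]) (simp only: eq basis_empty_Suc[OF \<rho>] add_0_left)
qed

lemma partial_exact:
  assumes u: "u \<in> free_mod (basis F G p (Suc q))" and cyc: "partial F G \<phi> u = 0"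
  shows "\<exists>w\<in>free_mod (basis F G (Suc p) (Suc (Suc q))). smul (\<Delta> ^ card G) u = partial F G \<phi> w"
proof -
  have "\<exists>w\<in>free_mod (basis F G (Suc p) (Suc (Suc q))). \<exists>\<rho>\<in>free_mod (basis F (G - H) p (Suc q)).
      partial F G \<phi> \<rho> = 0 \<and> smul (\<Delta> ^ card H) u = \<rho> + partial F G \<phi> w" if "finite H" "H \<subseteq> G" for H
    using that
  proof (induction H rule: finite_induct)
    case empty
    show ?case
      by (rule bexI[of _ 0], rule bexI[of _ u])
        (simp_all only: partial.zero card.empty power_0 chain.scale_one add_0_right Diff_empty cyc u simp_thms
          chain.subspace_0[OF coeffs_in_subspace] ideal.subspace_UNIV)
  next
    case (insert t H)
    then obtain w \<rho> where w: "w \<in> free_mod (basis F G (Suc p) (Suc (Suc q)))"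
      and \<rho>: "\<rho> \<in> free_mod (basis F (G - H) p (Suc q))" "partial F G \<phi> \<rho> = 0"
      and eq: "smul (\<Delta> ^ card H) u = \<rho> + partial F G \<phi> w" by blast
    have t: "t \<in> G" using insert by blast
    let ?\<rho> = "E t (D t (omit t \<rho>))" and ?w = "smul \<Delta> w + E t (mulvar t \<rho>)"
    have h: "smul \<Delta> \<rho> = ?\<rho> + partial F G \<phi> (E t (mulvar t \<rho>))"
      using partial_homotopy[OF t, of \<rho>] \<rho>(2) by (simp only: mulvar.zero E.zero add_0_right)
    have "smul (\<Delta> ^ card (insert t H)) u = smul \<Delta> (smul (\<Delta> ^ card H) u)"
      using insert.hyps by simp
    also have "\<dots> = ?\<rho> + partial F G \<phi> ?w"
      unfolding eq chain.scale_right_distrib h partial.add partial.scale by (simp add: algebra_simps)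
    finally have "smul (\<Delta> ^ card (insert t H)) u = ?\<rho> + partial F G \<phi> ?w" .
    moreover have "partial F G \<phi> ?\<rho> = 0"
    proof -
      have "?\<rho> = smul \<Delta> \<rho> - partial F G \<phi> (E t (mulvar t \<rho>))" using h by simp
      then show ?thesis by (simp only: partial.diff partial.scale \<rho>(2) partial_partial[OF F G] chain.scale_zero_right diff_self)
    qed
    moreover have "?\<rho> \<in> free_mod (basis F (G - insert t H) p (Suc q))"
    proof -
      have eq: "G - insert t H = G - H - {t}" by blast
      have o: "omit t \<rho> \<in> free_mod (basis F (G - H - {t}) p (Suc q))"
        by (rule omit_basis_remove[OF \<rho>(1)])
      show ?thesis
      \<comment> \<open>In exterior degree 0 there is no lower degree for \<open>D t\<close> to land
        in; the contraction is 0 there.\<close>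
      proof (cases p)
        case 0
        then show ?thesis
          using contract_basis_0[OF F, of "omit t \<rho>"] o
          by (simp add: E.zero chain.subspace_0[OF coeffs_in_subspace])
      next
        case (Suc p')
        then show ?thesis unfolding eq using o by (auto intro!: D_basis E_basis)
      qed
    qed
    moreover have "?w \<in> free_mod (basis F G (Suc p) (Suc (Suc q)))"
    proof -
      have "\<rho> \<in> free_mod (basis F G p (Suc q))"
        using \<rho>(1) by (rule free_mod_mono[OF basis_mono, rotated]) blast
      then show ?thesis
        by (intro chain.subspace_add chain.subspace_scale coeffs_in_subspace w E_basis mulvar_basis t)
          simp_all
    qed
    ultimately show ?case by blast
  qed
  from this[OF G order_refl, unfolded Diff_cancel] obtain w \<rho> where
    w: "w \<in> free_mod (basis F G (Suc p) (Suc (Suc q)))" and \<rho>: "\<rho> \<in> free_mod (basis F {} p (Suc q))"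
    and eq: "smul (\<Delta> ^ card G) u = \<rho> + partial F G \<phi> w"
    by blast
  show ?thesis
    by (rule bexI[OF _ w]) (simp only: eq basis_empty_Suc[OF \<rho>] add_0_left)
qed

text \<open>In polynomial degree 0, \<open>D t z\<close> is the coefficient of y_t in
  \<open>delta F G \<phi> z\<close>.\<close>

lemma delta_basis_zero_iff:
  assumes z: "z \<in> free_mod (basis F G p 0)" and cyc: "delta F G \<phi> z = 0" and t: "t \<in> G"
  shows "D t z = 0"
proof (rule chain_eqI)
  fix B v
  have zv: "z (A, w) = 0" if "w \<noteq> {#}" for A w
    using coeffs_inD(2)[OF z, of A w] that by (auto simp: basis_iff)
  show "D t z (B, v) = 0 (B, v)"
  proof (cases "v = {#}")
    case False
    then show ?thesis by (simp add: contract_apply zv)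
  next
    case True
    have "delta F G \<phi> z (B, {#t#}) = (\<Sum>s\<in>G. mulvar s (D s z) (B, {#t#}))"
      unfolding delta_def by (induction G rule: infinite_finite_induct) simp_all
    also have "\<dots> = (\<Sum>s\<in>G. if s = t then D t z (B, {#}) else 0)"
      by (intro sum.cong refl) (simp add: mulvar_apply)
    also have "\<dots> = D t z (B, {#})" using t G by simp
    finally show ?thesis using cyc True by simp
  qed
qed

text \<open>If \<open>D t z = 0\<close>, then \<open>D t (E t z)\<close> is \<open>\<Delta>\<close>
  times \<open>z\<close>, and \<open>E t z\<close> stays in the kernels of the other rows. Thus the
  preimage is built one row at a time, each costing a factor \<open>\<Delta>\<close>.\<close>

lemma common_kernel:
  assumes "\<And>t. t \<in> set ts \<Longrightarrow> D t z = 0" "z \<in> free_mod (basis F G p q)" "distinct ts" "set ts \<subseteq> G"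
  shows "\<exists>w\<in>free_mod (basis F G (length ts + p) q). smul (\<Delta> ^ length ts) z = contracts F \<phi> ts w"
  using assms
proof (induction ts arbitrary: z p)
  case Nil
  then show ?case by (intro bexI[of _ z]) simp_all
next
  case (Cons t ts)
  have t: "t \<in> G" using Cons.prems by simp
  have "\<exists>w\<in>free_mod (basis F G (length ts + Suc p) q). smul (\<Delta> ^ length ts) (E t z) = contracts F \<phi> ts w"
  proof (rule Cons.IH[OF _ E_basis[OF Cons.prems(2)]])
    fix s assume "s \<in> set ts"
    then have "s \<in> G" "s \<noteq> t" "D s z = 0" using Cons.prems(3,4) Cons.prems(1)[of s] by auto
    then show "D s (E t z) = 0" by (simp only: D_E[OF \<open>s \<in> G\<close> t] if_False E.zero diff_self)
  qed (use Cons.prems(3,4) in simp_all)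
  then obtain w where w: "w \<in> free_mod (basis F G (length ts + Suc p) q)"
    "smul (\<Delta> ^ length ts) (E t z) = contracts F \<phi> ts w"
    by blast
  have "D t z = 0" by (rule Cons.prems(1)) simp
  then have "smul (\<Delta> ^ length (t # ts)) z = smul (\<Delta> ^ length ts) (D t (E t z))"
    by (simp only: D_E[OF t t] if_True simp_thms E.zero diff_0_right list.size add_Suc_right add_0_right power_Suc
        chain.scale_scale mult.commute)
  also have "\<dots> = contracts F \<phi> (t # ts) w"
    by (simp only: contracts_simps w(2)[symmetric] contract.scale)
  finally show ?case using w(1) by auto
qed

text \<open>\<open>D t y\<close> is the image of \<open>y\<close> tensored with the dual of y_t: the
  shifts by the other variables annihilate polynomial degree 0.\<close>

lemma D_image: 
  assumes y: "y \<in> free_mod (basis F G (Suc p) 0)" and t: "t \<in> G"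
  shows "D t y \<in> partial F G \<phi> ` free_mod (basis F G (Suc p) (Suc 0))"
proof
  show "mulvar t y \<in> free_mod (basis F G (Suc p) (Suc 0))"
    by (intro mulvar_basis t y) simp
  have "partial F G \<phi> (mulvar t y) = (\<Sum>s\<in>G. if s = t then D t y else 0)"
    unfolding partial_def
  proof (rule sum.cong[OF refl])
    fix s
    show "shift s (D s (mulvar t y)) = (if s = t then D t y else 0)"
    proof (cases "s = t")
      case True
      then show ?thesis by (simp only: mulvar_contract[symmetric] shift_mulvar_self if_True simp_thms True)
    next
      case False
      then show ?thesis
        by (simp only: shift_contract shift_mulvar[OF False] False shift_basis_0[OF y] mulvar.zero contract.zero if_False)
    qed
  qed
  then show "D t y = partial F G \<phi> (mulvar t y)" using t G by simp
qed

lemma fold_E_basis: "u \<in> free_mod (basis F G' p q) \<Longrightarrow> fold E ts u \<in> free_mod (basis F G' (length ts + p) q)"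
proof (induction ts arbitrary: u p)
  case (Cons t ts)
  then show ?case using Cons.IH[OF E_basis, of u p t] by simp
qed simp

lemma linear_fold_E: "linear_map (fold E ts)"
proof (induction ts)
  case Nil
  show ?case by (rule linear_mapI) (simp_all only: fold.simps id_apply)
next
  case (Cons t ts)
  show ?case
    by (rule linear_mapI)
      (simp_all only: fold.simps o_apply E.add E.scale module_hom.add[OF Cons.IH] module_hom.scale[OF Cons.IH])
qed

lemma D_fold_E:
  "s \<in> G \<Longrightarrow> set ts \<subseteq> G \<Longrightarrow> s \<notin> set ts \<Longrightarrow> D s (fold E ts u) = smul ((- 1) ^ length ts) (fold E ts (D s u))"
proof (induction ts arbitrary: u)
  case Nil
  show ?case by (simp only: fold.simps id_apply list.size power_0 chain.scale_one)
next
  case (Cons t ts)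
  have "t \<in> G" "s \<noteq> t" "set ts \<subseteq> G" "s \<notin> set ts" using Cons.prems by auto
  then show ?case
    by (simp only: fold.simps o_apply Cons.IH[OF Cons.prems(1)] D_E[OF Cons.prems(1)] if_False
        diff_0 module_hom.neg[OF linear_fold_E] list.size add_Suc_right add_0_right power_Suc mult_minus_left
        mult_1_left chain.scale_minus_left chain.scale_minus_right not_False_eq_True)
qed

text \<open>Exchanging D_t E_t for \<Delta> - E_t D_t, row by row, telescopes. The error of each
  exchange is, up to sign, \<open>D t\<close> of an element of polynomial degree 0, hence a boundary
  by \<open>D_image\<close>.\<close>

lemma fold_E_contracts:
  assumes z: "z \<in> free_mod (basis F G (length ts + p) 0)"
  shows "distinct ss \<Longrightarrow> set ss \<subseteq> G \<Longrightarrow> length ss \<le> length ts \<Longrightarrow>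
    smul (\<Delta> ^ length ss) z - fold E ss (contracts F \<phi> ss z)
      \<in> partial F G \<phi> ` free_mod (basis F G (Suc (length ts + p)) (Suc 0))"
    (is "_ \<Longrightarrow> _ \<Longrightarrow> _ \<Longrightarrow> _ \<in> ?Im")
proof (induction ss)
  case Nil
  have "0 \<in> ?Im" by (rule image_eqI[of _ _ 0])
    (simp_all only: partial.zero chain.subspace_0[OF coeffs_in_subspace] ideal.subspace_UNIV)
  then show ?case
    by (simp only: list.size power_0 chain.scale_one fold.simps id_apply contracts_simps diff_self)
next
  case (Cons t ss)
  have Im: "chain.subspace ?Im"
    by (intro partial.subspace_image coeffs_in_subspace ideal.subspace_UNIV)
  have t: "t \<in> G" "t \<notin> set ss" "set ss \<subseteq> G" using Cons.prems by auto
  let ?y = "contracts F \<phi> ss z"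
  obtain r where r: "length ts + p = length ss + r"
    using Cons.prems(3) by (metis le_iff_add length_Cons Suc_leD add.assoc)
  have y: "?y \<in> free_mod (basis F G r 0)"
    by (rule contracts_basis[OF F]) (use z r in simp_all)
  have "smul ((- 1) ^ length ss) (D t (fold E ss (E t ?y))) = fold E ss (D t (E t ?y))"
    unfolding D_fold_E[OF t(1,3,2)] chain.scale_scale
    by (simp only: power_mult_distrib[symmetric] mult_minus_left mult_1_left minus_minus power_one chain.scale_one)
  moreover have "fold E ss (E t ?y) \<in> free_mod (basis F G (Suc (length ts + p)) 0)"
    using fold_E_basis[OF E_basis[OF y], of ss t] r by simp
  ultimately have "fold E ss (D t (E t ?y)) \<in> ?Im"
    using chain.subspace_scale[OF Im D_image[OF _ t(1)]] by metis
  moreover have "smul \<Delta> (smul (\<Delta> ^ length ss) z - fold E ss ?y) \<in> ?Im"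
    by (rule chain.subspace_scale[OF Im Cons.IH]) (use Cons.prems in simp_all)
  moreover have "smul (\<Delta> ^ length (t # ss)) z - fold E (t # ss) (contracts F \<phi> (t # ss) z) =
    smul \<Delta> (smul (\<Delta> ^ length ss) z - fold E ss ?y) + fold E ss (D t (E t ?y))"
  proof -
    have "fold E ss (D t (E t ?y)) = smul \<Delta> (fold E ss ?y) - fold E ss (E t (D t ?y))"
      by (simp only: D_E[OF t(1) t(1)] if_True simp_thms module_hom.diff[OF linear_fold_E] module_hom.scale[OF linear_fold_E])
    then show ?thesis
      by (simp add: chain.scale_right_diff_distrib)
  qed
  ultimately show ?case using chain.subspace_add[OF Im] by metis
qed

text \<open>Exactness at the source of the splice map, which is contraction with all rows;
  \<open>delta_exact_0\<close> treats its target.\<close>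

lemma partial_exact_0:
  assumes z: "z \<in> free_mod (basis F G (card G + p) 0)" and ts: "distinct ts" "set ts = G"
    and cyc: "contracts F \<phi> ts z = 0"
  shows "\<exists>w\<in>free_mod (basis F G (Suc (card G + p)) (Suc 0)). smul (\<Delta> ^ card G) z = partial F G \<phi> w"
proof -
  have l: "length ts = card G" using distinct_card[OF ts(1)] ts(2) by simp
  have "smul (\<Delta> ^ length ts) z - fold E ts (contracts F \<phi> ts z)
      \<in> partial F G \<phi> ` free_mod (basis F G (Suc (length ts + p)) (Suc 0))"
    by (rule fold_E_contracts) (use z ts l in simp_all)
  then show ?thesis
    unfolding cyc module_hom.zero[OF linear_fold_E] l by auto
qed

lemma delta_exact_0:
  assumes z: "z \<in> free_mod (basis F G p 0)" and ts: "distinct ts" "set ts = G"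
    and cyc: "delta F G \<phi> z = 0"
  shows "\<exists>w\<in>free_mod (basis F G (card G + p) 0). smul (\<Delta> ^ card G) z = contracts F \<phi> ts w"
proof -
  have l: "length ts = card G" using distinct_card[OF ts(1)] ts(2) by simp
  show ?thesis unfolding l[symmetric]
    by (rule common_kernel) (use delta_basis_zero_iff[OF z cyc] z ts in simp_all)
qed

end

text \<open>Cramer's rule: \<open>\<psi> t\<close> consists of the singleton coefficients that
  remain when \<open>t\<close> is left out of the list of contractions. Contracting once more with
  row \<open>t\<close> restores the minor up to sign, while any other row is repeated and gives
  0.\<close>

lemma dual_vectors_exist:
  fixes \<phi> :: "nat \<Rightarrow> nat \<Rightarrow> 'a::comm_ring_1"
  assumes F: "finite F" and G: "finite G" and ts: "distinct ts" "set ts = G"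
  shows "\<exists>\<psi>. dual_vectors F G \<phi> \<psi> (contracts F \<phi> ts u ({}, {#}))"
proof -
  let ?\<Delta> = "contracts F \<phi> ts u ({}, {#})"
  have "\<exists>\<psi>. \<forall>s\<in>G. (\<Sum>c\<in>F. \<phi> s c * \<psi> c) = (if s = t then ?\<Delta> else 0)" if t: "t \<in> G" for t
  proof -
    obtain us vs where split: "ts = us @ t # vs" using t ts(2) by (metis split_list)
    let ?W = "contracts F \<phi> (us @ vs) u"
    have coeff: "(\<Sum>c\<in>F. \<phi> s c * ?W ({c}, {#})) = contract F (\<phi> s) ?W ({}, {#})" for s
      by (simp add: contract_apply insertion_sign_def)
    have "(\<Sum>c\<in>F. \<phi> s c * ((- 1) ^ length us * ?W ({c}, {#}))) = (if s = t then ?\<Delta> else 0)" if s: "s \<in> G" for s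
    proof -
      have "(\<Sum>c\<in>F. \<phi> s c * ((- 1) ^ length us * ?W ({c}, {#}))) =
          (- 1) ^ length us * contract F (\<phi> s) ?W ({}, {#})"
        unfolding coeff[symmetric] sum_distrib_left by (simp add: mult_ac)
      also have "\<dots> = (if s = t then ?\<Delta> else 0)"
      proof (cases "s = t")
        case True
        have "smul ((- 1) ^ length us) (contract F (\<phi> t) ?W) = contracts F \<phi> ts u"
          unfolding split contracts_append contract_contracts[OF F, of "\<phi> t" \<phi> us] chain.scale_scale
          by (simp flip: power_mult_distrib)
        then have "smul ((- 1) ^ length us) (contract F (\<phi> t) ?W) ({}, {#}) = ?\<Delta>" by simp
        then show ?thesis using True by simp
      next
        case False
        then have "s \<in> set (us @ vs)" using s ts(2) split by auto
        then show ?thesis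
          using False by (simp only: contract_contracts_member[OF F] zero_fun_apply mult_zero_right if_False)
      qed
      finally show ?thesis .
    qed
    then show ?thesis
      by (intro exI[of _ "\<lambda>c. (- 1) ^ length us * ?W ({c}, {#})"] ballI)
  qed
  then obtain \<psi> where "\<And>t s. t \<in> G \<Longrightarrow> s \<in> G \<Longrightarrow> (\<Sum>c\<in>F. \<phi> s c * \<psi> t c) = (if s = t then ?\<Delta> else 0)"
    by metis
  then show ?thesis using F G by (intro exI[of _ \<psi>]) (auto simp: dual_vectors_def)
qed


section \<open>Splitting off an entry of the matrix\<close>

text \<open>The degree \<open>i\<close> strand of the Koszul complex over Sym G; the condition
  \<open>j \<le> i\<close> guards the truncated subtraction.\<close>

definition koszul_basis :: "nat set \<Rightarrow> nat set \<Rightarrow> nat \<Rightarrow> nat \<Rightarrow> (nat set \<times> nat multiset) set" where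
  "koszul_basis F G i j = (if j \<le> i then basis F G j (i - j) else {})"

lemma free_mod_empty: "free_mod {} = {0}"
  by (auto simp: coeffs_in_def fun_eq_iff)

lemma free_complex_koszul:
  fixes \<phi> :: "nat \<Rightarrow> nat \<Rightarrow> 'a::comm_ring_1"
  assumes F: "finite F" and G: "finite G"
  shows "free_complex (koszul_basis F G i) (\<lambda>_. delta F G \<phi>)"
proof
  fix I j and u :: "'a chain" assume I: "ideal.subspace I"
    and u: "u \<in> coeffs_in (koszul_basis F G i (Suc j)) I"
  show "delta F G \<phi> u \<in> coeffs_in (koszul_basis F G i j) I"
  proof (cases "Suc j \<le> i")
    case True
    then have "Suc (i - Suc j) = i - j" by simp
    then show ?thesis
      using delta_basis[OF F I, of u G j "i - Suc j" \<phi>] u True by (simp add: koszul_basis_def)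
  next
    case False
    have "u = 0" using u False by (intro chain_eqI) (auto simp: coeffs_in_def koszul_basis_def)
    then show ?thesis by (simp only: delta.zero chain.subspace_0[OF coeffs_in_subspace[OF I]])
  qed
qed (simp_all only: delta.add delta.scale delta_delta[OF F G])

abbreviation koszul_annihilator :: "nat set \<Rightarrow> nat set \<Rightarrow> (nat \<Rightarrow> nat \<Rightarrow> 'a::comm_ring_1) \<Rightarrow> nat \<Rightarrow> nat \<Rightarrow> 'a set" where
  "koszul_annihilator F G \<phi> i j \<equiv> free_complex.annihilator (koszul_basis F G i) (\<lambda>_. delta F G \<phi>) j"

text \<open>Multiplication by the linear form \<phi>(x_c) of Sym G.\<close>

definition column_form :: "nat set \<Rightarrow> (nat \<Rightarrow> nat \<Rightarrow> 'a::comm_ring_1) \<Rightarrow> nat \<Rightarrow> 'a chain \<Rightarrow> 'a chain" where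
  "column_form G \<phi> c u = (\<Sum>t\<in>G. smul (\<phi> t c) (mulvar t u))"

lemma linear_column_form: "linear_map (column_form G \<phi> c)"
  by (rule linear_mapI)
    (simp_all add: column_form_def mulvar.add mulvar.scale chain.scale_right_distrib sum.distrib
      chain.scale_sum_right mult.commute)

interpretation column_form: module_hom smul smul "column_form G \<phi> c" by (rule linear_column_form)

lemma column_form_contract: "contract F l (column_form G \<phi> c u) = column_form G \<phi> c (contract F l u)"
  by (simp only: column_form_def contract.sum contract.scale mulvar_contract)

lemma column_form_mulvar: "mulvar s (column_form G \<phi> c u) = column_form G \<phi> c (mulvar s u)"
  by (simp only: column_form_def mulvar.sum mulvar.scale mulvar_commute[of s])

lemma column_form_delta: "delta F G' \<phi>' (column_form G \<phi> c u) = column_form G \<phi> c (delta F G' \<phi>' u)"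
  by (simp only: delta_def column_form_contract column_form_mulvar column_form.sum)

lemma column_form_basis:
  assumes "u \<in> free_mod (basis F G p q)"
  shows "column_form G \<phi> c u \<in> free_mod (basis F G p (Suc q))"
  unfolding column_form_def
  by (intro chain.subspace_sum chain.subspace_scale coeffs_in_subspace mulvar_basis assms ideal.subspace_UNIV)

text \<open>Hence \<open>wedge c\<close> is a homotopy from multiplication by \<phi>(x_c) to
  zero.\<close>

lemma delta_wedge:
  assumes "finite F" "c \<in> F"
  shows "delta F G \<phi> (wedge c u) = column_form G \<phi> c u - wedge c (delta F G \<phi> u)"
  by (simp only: delta_def column_form_def contract_wedge[OF assms] mulvar.diff mulvar.scale mulvar_wedge
      sum_subtractf wedge.sum)

definition without :: "nat \<Rightarrow> 'a::comm_ring_1 chain \<Rightarrow> bool" where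
  "without c u \<longleftrightarrow> (\<forall>B v. c \<in> B \<longrightarrow> u (B, v) = 0)"

lemma without_subspace: "chain.subspace {u. without c u}"
  by (rule chain.subspaceI) (auto simp: without_def)

lemma without_add: "without c u \<Longrightarrow> without c w \<Longrightarrow> without c (u + w)"
  and without_scale: "without c u \<Longrightarrow> without c (smul x u)"
  by (simp_all add: without_def)

lemma without_contract: "without c u \<Longrightarrow> without c (contract F l u)"
  by (simp add: without_def contract_apply)

lemma without_mulvar: "without c u \<Longrightarrow> without c (mulvar t u)"
  by (simp add: without_def mulvar_apply)

lemma without_delta: "without c u \<Longrightarrow> without c (delta F G \<phi> u)"
  unfolding delta_def
  using chain.subspace_sum[OF without_subspace, of G "\<lambda>t. mulvar t (contract F (\<phi> t) u)" c]
  by (simp add: without_mulvar without_contract)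

lemma without_column_form: "without c u \<Longrightarrow> without c (column_form G \<phi> c' u)"
  unfolding column_form_def
  using chain.subspace_sum[OF without_subspace, of G "\<lambda>t. smul (\<phi> t c') (mulvar t u)" c]
  by (simp add: without_mulvar without_scale)

lemma without_basis:
  "u \<in> free_mod (basis F G p q) \<Longrightarrow> without c u \<Longrightarrow> u \<in> free_mod (basis (F - {c}) G p q)"
  by (rule coeffs_inI) (auto simp: without_def basis_iff dest!: coeffs_inD(2))

lemma basis_without: "u \<in> free_mod (basis (F - {c}) G p q) \<Longrightarrow> without c u"
  by (auto simp: without_def coeffs_in_def basis_iff)

lemma basis_subset: "F' \<subseteq> F \<Longrightarrow> G' \<subseteq> G \<Longrightarrow> u \<in> free_mod (basis F' G' p q) \<Longrightarrow> u \<in> free_mod (basis F G p q)"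
  by (rule coeffs_inI, simp) (drule (1) coeffs_inD(2), unfold basis_iff, blast)

lemma without_wedge_zero:
  assumes "without c u" "u + wedge c w = 0" shows "u = 0"
proof (rule chain_eqI)
  fix B v
  have "u (B, v) + wedge c w (B, v) = 0" using fun_cong[OF assms(2), of "(B, v)"] by simp
  then show "u (B, v) = 0 (B, v)"
    using assms(1) by (cases "c \<in> B") (simp_all add: without_def wedge_apply)
qed

lemma contract_remove:
  assumes "finite F" "l c = 0" shows "contract F l = contract (F - {c}) l"
proof (rule ext, rule chain_eqI)
  fix u :: "'a chain" and B v
  show "contract F l u (B, v) = contract (F - {c}) l u (B, v)"
    unfolding contract_apply
    by (rule sum.mono_neutral_right) (use assms in auto)
qed

lemma contract_zero_left: "contract F (\<lambda>_. 0) u = 0"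
  by (rule chain_eqI) (simp add: contract_apply)

lemma split_without:
  assumes "finite F" "c \<in> F" "z \<in> free_mod (basis F G (Suc p) q)"
  obtains z0 z1 where "z = z0 + wedge c z1" "z0 \<in> free_mod (basis (F - {c}) G (Suc p) q)"
    "z1 \<in> free_mod (basis (F - {c}) G p q)"
proof -
  \<comment> \<open>The functional dual to x_c: the antiderivation rule writes \<open>z\<close> as
    its part without x_c plus a multiple of x_c.\<close>
  let ?e = "\<lambda>a. if a = c then 1 else 0 :: 'a"
  have wo: "without c (contract F ?e u)" for u
    by (auto simp: without_def contract_apply intro!: sum.neutral)
  have "contract F ?e (wedge c z) = z - wedge c (contract F ?e z)"
    by (simp only: contract_wedge[OF assms(1,2)] if_True simp_thms chain.scale_one)
  then have "z = contract F ?e (wedge c z) + wedge c (contract F ?e z)" by simp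
  moreover have "contract F ?e (wedge c z) \<in> free_mod (basis (F - {c}) G (Suc p) q)"
    by (intro without_basis wo contract_basis wedge_basis assms ideal.subspace_UNIV)
  moreover have "contract F ?e z \<in> free_mod (basis (F - {c}) G p q)"
    by (intro without_basis wo contract_basis assms ideal.subspace_UNIV)
  ultimately show ?thesis by (rule that)
qed

text \<open>Polynomial degree \<open>q - 1\<close>, except that degree -1 gives the zero module,
  which truncated subtraction would miss.\<close>

definition lower :: "nat set \<Rightarrow> nat set \<Rightarrow> nat \<Rightarrow> nat \<Rightarrow> ('a::comm_ring_1) chain set" where
  "lower F G p q = (if q = 0 then {0} else free_mod (basis F G p (q - 1)))"

lemma lower_subspace: "chain.subspace (lower F G p q)"
  by (simp add: lower_def coeffs_in_subspace)

lemma lower_subset: "F' \<subseteq> F \<Longrightarrow> G' \<subseteq> G \<Longrightarrow> u \<in> lower F' G' p q \<Longrightarrow> u \<in> lower F G p q"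
  using basis_subset[of F' F G' G u p "q - 1"] by (simp add: lower_def split: if_splits)

lemma lower_without: "u \<in> lower (F - {c}) G p q \<Longrightarrow> without c u"
  using basis_without[of u F c G p "q - 1"] by (auto simp: lower_def without_def split: if_splits)

lemma koszul_basis_lower: "j \<le> i \<Longrightarrow> free_mod (koszul_basis F G i (Suc j)) = lower F G (Suc j) (i - j)"
  by (auto simp: koszul_basis_def lower_def free_mod_empty)

lemma delta_lower: "finite F \<Longrightarrow> u \<in> lower F G (Suc p) q \<Longrightarrow> delta F G \<phi> u \<in> free_mod (basis F G p q)"
  using delta_basis[of F UNIV u G p "q - 1" \<phi>]
  by (cases q) (simp_all add: lower_def delta.zero chain.subspace_0[OF coeffs_in_subspace])

lemma contract_lower: "finite F \<Longrightarrow> u \<in> lower F G (Suc p) q \<Longrightarrow> contract F l u \<in> lower F G p q"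
  using contract_basis[of F UNIV u G p "q - 1" l]
  by (cases q) (simp_all add: lower_def contract.zero)

lemma wedge_lower: "finite F \<Longrightarrow> c \<in> F \<Longrightarrow> u \<in> lower F G p q \<Longrightarrow> wedge c u \<in> lower F G (Suc p) q"
  using wedge_basis[of F UNIV c u G p "q - 1"]
  by (cases q) (simp_all add: lower_def wedge.zero)

lemma shift_remove: "u \<in> free_mod (basis F (G - {r}) p q) \<Longrightarrow> shift r u = 0"
  by (rule chain_eqI) (auto simp: shift_apply coeffs_in_def basis_iff)

text \<open>The matrix \<open>a \<phi> s b - \<phi> s c \<phi> r b\<close>, with \<open>a = \<phi> r c\<close>, is \<open>a\<close> times the Schur complement of \<open>a\<close>.\<close>

locale pivot =
  fixes F G :: "nat set" and \<phi> :: "nat \<Rightarrow> nat \<Rightarrow> 'a::comm_ring_1" and r c :: nat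
  assumes F: "finite F" and G: "finite G" and r: "r \<in> G" and c: "c \<in> F"
begin

abbreviation a :: 'a where "a \<equiv> \<phi> r c"

definition schur :: "nat \<Rightarrow> nat \<Rightarrow> 'a" where
  "schur s b = a * \<phi> s b - \<phi> s c * \<phi> r b"

abbreviation Y :: "'a chain \<Rightarrow> 'a chain" where "Y \<equiv> column_form G \<phi> c"
abbreviation Y' :: "'a chain \<Rightarrow> 'a chain" where "Y' \<equiv> column_form (G - {r}) \<phi> c"
abbreviation F' where "F' \<equiv> F - {c}"
abbreviation G' where "G' \<equiv> G - {r}"

lemma Y_split: "Y u = smul a (mulvar r u) + Y' u"
  unfolding column_form_def using G r by (simp add: sum.remove)

lemma shift_Y: "shift r (Y u) = smul a u + Y' (shift r u)"
proof -
  have "shift r (Y' u) = Y' (shift r u)"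
    unfolding column_form_def shift.sum shift.scale
    by (intro sum.cong refl) (simp add: shift_mulvar)
  then show ?thesis by (simp only: Y_split shift.add shift.scale shift_mulvar_self)
qed

lemma Y'_shift: "shift r (Y' u) = Y' (shift r u)"
  unfolding column_form_def shift.sum shift.scale
  by (intro sum.cong refl) (simp add: shift_mulvar)

text \<open>Once \<open>a\<close> is inverted, \<open>Y\<close> is a linear form with invertible
  coefficient at y_r, so a nonzero multiple of it cannot be free of y_r. Each polynomial degree from
  0 to \<open>q\<close> costs one factor \<open>a\<close>.\<close>

lemma column_form_torsion:
  "u \<in> free_mod (basis F0 G p q) \<Longrightarrow> shift r (Y u) = 0 \<Longrightarrow> smul (a ^ Suc q) u = 0"
proof (induction q arbitrary: u)
  case 0
  then show ?case
    by (simp only: shift_Y shift_basis_0[OF 0(1)] column_form.zero add_0_right power_Suc power_0 mult_1_right)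
next
  case (Suc q)
  have eq: "smul a u = - Y' (shift r u)"
    using Suc.prems(2) unfolding shift_Y by (simp only: eq_neg_iff_add_eq_0)
  have "shift r (Y (shift r u)) = shift r (shift r (Y u))"
    by (simp only: shift_Y shift.add shift.scale Y'_shift)
  then have "smul (a ^ Suc q) (shift r u) = 0"
    using Suc.IH[OF shift_basis[OF Suc.prems(1)]] by (simp only: Suc.prems(2) shift.zero)
  then have "smul (a ^ Suc q) (Y' (shift r u)) = 0"
    by (simp only: column_form.scale[symmetric] column_form.zero)
  then show ?case
    using arg_cong[OF eq, of "smul (a ^ Suc q)"]
    by (simp only: chain.scale_scale power_Suc2[symmetric] chain.scale_minus_right minus_zero)
qed

text \<open>Division with remainder by \<open>Y\<close>, which is monic in y_r up to the factor
  \<open>a\<close>; the remainder is free of y_r.\<close>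

lemma column_form_division:
  "u \<in> free_mod (basis F0 G p q) \<Longrightarrow> \<exists>\<rho>\<in>free_mod (basis F0 G' p q). \<exists>y\<in>lower F0 G p q.
     smul (a ^ q) u = \<rho> + Y y"
proof (induction q arbitrary: u)
  case 0
  have "u \<in> free_mod (basis F0 G' p 0)"
    using 0 by (intro coeffs_inI) (auto simp: basis_iff dest!: coeffs_inD(2))
  then show ?case
    by (rule bexI[rotated], intro bexI[of _ 0])
      (simp_all only: power_0 chain.scale_one column_form.zero add_0_right lower_def if_True simp_thms singletonI)
next
  case (Suc q)
  have s: "shift r u \<in> free_mod (basis F0 G p q)" by (rule shift_basis[OF Suc.prems])
  obtain \<rho> y where \<rho>: "\<rho> \<in> free_mod (basis F0 G' p q)" and y: "y \<in> lower F0 G p q"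
    and eq: "smul (a ^ q) (shift r u) = \<rho> + Y y"
    using Suc.IH[OF s] by blast
  let ?\<rho> = "smul (a ^ Suc q) (omit r u) - Y' \<rho>" and ?y = "smul (a ^ q) (shift r u) - Y' y"
  have "smul a u = smul a (omit r u) + (Y (shift r u) - Y' (shift r u))"
    unfolding Y_split mulvar_shift_self by (simp add: chain.scale_right_diff_distrib)
  then have "smul (a ^ q) (smul a u) =
      smul (a ^ q) (smul a (omit r u)) + (Y (smul (a ^ q) (shift r u)) - Y' (smul (a ^ q) (shift r u)))"
    by (simp only: chain.scale_right_distrib chain.scale_right_diff_distrib column_form.scale)
  also have "\<dots> = smul (a ^ Suc q) (omit r u) + (Y (smul (a ^ q) (shift r u)) - (Y' \<rho> + Y' (Y y)))"
    unfolding eq column_form.add by (simp only: chain.scale_scale power_Suc2)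
  also have "Y' (Y y) = Y (Y' y)"
    unfolding column_form_def[of "G - {r}"]
    by (simp only: column_form_mulvar column_form.sum column_form.scale)
  finally have "smul (a ^ q) (smul a u) =
      smul (a ^ Suc q) (omit r u) + (Y (smul (a ^ q) (shift r u)) - (Y' \<rho> + Y (Y' y)))" .
  moreover have "A + (P - (Q + R)) = A - Q + (P - R)" for A P Q R :: "'a chain"
    by (simp add: algebra_simps)
  ultimately have "smul (a ^ Suc q) u = ?\<rho> + Y ?y"
    by (simp only: chain.scale_scale power_Suc2 column_form.diff)
  moreover have "?\<rho> \<in> free_mod (basis F0 G' p (Suc q))"
  proof (intro chain.subspace_diff chain.subspace_scale coeffs_in_subspace ideal.subspace_UNIV)
    show "omit r u \<in> free_mod (basis F0 G' p (Suc q))"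
      using Suc.prems by (intro coeffs_inI) (auto simp: omit_apply basis_iff dest!: coeffs_inD(2) split: if_splits)
    show "Y' \<rho> \<in> free_mod (basis F0 G' p (Suc q))" by (rule column_form_basis[OF \<rho>])
  qed
  moreover have "?y \<in> lower F0 G p (Suc q)"
  proof -
    have "Y' y \<in> free_mod (basis F0 G p q)"
    proof (cases q)
      case 0
      then show ?thesis
        using y by (simp add: lower_def column_form.zero chain.subspace_0[OF coeffs_in_subspace])
    next
      case (Suc q')
      then show ?thesis
        using y unfolding column_form_def lower_def
        by (intro chain.subspace_sum chain.subspace_scale coeffs_in_subspace) (auto intro!: mulvar_basis)
    qed
    then have "?y \<in> free_mod (basis F0 G p q)"
      using s by (intro chain.subspace_diff chain.subspace_scale coeffs_in_subspace) simp_all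
    then show ?thesis by (simp only: lower_def diff_Suc_1 nat.distinct if_False)
  qed
  ultimately show ?case by blast
qed

lemma contract_schur: "contract F (schur s) u = smul a (contract F (\<phi> s) u) - smul (\<phi> s c) (contract F (\<phi> r) u)"
  unfolding schur_def contract_diff_left contract_scale_left ..

lemma schur_column: "schur s c = 0" and schur_row: "schur r b = 0"
  by (simp_all add: schur_def mult.commute)

lemma contract_schur_remove: "contract F' (schur s) = contract F (schur s)"
  by (rule contract_remove[OF F, symmetric]) (rule schur_column)

text \<open>\<open>schur\<close> is \<open>a\<close> times \<phi> minus the rank one matrix formed
  from column \<open>c\<close> and row \<open>r\<close>, and the latter contributes \<open>Y\<close>
  after contraction with row \<open>r\<close>. As \<open>schur\<close> vanishes in that row and
  column, both may be dropped from the index sets.\<close>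

lemma delta_schur: "delta F' G' schur u = smul a (delta F G \<phi> u) - Y (contract F (\<phi> r) u)"
proof -
  have r0: "mulvar r (contract F (schur r) u) = 0"
    by (simp only: schur_row[abs_def] contract_zero_left mulvar.zero)
  have "delta F' G' schur u = (\<Sum>t\<in>G'. mulvar t (contract F (schur t) u))"
    unfolding delta_def contract_schur_remove ..
  also have "\<dots> = (\<Sum>t\<in>G. mulvar t (contract F (schur t) u))"
    by (simp only: sum.remove[OF G r] r0 add_0_left)
  also have "\<dots> = smul a (delta F G \<phi> u) - Y (contract F (\<phi> r) u)"
    by (simp only: contract_schur mulvar.diff mulvar.scale sum_subtractf delta_def column_form_def
        chain.scale_sum_right)
  finally show ?thesis .
qed

text \<open>
  Up to powers of \<open>a\<close>, a cycle \<open>z\<close> can be reduced to one for the Schur complement: the component of \<open>z\<close>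
  not involving the basis vector \<open>c\<close> is divided by the linear form \<open>Y\<close> belonging to the column \<open>c\<close>,
  and multiplication by \<open>Y\<close> is homotopic to zero.
\<close>

lemma cycle_reduction:
  assumes z: "z \<in> free_mod (basis F G (Suc p) q)" and cyc: "delta F G \<phi> z = 0"
    and bnd: "\<And>z'. z' \<in> free_mod (basis F' G' (Suc p) q) \<Longrightarrow> delta F' G' schur z' = 0 \<Longrightarrow>
       smul \<beta> z' \<in> delta F' G' schur ` lower F' G' (Suc (Suc p)) q"
  shows "smul (a ^ (3 * q + 2) * \<beta>) z \<in> delta F G \<phi> ` lower F G (Suc (Suc p)) q"
proof -
  have F': "finite F'" and sub: "F' \<subseteq> F" "G' \<subseteq> G" using F by auto
  note cl = chain.subspace_add[OF coeffs_in_subspace[OF ideal.subspace_UNIV]]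
    chain.subspace_scale[OF coeffs_in_subspace[OF ideal.subspace_UNIV]]
    chain.subspace_diff[OF coeffs_in_subspace[OF ideal.subspace_UNIV]]
    chain.subspace_neg[OF coeffs_in_subspace[OF ideal.subspace_UNIV]]
  note lcl = chain.subspace_add[OF lower_subspace] chain.subspace_scale[OF lower_subspace]
    chain.subspace_diff[OF lower_subspace]
  have restrict: "contract F l u = contract F' l u" if "without c u" for l u
  proof (rule chain_eqI)
    fix B v
    show "contract F l u (B, v) = contract F' l u (B, v)"
      unfolding contract_apply
      by (rule sum.mono_neutral_right) (use F that in \<open>auto simp: without_def\<close>)
  qed
  have delta_restrict: "delta F G \<phi> u = delta F' G \<phi> u" if "without c u" for u
    unfolding delta_def using restrict[OF that] by simp
  obtain z0 z1 where split: "z = z0 + wedge c z1"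
    and z0: "z0 \<in> free_mod (basis F' G (Suc p) q)" and z1: "z1 \<in> free_mod (basis F' G p q)"
    using split_without[OF F c z] by blast
  note wo = basis_without[OF z0] basis_without[OF z1]
  have "(delta F G \<phi> z0 + Y z1) + wedge c (- delta F G \<phi> z1) = 0"
    using cyc unfolding split delta.add delta_wedge[OF F c] wedge.neg
    by (simp only: add_uminus_conv_diff add_diff_eq)
  moreover have "without c (delta F G \<phi> z0 + Y z1)"
    by (intro without_add without_delta without_column_form wo)
  \<comment> \<open>Comparison of the terms without x_c in the cycle condition for
    \<open>z\<close>.\<close>
  ultimately have dz0: "delta F G \<phi> z0 = - Y z1"
    using without_wedge_zero by (metis eq_neg_iff_add_eq_0)
  obtain \<rho> y where \<rho>: "\<rho> \<in> free_mod (basis F' G' (Suc p) q)" and y: "y \<in> lower F' G (Suc p) q"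
    and div: "smul (a ^ q) z0 = \<rho> + Y y"
    using column_form_division[OF z0] by blast
  have \<rho>G: "\<rho> \<in> free_mod (basis F' G (Suc p) q)" by (rule basis_subset[OF order_refl sub(2) \<rho>])
  have woy: "without c y" by (rule lower_without[OF y])
  \<comment> \<open>Chosen so that \<open>delta F' G' schur \<rho> = Y y2\<close>. The left side is
    free of y_r, so by \<open>column_form_torsion\<close> \<rho> becomes a cycle after
    multiplication by \<open>a ^ Suc q\<close>.\<close>
  define y2 where "y2 = - smul (a ^ Suc q) z1 - smul a (delta F G \<phi> y) - contract F (\<phi> r) \<rho>"
  have "\<rho> = smul (a ^ q) z0 - Y y" using div by simp
  then have "smul a (delta F G \<phi> \<rho>) = smul (a * a ^ q) (- Y z1) - smul a (Y (delta F G \<phi> y))"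
    by (simp only: delta.diff delta.scale dz0 column_form_delta chain.scale_right_diff_distrib chain.scale_scale)
  then have d\<rho>: "delta F' G' schur \<rho> = Y y2"
    unfolding delta_schur y2_def column_form.diff column_form.neg column_form.scale
    by (simp only: power_Suc chain.scale_minus_right)
  have y2: "y2 \<in> free_mod (basis F' G p q)"
    unfolding y2_def delta_restrict[OF woy] restrict[OF basis_without[OF \<rho>G]]
    by (intro cl z1 delta_lower[OF F' y] contract_basis[OF F' ideal.subspace_UNIV \<rho>G])
  have "shift r (Y y2) = 0"
    unfolding d\<rho>[symmetric]
    by (rule shift_remove[OF delta_basis[OF F' ideal.subspace_UNIV \<rho>]])
  from column_form_torsion[OF y2 this] have "smul (a ^ Suc q) (Y y2) = 0"
    by (simp only: column_form.scale[symmetric] column_form.zero)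
  then have "delta F' G' schur (smul (a ^ Suc q) \<rho>) = 0"
    by (simp only: delta.scale d\<rho>)
  from bnd[OF cl(2)[OF \<rho>] this] obtain w where w: "w \<in> lower F' G' (Suc (Suc p)) q"
    and dw: "smul \<beta> (smul (a ^ Suc q) \<rho>) = delta F' G' schur w" by blast
  define M where "M = \<beta> * a ^ Suc q"
  \<comment> \<open>\<open>W\<close> lifts \<open>w\<close> to the original matrix. The choice of
    \<open>v\<close> and \<open>x\<close> makes \<open>smul (M * a ^ q) z\<close> differ from the
    boundary of \<open>W\<close> only by \<open>wedge c x\<close>.\<close>
  define v where "v = smul M y - contract F (\<phi> r) w"
  define x where "x = delta F G \<phi> v + smul (M * a ^ q) z1"
  define W where "W = smul a w + wedge c v"
  have wG: "w \<in> lower F' G (Suc (Suc p)) q" by (rule lower_subset[OF order_refl sub(2) w])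
  have wow: "without c w" by (rule lower_without[OF w])
  have v: "v \<in> lower F' G (Suc p) q"
    unfolding v_def restrict[OF wow] by (intro lcl y contract_lower[OF F' wG])
  have wov: "without c v" by (rule lower_without[OF v])
  have x: "x \<in> free_mod (basis F' G p q)"
    unfolding x_def delta_restrict[OF wov] by (intro cl z1 delta_lower[OF F' v])
  have W: "W \<in> lower F G (Suc (Suc p)) q"
    unfolding W_def
    by (intro lcl lower_subset[OF sub(1) order_refl wG] wedge_lower[OF F c] lower_subset[OF sub(1) order_refl v])
  have "smul (M * a ^ q) z0 = delta F' G' schur w + smul M (Y y)"
  proof -
    have "smul (M * a ^ q) z0 = smul M (\<rho> + Y y)" by (simp only: div[symmetric] chain.scale_scale)
    then show ?thesis
      by (simp only: chain.scale_right_distrib dw[symmetric] chain.scale_scale M_def)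
  qed
  also have "\<dots> = smul a (delta F G \<phi> w) + Y v"
    unfolding delta_schur v_def column_form.diff column_form.scale by (simp add: algebra_simps)
  finally have Mz0: "smul (M * a ^ q) z0 = smul a (delta F G \<phi> w) + Y v" .
  have dW: "delta F G \<phi> W = smul a (delta F G \<phi> w) + (Y v - wedge c (delta F G \<phi> v))"
    unfolding W_def delta.add delta.scale delta_wedge[OF F c] ..
  have Mz: "smul (M * a ^ q) z = delta F G \<phi> W + wedge c x"
    unfolding dW split chain.scale_right_distrib Mz0 x_def wedge.add wedge.scale by (simp add: algebra_simps)
  have "delta F G \<phi> (wedge c x) = 0"
  proof -
    have "wedge c x = smul (M * a ^ q) z - delta F G \<phi> W" using Mz by simp
    then show ?thesis
      by (simp only: delta.diff delta.scale cyc delta_delta[OF F G] chain.scale_zero_right diff_self)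
  qed
  \<comment> \<open>For a cycle of the form \<open>wedge c x\<close>, the terms without x_c give
    \<open>Y x = 0\<close>; so \<open>x\<close> is torsion and the discrepancy disappears.\<close>
  then have "Y x + wedge c (- delta F G \<phi> x) = 0"
    unfolding delta_wedge[OF F c] wedge.neg by simp
  then have "Y x = 0"
    by (rule without_wedge_zero[OF without_column_form[OF basis_without[OF x]]])
  then have "smul (a ^ Suc q) x = 0"
    by (intro column_form_torsion[OF x]) (simp only: shift.zero)
  then have "smul (a ^ Suc q) (wedge c x) = 0"
    by (simp only: wedge.scale[symmetric] wedge.zero)
  then have "smul (a ^ Suc q) (smul (M * a ^ q) z) = delta F G \<phi> (smul (a ^ Suc q) W)"
    unfolding Mz chain.scale_right_distrib delta.scale by (simp only: add_0_right)
  \<comment> \<open>The exponent adds up q for the division, q + 1 for making \<rho> a cycle and q +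
    1 for killing \<open>x\<close>.\<close>
  moreover have "a ^ Suc q * (M * a ^ q) = a ^ (3 * q + 2) * \<beta>"
  proof -
    have "3 * q + 2 = Suc q + (Suc q + q)" by simp
    then show ?thesis unfolding M_def by (simp only: power_add mult_ac)
  qed
  ultimately have "smul (a ^ (3 * q + 2) * \<beta>) z = delta F G \<phi> (smul (a ^ Suc q) W)"
    by (simp only: chain.scale_scale)
  then show ?thesis using lcl(2)[OF W] by blast
qed

lemma annihilator_reduction:
  assumes \<beta>: "\<beta> \<in> radical (koszul_annihilator F' G' schur i j)" and j: "j \<ge> 1"
  shows "a * \<beta> \<in> radical (koszul_annihilator F G \<phi> i j)"
proof (cases "j \<le> i")
  case False
  interpret free_complex "koszul_basis F G i" "\<lambda>_. delta F G \<phi>" by (rule free_complex_koszul[OF F G])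
  have "Z j \<subseteq> {0}" using False by (auto simp: Z_def koszul_basis_def free_mod_empty)
  then have "(a * \<beta>) ^ 1 \<in> annihilator j"
    by (auto simp: annihilator_def chain.subspace_0[OF B_subspace])
  then show ?thesis by (rule radicalI)
next
  case True
  interpret K: free_complex "koszul_basis F G i" "\<lambda>_. delta F G \<phi>" by (rule free_complex_koszul[OF F G])
  have F': "finite F'" "finite G'" using F G by auto
  interpret K': free_complex "koszul_basis F' G' i" "\<lambda>_. delta F' G' schur" by (rule free_complex_koszul[OF F'])
  obtain p where p: "j = Suc p" using j by (cases j) auto
  let ?q = "i - j"
  obtain n where n: "\<beta> ^ n \<in> K'.annihilator j" using \<beta> by (auto simp: radical_def)
  have "a ^ (3 * ?q + 2) * \<beta> ^ n \<in> K.annihilator j"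
    unfolding K.annihilator_def
  proof (intro CollectI ballI)
    fix z assume "z \<in> K.Z j"
    then have z: "z \<in> free_mod (basis F G (Suc p) ?q)" "delta F G \<phi> z = 0"
      using True p by (simp_all add: K.Z_def koszul_basis_def)
    have "smul (a ^ (3 * ?q + 2) * \<beta> ^ n) z \<in> delta F G \<phi> ` lower F G (Suc (Suc p)) ?q"
    proof (rule cycle_reduction[OF z])
      fix z' assume "z' \<in> free_mod (basis F' G' (Suc p) ?q)" "delta F' G' schur z' = 0"
      then have "z' \<in> K'.Z j" using True p by (simp add: K'.Z_def koszul_basis_def)
      then have "smul (\<beta> ^ n) z' \<in> K'.B j" using n by (simp add: K'.annihilator_def)
      then show "smul (\<beta> ^ n) z' \<in> delta F' G' schur ` lower F' G' (Suc (Suc p)) ?q"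
        unfolding K'.B_def koszul_basis_lower[OF True] unfolding p .
    qed
    then show "smul (a ^ (3 * ?q + 2) * \<beta> ^ n) z \<in> K.B j"
      unfolding K.B_def koszul_basis_lower[OF True] unfolding p .
  qed
  \<comment> \<open>The factor makes the exponents of \<open>a\<close> and \<beta> equal.\<close>
  then have "(a ^ n * \<beta> ^ (3 * ?q + 2)) * (a ^ (3 * ?q + 2) * \<beta> ^ n) \<in> K.annihilator j"
    by (rule ideal.subspace_scale[OF K.annihilator_ideal])
  moreover have "(a ^ n * \<beta> ^ (3 * ?q + 2)) * (a ^ (3 * ?q + 2) * \<beta> ^ n) = (a * \<beta>) ^ (n + (3 * ?q + 2))"
    by (simp only: power_mult_distrib power_add mult_ac)
  ultimately show ?thesis by (metis radicalI)
qed

end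

text \<open>The coefficient at a singleton is the one at the empty set after contraction with the
  dual functional, which anticommutes with the other contractions and is absorbed into
  \<open>u\<close>.\<close>

lemma contracts_coeff_singleton:
  assumes F: "finite F" and ts: "set ts \<subseteq> G" and b: "b \<in> F"
  shows "contracts F \<phi> ts u ({b}, {#}) \<in> determinantal_ideal F G \<phi> (length ts)"
proof -
  let ?e = "\<lambda>a. if a = b then 1 else 0 :: 'a"
  have "contract F ?e w ({}, {#}) = w ({b}, {#})" for w :: "'a chain"
  proof -
    have "contract F ?e w ({}, {#}) = (\<Sum>a\<in>F. if a = b then w ({b}, {#}) else 0)"
      unfolding contract_apply by (rule sum.cong) (auto simp: insertion_sign_def)
    then show ?thesis using F b by simp
  qed
  then have "contracts F \<phi> ts u ({b}, {#}) =
      smul ((- 1) ^ length ts) (contracts F \<phi> ts (contract F ?e u)) ({}, {#})"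
    by (simp only: contract_contracts[OF F, symmetric])
  also have "\<dots> \<in> determinantal_ideal F G \<phi> (length ts)"
    unfolding smul_apply
    by (intro ideal.subspace_scale[OF ideal_determinantal] determinantal_idealI ts refl)
  finally show ?thesis .
qed

text \<open>Laplace expansion: the outermost contraction is a combination of coefficients at
  singletons of the remaining \<open>m\<close> contractions.\<close>

lemma determinantal_ideal_Suc:
  assumes F: "finite F"
  shows "determinantal_ideal F G \<phi> (Suc m) \<subseteq> determinantal_ideal F G \<phi> m"
  unfolding determinantal_ideal_def[of F G \<phi> "Suc m"]
proof (rule ideal.span_minimal[OF _ ideal_determinantal], rule subsetI)
  fix x assume "x \<in> {contracts F \<phi> ts u ({}, {#}) |ts u. set ts \<subseteq> G \<and> length ts = Suc m}"
  then obtain t ts u where ts: "set ts \<subseteq> G" "length ts = m" and x: "x = contracts F \<phi> (t # ts) u ({}, {#})"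
    by (auto simp: length_Suc_conv)
  have "contracts F \<phi> ts u (insert b {}, {#}) \<in> determinantal_ideal F G \<phi> m" if "b \<in> F" for b
    using contracts_coeff_singleton[OF F ts(1) that] ts(2) by simp
  then show "x \<in> determinantal_ideal F G \<phi> m"
    unfolding x contracts_simps contract_apply
    by (intro ideal.subspace_sum[OF ideal_determinantal] ideal.subspace_scale[OF ideal_determinantal]) simp
qed

lemma determinantal_ideal_entries:
  assumes F: "finite F"
  shows "determinantal_ideal F G \<phi> (Suc m) \<subseteq> ideal.span {\<phi> t b |t b. t \<in> G \<and> b \<in> F}"
  unfolding determinantal_ideal_def
proof (rule ideal.span_minimal[OF _ ideal.subspace_span], rule subsetI)
  fix x assume "x \<in> {contracts F \<phi> ts u ({}, {#}) |ts u. set ts \<subseteq> G \<and> length ts = Suc m}"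
  then obtain t ts u where t: "t \<in> G" and x: "x = contracts F \<phi> (t # ts) u ({}, {#})"
    by (auto simp: length_Suc_conv)
  have "\<phi> t b * (insertion_sign {} b * contracts F \<phi> ts u (insert b {}, {#})) \<in>
      ideal.span {\<phi> t b |t b. t \<in> G \<and> b \<in> F}" if "b \<in> F" for b
    by (rule ideal_mult[OF ideal.subspace_span ideal.span_base]) (use t that in blast)
  then show "x \<in> ideal.span {\<phi> t b |t b. t \<in> G \<and> b \<in> F}"
    unfolding x contracts_simps contract_apply
    by (intro ideal.span_sum) (simp add: mult.assoc mult.left_commute)
qed

section \<open>Determinantal ideals of the Schur complement\<close>

context pivot
begin

text \<open>Where the correction term \<open>Q\<close> for a product of \<open>k\<close>
  contractions lives: one factor has been spent on the contraction with row \<open>r\<close>,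
  leaving \<open>k - 1\<close> with rows of \<open>schur\<close>. For \<open>k = 0\<close> there is
  no correction.\<close>

definition contracts_span :: "nat \<Rightarrow> 'a chain set" where
  "contracts_span k = (case k of 0 \<Rightarrow> {0} | Suc l \<Rightarrow>
     chain.span {contracts F schur ts u |ts u. set ts \<subseteq> G \<and> length ts = l})"

lemma contracts_span_subspace: "chain.subspace (contracts_span k)"
  by (simp add: contracts_span_def split: nat.split)

lemma contract_contracts_span:
  assumes "s \<in> G" "Q \<in> contracts_span k"
  shows "contract F (schur s) Q \<in> contracts_span (Suc k)"
proof (cases k)
  case 0
  then show ?thesis using assms(2) chain.subspace_0[OF contracts_span_subspace]
    by (simp add: contracts_span_def contract.zero)
next
  case (Suc l)
  have "chain.subspace {Q. contract F (schur s) Q \<in> contracts_span (Suc k)}"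
    by (rule contract.subspace_linear_preimage[OF contracts_span_subspace])
  moreover have "contracts F schur ts u \<in> {Q. contract F (schur s) Q \<in> contracts_span (Suc k)}"
    if "set ts \<subseteq> G" "length ts = l" for ts u
  proof -
    have "contracts F schur (s # ts) u \<in> contracts_span (Suc k)"
      unfolding contracts_span_def nat.case using that assms(1) Suc
      by (intro chain.span_base) (auto intro!: exI[of _ "s # ts"])
    then show ?thesis by simp
  qed
  ultimately have "chain.span {contracts F schur ts u |ts u. set ts \<subseteq> G \<and> length ts = l} \<subseteq>
      {Q. contract F (schur s) Q \<in> contracts_span (Suc k)}"
    by (intro chain.span_minimal) auto
  then show ?thesis using assms(2) Suc by (auto simp: contracts_span_def)
qed

text \<open>
  Substituting \<open>a D\<^sub>s = D'\<^sub>s + \<phi> s c D\<^sub>r\<close> in a product of contractions, only the terms with at most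
  one factor \<open>D\<^sub>r\<close> survive.
\<close>

lemma contracts_schur:
  "set ts \<subseteq> G \<Longrightarrow> \<exists>Q\<in>contracts_span (length ts).
     smul (a ^ length ts) (contracts F \<phi> ts u) = contracts F schur ts u + contract F (\<phi> r) Q"
proof (induction ts)
  case Nil
  show ?case
    by (rule bexI[of _ 0]) (simp_all only: list.size power_0 chain.scale_one contracts_simps
        contract.zero add_0_right chain.subspace_0[OF contracts_span_subspace])
next
  case (Cons t ts)
  have "set ts \<subseteq> G" using Cons.prems by simp
  from Cons.IH[OF this] obtain Q where Q: "Q \<in> contracts_span (length ts)"
    and eq: "smul (a ^ length ts) (contracts F \<phi> ts u) = contracts F schur ts u + contract F (\<phi> r) Q"
    by (elim bexE)
  let ?C = "contracts F schur ts u"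
  have D: "smul a (contract F (\<phi> t) w) = contract F (schur t) w + smul (\<phi> t c) (contract F (\<phi> r) w)" for w
    by (simp add: contract_schur)
  have "smul (a ^ length (t # ts)) (contracts F \<phi> (t # ts) u) =
      smul a (contract F (\<phi> t) (smul (a ^ length ts) (contracts F \<phi> ts u)))"
    by (simp only: contracts_simps contract.scale chain.scale_scale list.size add_Suc_right add_0_right power_Suc)
  also have "\<dots> = contract F (schur t) ?C + contract F (schur t) (contract F (\<phi> r) Q) +
      smul (\<phi> t c) (contract F (\<phi> r) ?C + contract F (\<phi> r) (contract F (\<phi> r) Q))"
    unfolding eq D by (simp only: contract.add)
  also have "\<dots> = contracts F schur (t # ts) u +
      (- contract F (\<phi> r) (contract F (schur t) Q) + smul (\<phi> t c) (contract F (\<phi> r) ?C))"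
    by (simp only: contract_contract_self[OF F] contract_anticommute[OF F, of "schur t" "\<phi> r"]
        contracts_simps add_0_right add.assoc)
  also have "\<dots> = contracts F schur (t # ts) u +
      contract F (\<phi> r) (- contract F (schur t) Q + smul (\<phi> t c) ?C)"
    by (simp only: contract.add contract.neg contract.scale)
  finally have "smul (a ^ length (t # ts)) (contracts F \<phi> (t # ts) u) = contracts F schur (t # ts) u +
      contract F (\<phi> r) (- contract F (schur t) Q + smul (\<phi> t c) ?C)" .
  moreover have "- contract F (schur t) Q + smul (\<phi> t c) ?C \<in> contracts_span (length (t # ts))"
  proof (intro chain.subspace_add chain.subspace_neg chain.subspace_scale contracts_span_subspace)
    show "contract F (schur t) Q \<in> contracts_span (length (t # ts))"
      using contract_contracts_span[OF _ Q, of t] Cons.prems by simp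
    show "?C \<in> contracts_span (length (t # ts))"
      unfolding contracts_span_def list.size add_Suc_right add_0_right nat.case
      by (rule chain.span_base) (use Cons.prems in auto)
  qed
  ultimately show ?case by blast
qed

lemma determinantal_schur_remove: "determinantal_ideal F G schur m \<subseteq> determinantal_ideal F' G' schur m"
  unfolding determinantal_ideal_def[of F]
proof (rule ideal.span_minimal[OF _ ideal_determinantal], rule subsetI)
  fix x assume "x \<in> {contracts F schur ts u ({}, {#}) |ts u. set ts \<subseteq> G \<and> length ts = m}"
  then obtain ts u where ts: "set ts \<subseteq> G" "length ts = m" and x: "x = contracts F schur ts u ({}, {#})"
    by blast
  have eq: "contracts F schur ts = contracts F' schur ts"
    unfolding contracts_def contract_schur_remove ..
  show "x \<in> determinantal_ideal F' G' schur m"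
  proof (cases "r \<in> set ts")
    case False
    then show ?thesis unfolding x eq by (intro determinantal_idealI) (use ts in auto)
  next
    case True
    then obtain us vs where "ts = us @ r # vs" by (meson split_list)
    then have "contracts F schur ts u = 0"
      by (simp only: contracts_append contracts_simps schur_row[abs_def] contract_zero_left contracts.zero)
    then show ?thesis unfolding x
      by (simp only: zero_fun_apply ideal.subspace_0[OF ideal_determinantal])
  qed
qed

text \<open>One unit of index is lost because a contraction with row \<open>r\<close> of \<phi> may
  take the place of one of the \<open>Suc m\<close> contractions, leaving \<open>m\<close> with rows
  of \<open>schur\<close>. The term without this replacement lies in the ideal for
  \<open>Suc m\<close>, hence in that for \<open>m\<close>.\<close>

lemma determinantal_ideal_schur:
  assumes "x \<in> determinantal_ideal F G \<phi> (Suc m)"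
  shows "a ^ Suc m * x \<in> determinantal_ideal F' G' schur m"
proof -
  let ?J = "determinantal_ideal F G schur m"
  have J: "ideal.subspace ?J" by (rule ideal_determinantal)
  have "ideal.subspace {x. a ^ Suc m * x \<in> ?J}"
    by (rule ideal.subspaceI)
      (use ideal.subspace_0[OF J] ideal.subspace_add[OF J] ideal.subspace_scale[OF J] in
        \<open>simp_all add: distrib_left mult.left_commute del: power_Suc\<close>)
  moreover have "a ^ Suc m * contracts F \<phi> ts u ({}, {#}) \<in> ?J" if ts: "set ts \<subseteq> G" "length ts = Suc m" for ts u
  proof -
    obtain Q where Q: "Q \<in> contracts_span (Suc m)"
      and eq: "smul (a ^ Suc m) (contracts F \<phi> ts u) = contracts F schur ts u + contract F (\<phi> r) Q"
      using contracts_schur[OF ts(1), of u] ts(2) by auto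
    have "contracts F schur ts u ({}, {#}) \<in> ?J"
      using determinantal_ideal_Suc[OF F] determinantal_idealI[OF ts] by blast
    moreover have "contract F (\<phi> r) Q ({}, {#}) \<in> ?J"
    proof -
      have "Q ({b}, {#}) \<in> ?J" if b: "b \<in> F" for b
      proof -
        have "chain.subspace {Q. Q ({b}, {#}) \<in> ?J}"
          by (rule chain.subspaceI)
            (use ideal.subspace_0[OF J] ideal.subspace_add[OF J] ideal.subspace_scale[OF J] in simp_all)
        moreover have "{contracts F schur ts u |ts u. set ts \<subseteq> G \<and> length ts = m} \<subseteq> {Q. Q ({b}, {#}) \<in> ?J}"
          using contracts_coeff_singleton[OF F _ b] by auto
        ultimately have "contracts_span (Suc m) \<subseteq> {Q. Q ({b}, {#}) \<in> ?J}"
          unfolding contracts_span_def nat.case by (intro chain.span_minimal)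
        then show ?thesis using Q by blast
      qed
      then show ?thesis unfolding contract_apply
        by (intro ideal.subspace_sum[OF J] ideal.subspace_scale[OF J]) simp
    qed
    ultimately have "smul (a ^ Suc m) (contracts F \<phi> ts u) ({}, {#}) \<in> ?J"
      unfolding eq plus_fun_apply by (intro ideal.subspace_add[OF J])
    then show ?thesis by (simp only: smul_apply)
  qed
  ultimately have "determinantal_ideal F G \<phi> (Suc m) \<subseteq> {x. a ^ Suc m * x \<in> ?J}"
    unfolding determinantal_ideal_def[of F G \<phi>] by (intro ideal.span_minimal) auto
  then show ?thesis using assms determinantal_schur_remove by blast
qed

end


section \<open>Acyclicity of the strands of the Koszul complex\<close>

text \<open>The form in which "depth at least \<open>d\<close> after inverting \<open>b\<close>" is
  used: the sequence is regular in the ring itself and enters \<open>I\<close> only up to radical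
  and multiplication by \<open>b\<close>, as members of a saturation do.\<close>

definition deep :: "'a::comm_ring_1 \<Rightarrow> 'a set \<Rightarrow> nat \<Rightarrow> bool" where
  "deep b I d \<longleftrightarrow> (\<exists>xs. weakly_regular xs \<and> length xs = d \<and> (\<forall>x\<in>set xs. b * x \<in> radical I))"

theorem koszul_strand_acyclic:
  assumes "finite F" "finite G" "card G \<le> card F" "card F < i + card G"
    and "\<And>m. card F < m + min i (card F) \<Longrightarrow> m \<le> card G \<Longrightarrow>
           deep b (determinantal_ideal F G \<phi> m) (card F - m + 1)"
    and "j \<ge> 1"
  shows "b \<in> radical (koszul_annihilator F G \<phi> i j)"
  using assms
proof (induction "card G" arbitrary: F G \<phi> b j)
  case 0
  interpret free_complex "koszul_basis F G i" "\<lambda>_. delta F G \<phi>" by (rule free_complex_koszul[OF 0(2,3)])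
  \<comment> \<open>With \<open>G\<close> empty the polynomial degree must be 0, so
    \<open>j = i\<close>, and \<open>F\<close> has fewer than \<open>i\<close> elements.\<close>
  have "koszul_basis F G i j = {}"
  proof (rule ccontr)
    assume "koszul_basis F G i j \<noteq> {}"
    then obtain A w where "(A, w) \<in> koszul_basis F G i j" by fast
    then have "j \<le> i" "A \<subseteq> F" "set_mset w \<subseteq> G" "card A = j" "size w = i - j"
      by (simp_all add: koszul_basis_def basis_iff split: if_splits)
    moreover have "G = {}" using 0(1,3) by simp
    moreover have "card A \<le> card F" using \<open>A \<subseteq> F\<close> 0(2) by (rule card_mono[rotated])
    ultimately show False using 0(5) by simp
  qed
  then have "Z j \<subseteq> {0}" by (auto simp: Z_def free_mod_empty)
  then have "b ^ 1 \<in> annihilator j"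
    by (auto simp: annihilator_def chain.subspace_0[OF B_subspace])
  then show ?case by (rule radicalI)
next
  case (Suc g)
  note F = Suc.prems(1) and G = Suc.prems(2)
  interpret free_complex "koszul_basis F G i" "\<lambda>_. delta F G \<phi>" by (rule free_complex_koszul[OF F G])
  define e where "e = min i (card F)"
  \<comment> \<open>\<open>Suc m\<close> is the least index covered by the hypothesis; the number of
    elements it provides is exactly \<open>e\<close>, the length of the complex.\<close>
  define m where "m = card F - e"
  have m: "Suc m \<le> card G" using Suc.prems(3,4) Suc.hyps(2) unfolding m_def e_def by auto
  have "card F - Suc m + 1 = e"
    using Suc.prems(3) m unfolding m_def e_def by auto
  then obtain xs where xs: "weakly_regular xs" "length xs = e"
    "\<And>x. x \<in> set xs \<Longrightarrow> b * x \<in> radical (determinantal_ideal F G \<phi> (Suc m))"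
    using Suc.prems(5)[of "Suc m"] m unfolding deep_def m_def e_def by auto
  show ?case
  proof (rule acyclicity[OF xs(1)])
    fix k assume k: "length xs < k"
    show "koszul_basis F G i k = {}"
    proof (rule ccontr)
      assume "koszul_basis F G i k \<noteq> {}"
      then obtain A w where "(A, w) \<in> koszul_basis F G i k" by fast
      then have "k \<le> i" "A \<subseteq> F" "card A = k"
        by (simp_all add: koszul_basis_def basis_iff split: if_splits)
      moreover have "card A \<le> card F" by (rule card_mono[OF F \<open>A \<subseteq> F\<close>])
      ultimately have "k \<le> e" unfolding e_def by (intro min.boundedI) (simp_all only:)
      then show False using k unfolding xs(2) by (rule leD[THEN notE])
    qed
  next
    fix x k assume x: "x \<in> set xs" and k: "(1::nat) \<le> k"
    let ?R = "radical (annihilator k)"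
    have R: "ideal.subspace ?R" by (rule ideal_radical[OF annihilator_ideal])
    have entry: "b * \<phi> r c \<in> ?R" if r: "r \<in> G" and c: "c \<in> F" for r c
    proof -
      interpret P: pivot F G \<phi> r c by unfold_locales (fact F G r c)+
      have cards: "card (F - {c}) = card F - 1" "card (G - {r}) = card G - 1" "card F \<ge> 1" "card G \<ge> 1"
        using F G r c by (auto simp: card_gt_0_iff Suc_le_eq)
      have "b * \<phi> r c \<in> radical (koszul_annihilator (F - {c}) (G - {r}) P.schur i k)"
      proof (rule Suc.hyps(1))
        show "g = card (G - {r})" using cards Suc.hyps(2) by simp
        show "card (G - {r}) \<le> card (F - {c})" using cards Suc.prems(3) by simp
        show "card (F - {c}) < i + card (G - {r})" using cards Suc.prems(4) by simp
        fix m' assume m': "card (F - {c}) < m' + min i (card (F - {c}))" "m' \<le> card (G - {r})"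
        \<comment> \<open>Index and size of the matrix drop together: an index m' admissible for the
          smaller matrix makes \<open>Suc m'\<close> admissible for \<phi>, and both ask for the
          same number of elements. So the sequence \<open>ys\<close> can be reused.\<close>
        have "card F < Suc m' + min i (card F)" "Suc m' \<le> card G" using m' cards by auto
        from Suc.prems(5)[OF this] obtain ys where ys: "weakly_regular ys" "length ys = card F - Suc m' + 1"
          "\<And>y. y \<in> set ys \<Longrightarrow> b * y \<in> radical (determinantal_ideal F G \<phi> (Suc m'))"
          unfolding deep_def by auto
        have "b * \<phi> r c * y \<in> radical (determinantal_ideal (F - {c}) (G - {r}) P.schur m')" if y: "y \<in> set ys" for y
        proof -
          let ?J = "determinantal_ideal (F - {c}) (G - {r}) P.schur m'"
          obtain n where "(b * y) ^ n \<in> determinantal_ideal F G \<phi> (Suc m')"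
            using ys(3)[OF y] by (auto simp: radical_def)
          then have "\<phi> r c ^ Suc m' * (b * y) ^ n \<in> ?J" by (rule P.determinantal_ideal_schur)
          then have "(\<phi> r c ^ n * (b * y) ^ Suc m') * (\<phi> r c ^ Suc m' * (b * y) ^ n) \<in> ?J"
            by (rule ideal.subspace_scale[OF ideal_determinantal])
          moreover have "(\<phi> r c ^ n * (b * y) ^ Suc m') * (\<phi> r c ^ Suc m' * (b * y) ^ n) =
              (b * \<phi> r c * y) ^ (n + Suc m')"
            by (simp only: power_mult_distrib power_add mult_ac)
          ultimately show ?thesis by (metis radicalI)
        qed
        moreover have "card (F - {c}) - m' + 1 = length ys" using ys(2) cards m' Suc.prems(3) by auto
        ultimately show "deep (b * \<phi> r c) (determinantal_ideal (F - {c}) (G - {r}) P.schur m')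
            (card (F - {c}) - m' + 1)"
          unfolding deep_def using ys(1) by auto
      qed (use F G k in auto)
      \<comment> \<open>The induction hypothesis was applied with \<open>b * \<phi> r c\<close> in
        place of \<open>b\<close>, since the depth of the Schur complement is controlled only where
        the entry is invertible; the reduction brings in a second factor \<open>\<phi> r c\<close>,
        hence the square.\<close>
      from P.annihilator_reduction[OF this k] have "b * (\<phi> r c * (b * \<phi> r c)) \<in> ?R"
        by (rule ideal.subspace_scale[OF R])
      then have "(b * \<phi> r c) ^ 2 \<in> ?R" by (simp only: power2_eq_square mult_ac)
      then show ?thesis by (rule radical_power)
    qed
    have "ideal.subspace {y. b * y \<in> ?R}"
      by (rule ideal.subspaceI)
        (use ideal.subspace_0[OF R] ideal.subspace_add[OF R] ideal.subspace_scale[OF R] in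
          \<open>simp_all add: distrib_left mult.left_commute\<close>)
    then have "ideal.span {\<phi> t c |t c. t \<in> G \<and> c \<in> F} \<subseteq> {y. b * y \<in> ?R}"
      using entry by (intro ideal.span_minimal) auto
    then have sub: "determinantal_ideal F G \<phi> (Suc m) \<subseteq> {y. b * y \<in> ?R}"
      using determinantal_ideal_entries[OF F] by blast
    obtain n where "(b * x) ^ n \<in> determinantal_ideal F G \<phi> (Suc m)"
      using xs(3)[OF x] by (auto simp: radical_def)
    with sub have "b * (b * x) ^ n \<in> ?R" unfolding subset_iff mem_Collect_eq by (elim allE impE)
    then have "x * (b * (b * x) ^ n) \<in> ?R" by (rule ideal.subspace_scale[OF R])
    then have "(b * x) ^ Suc n \<in> ?R" by (simp only: power_Suc mult_ac)
    then show "b * x \<in> ?R" by (rule radical_power)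
  qed (rule Suc.prems(6))
qed


section \<open>Acyclicity of the generalized Eagon-Northcott complexes\<close>

text \<open>\<open>contracts\<close> applies the last member of its list first, so the reversed list
  contracts with row 0 first. This order yields the splice map with its shuffle signs, see
  \<open>contracts_rev_apply\<close>.\<close>

definition en_map :: "nat \<Rightarrow> nat \<Rightarrow> (nat \<Rightarrow> nat \<Rightarrow> 'a::comm_ring_1) \<Rightarrow> int \<Rightarrow> nat \<Rightarrow> 'a chain \<Rightarrow> 'a chain" where
  "en_map f g \<phi> i j = (if int j \<le> i then delta {..<f} {..<g} \<phi>
     else if int j = i + 1 then contracts {..<f} \<phi> (rev [0..<g])
     else partial {..<f} {..<g} \<phi>)"

text \<open>Beyond the length of the complex there are no sets \<open>A\<close> of the required
  size, so the cut-off in \<open>en_basis\<close> is automatic.\<close>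

lemma en_basis_left:
  assumes "g \<le> f" "int j \<le> i"
  shows "en_basis f g i j = basis {..<f} {..<g} j (nat i - j)"
proof (cases "j > en_length f g i")
  case True
  have "j > f" using True assms by (auto simp: en_length_def split: if_splits)
  then have "\<not> A \<subseteq> {..<f} \<or> card A \<noteq> j" for A
    using card_mono[of "{..<f}" A] by auto
  then show ?thesis using True by (auto simp: en_basis_def basis_def)
next
  case False
  have "int n = i - int j \<longleftrightarrow> n = nat i - j" for n using assms by linarith
  then show ?thesis using False assms by (auto simp: en_basis_def basis_def)
qed

text \<open>The assumption \<open>1 \<le> g + j\<close> excludes exterior degree -1, which truncated
  subtraction would turn into 0.\<close>

lemma en_basis_right:
  assumes "g \<le> f" "- 1 \<le> i" "i < int j" "1 \<le> g + j"
  shows "en_basis f g i j = basis {..<f} {..<g} (g + j - 1) (j - nat (i + 1))"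
proof (cases "j > en_length f g i")
  case True
  have "g + j - 1 > f" using True assms by (auto simp: en_length_def split: if_splits)
  then have "\<not> A \<subseteq> {..<f} \<or> card A \<noteq> g + j - 1" for A
    using card_mono[of "{..<f}" A] by auto
  then show ?thesis using True by (auto simp: en_basis_def basis_def)
next
  case False
  have "int n = int j - i - 1 \<longleftrightarrow> n = j - nat (i + 1)" for n using assms by linarith
  moreover have "int n = int g + int j - 1 \<longleftrightarrow> n = g + j - 1" for n using assms by linarith
  ultimately show ?thesis using False assms by (auto simp: en_basis_def basis_def)
qed

lemma free_complex_en:
  fixes \<phi> :: "nat \<Rightarrow> nat \<Rightarrow> 'a::comm_ring_1"
  assumes g: "g \<le> f" and i: "- 1 \<le> i"
  shows "free_complex (en_basis f g i) (en_map f g \<phi> i)"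
proof
  fix j
  show "en_map f g \<phi> i j (u + v) = en_map f g \<phi> i j u + en_map f g \<phi> i j v" for u v :: "'a chain"
    by (simp only: en_map_def delta.add contracts.add partial.add split: if_split) simp
  show "en_map f g \<phi> i j (smul c u) = smul c (en_map f g \<phi> i j u)" for c and u :: "'a chain"
    by (simp only: en_map_def delta.scale contracts.scale partial.scale split: if_split) simp
next
  fix I j and u :: "'a chain"
  assume I: "ideal.subspace I" and u: "u \<in> coeffs_in (en_basis f g i (Suc j)) I"
  consider "int (Suc j) \<le> i" | "int (Suc j) = i + 1" | "int (Suc j) > i + 1" by linarith
  then show "en_map f g \<phi> i (Suc j) u \<in> coeffs_in (en_basis f g i j) I"
  proof cases
    case 1
    then have "nat i - j = Suc (nat i - Suc j)" by linarith
    then show ?thesis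
      using delta_basis[OF finite_lessThan I, of u f "{..<g}" j "nat i - Suc j" \<phi>] 1 u
      by (simp add: en_map_def en_basis_left[OF g])
  next
    case 2
    then have eqs: "nat (i + 1) = Suc j" "nat i = j" "int j \<le> i" "\<not> int (Suc j) \<le> i" "i < int (Suc j)" by linarith+
    have "u \<in> coeffs_in (basis {..<f} {..<g} (length (rev [0..<g]) + j) 0) I"
      using u by (simp add: en_basis_right[OF g i eqs(5)] eqs(1))
    from contracts_basis[OF finite_lessThan I this, of \<phi>] show ?thesis
      unfolding en_map_def en_basis_left[OF g eqs(3)] eqs(2) using 2 eqs(4) by simp
  next
    case 3
    then have m: "en_map f g \<phi> i (Suc j) = partial {..<f} {..<g} \<phi>" by (auto simp: en_map_def)
    show ?thesis
    proof (cases "1 \<le> g + j")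
      case True
      have eqs: "i < int j" "i < int (Suc j)" "g + Suc j - 1 = Suc (g + j - 1)" "Suc j - nat (i + 1) = Suc (j - nat (i + 1))"
        using 3 True by linarith+
      have "1 \<le> g + Suc j" by simp
      from u have "u \<in> coeffs_in (basis {..<f} {..<g} (Suc (g + j - 1)) (Suc (j - nat (i + 1)))) I"
        unfolding en_basis_right[OF g i eqs(2) \<open>1 \<le> g + Suc j\<close>] eqs(3,4) .
      from partial_basis[OF finite_lessThan I this, of \<phi>] show ?thesis
        unfolding m en_basis_right[OF g i eqs(1) True] .
    next
      case False
      then have "g = 0" by simp
      then have "partial {..<f} {..<g} \<phi> u = 0" by (simp add: partial_def)
      then show ?thesis unfolding m by (simp only: chain.subspace_0[OF coeffs_in_subspace[OF I]])
    qed
  qed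
next
  fix j and u :: "'a chain"
  have set: "set (rev [0..<g]) = {..<g}" by auto
  consider "int (Suc (Suc j)) \<le> i" | "int (Suc (Suc j)) = i + 1" | "int (Suc (Suc j)) = i + 2" | "int (Suc (Suc j)) > i + 2"
    by linarith
  then show "en_map f g \<phi> i (Suc j) (en_map f g \<phi> i (Suc (Suc j)) u) = 0"
  proof cases
    case 1
    then have "en_map f g \<phi> i (Suc j) = delta {..<f} {..<g} \<phi>" "en_map f g \<phi> i (Suc (Suc j)) = delta {..<f} {..<g} \<phi>"
      by (auto simp: en_map_def)
    then show ?thesis by (simp only: delta_delta[OF finite_lessThan finite_lessThan])
  next
    case 2
    then have "en_map f g \<phi> i (Suc j) = delta {..<f} {..<g} \<phi>" "en_map f g \<phi> i (Suc (Suc j)) = contracts {..<f} \<phi> (rev [0..<g])"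
      by (auto simp: en_map_def)
    then show ?thesis by (simp only: delta_contracts[OF finite_lessThan set])
  next
    case 3
    then have "en_map f g \<phi> i (Suc j) = contracts {..<f} \<phi> (rev [0..<g])" "en_map f g \<phi> i (Suc (Suc j)) = partial {..<f} {..<g} \<phi>"
      by (auto simp: en_map_def)
    then show ?thesis by (simp only: contracts_partial[OF finite_lessThan finite_lessThan set])
  next
    case 4
    then have "en_map f g \<phi> i (Suc j) = partial {..<f} {..<g} \<phi>" "en_map f g \<phi> i (Suc (Suc j)) = partial {..<f} {..<g} \<phi>"
      by (auto simp: en_map_def)
    then show ?thesis by (simp only: partial_partial[OF finite_lessThan finite_lessThan])
  qed
qed

abbreviation en_annihilator :: "nat \<Rightarrow> nat \<Rightarrow> (nat \<Rightarrow> nat \<Rightarrow> 'a::comm_ring_1) \<Rightarrow> int \<Rightarrow> nat \<Rightarrow> 'a set" where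
  "en_annihilator f g \<phi> i j \<equiv> free_complex.annihilator (en_basis f g i) (en_map f g \<phi> i) j"

text \<open>The cases are the positions relative to the splice map: \<open>delta_exact\<close> on
  the symmetric side, \<open>delta_exact_0\<close> and \<open>partial_exact_0\<close> at its two
  ends, \<open>partial_exact\<close> on the dual side.\<close>

lemma maximal_minor_power_annihilates:
  fixes \<phi> :: "nat \<Rightarrow> nat \<Rightarrow> 'a::comm_ring_1"
  assumes g: "g \<le> f" and i: "- 1 \<le> i" and j: "1 \<le> j"
    and dual: "dual_vectors {..<f} {..<g} \<phi> \<psi> \<Delta>"
  shows "\<Delta> ^ g \<in> en_annihilator f g \<phi> i j"
proof -
  interpret free_complex "en_basis f g i" "en_map f g \<phi> i" by (rule free_complex_en[OF g i])
  interpret V: dual_vectors "{..<f}" "{..<g}" \<phi> \<psi> \<Delta> by (rule dual)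
  have ts: "distinct (rev [0..<g])" "set (rev [0..<g]) = {..<g}" by auto
  have "smul (\<Delta> ^ g) z \<in> B j" if "z \<in> Z j" for z
  proof -
    have z: "z \<in> free_mod (en_basis f g i j)" "en_map f g \<phi> i j z = 0" using that by (auto simp: Z_def)
    have gj: "1 \<le> g + Suc j" "1 \<le> g + j" using j by auto
    consider "int (Suc j) \<le> i" | "int j = i" | "int j = i + 1" | "int j > i + 1" by linarith
    then show ?thesis
    proof cases
      case 1
      then have eqs: "int j \<le> i" "nat i - j = Suc (nat i - Suc j)" by linarith+
      have "\<exists>w\<in>free_mod (basis {..<f} {..<g} (Suc j) (nat i - Suc j)).
          smul (\<Delta> ^ card {..<g}) z = delta {..<f} {..<g} \<phi> w"
        by (rule V.delta_exact)
          (use z eqs in \<open>simp_all add: en_basis_left[OF g] en_map_def\<close>)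
      then show ?thesis using 1
        by (auto simp: B_def en_basis_left[OF g] en_map_def)
    next
      case 2
      then have eqs: "int j \<le> i" "nat i = j" "nat (i + 1) = Suc j" "i < int (Suc j)" "int (Suc j) = i + 1" "\<not> int (Suc j) \<le> i" by linarith+
      have z0: "z \<in> free_mod (basis {..<f} {..<g} j 0)" "delta {..<f} {..<g} \<phi> z = 0"
        using z eqs(1,2) by (simp_all add: en_basis_left[OF g] en_map_def)
      from V.delta_exact_0[OF z0(1) ts z0(2)] show ?thesis
        unfolding B_def en_basis_right[OF g i eqs(4) gj(1)] en_map_def eqs(3)
        using eqs(5,6) by auto
    next
      case 3
      then have eqs: "i < int j" "nat (i + 1) = j" "i < int (Suc j)" "\<not> int j \<le> i" "\<not> int (Suc j) \<le> i" "int (Suc j) \<noteq> i + 1" by linarith+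
      have "z \<in> free_mod (basis {..<f} {..<g} (card {..<g} + (j - 1)) 0)"
        using z(1) j unfolding en_basis_right[OF g i eqs(1) gj(2)] eqs(2) by simp
      moreover have "contracts {..<f} \<phi> (rev [0..<g]) z = 0"
        using z(2) eqs(4) 3 by (simp add: en_map_def)
      ultimately obtain w where "w \<in> free_mod (basis {..<f} {..<g} (Suc (card {..<g} + (j - 1))) (Suc 0))"
        "smul (\<Delta> ^ card {..<g}) z = partial {..<f} {..<g} \<phi> w"
        using V.partial_exact_0[OF _ ts] by blast
      moreover have "Suc (card {..<g} + (j - 1)) = g + Suc j - 1" "Suc j - nat (i + 1) = Suc 0"
        using j eqs(2) by simp_all
      ultimately show ?thesis
        unfolding B_def en_basis_right[OF g i eqs(3) gj(1)] en_map_def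
        using eqs(5,6) by auto
    next
      case 4
      then have eqs: "i < int j" "i < int (Suc j)" "\<not> int j \<le> i" "int j \<noteq> i + 1" "\<not> int (Suc j) \<le> i" "int (Suc j) \<noteq> i + 1"
        "j - nat (i + 1) = Suc (j - nat (i + 1) - 1)" "Suc j - nat (i + 1) = Suc (Suc (j - nat (i + 1) - 1))"
        "g + Suc j - 1 = Suc (g + j - 1)"
        using i j by linarith+
      have "z \<in> free_mod (basis {..<f} {..<g} (g + j - 1) (Suc (j - nat (i + 1) - 1)))"
        using z(1) unfolding en_basis_right[OF g i eqs(1) gj(2)] eqs(7)[symmetric] .
      moreover have "partial {..<f} {..<g} \<phi> z = 0"
        using z(2) eqs(3,4) by (simp add: en_map_def)
      ultimately obtain w where "w \<in> free_mod (basis {..<f} {..<g} (Suc (g + j - 1)) (Suc (Suc (j - nat (i + 1) - 1))))"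
        "smul (\<Delta> ^ card {..<g}) z = partial {..<f} {..<g} \<phi> w"
        using V.partial_exact by blast
      then show ?thesis
        unfolding B_def en_basis_right[OF g i eqs(2) gj(1)] en_map_def eqs(8,9)
        using eqs(5,6) by auto
    qed
  qed
  then show ?thesis by (simp add: annihilator_def)
qed

lemma en_acyclic_short:
  fixes \<phi> :: "nat \<Rightarrow> nat \<Rightarrow> 'a::comm_ring_1"
  assumes g: "g \<le> f" and i: "- 1 \<le> i" "i \<le> int f - int g" and j: "1 \<le> j"
    and deep: "deep b (determinantal_ideal {..<f} {..<g} \<phi> g) (f - g + 1)"
  shows "b \<in> radical (en_annihilator f g \<phi> i j)"
proof -
  interpret free_complex "en_basis f g i" "en_map f g \<phi> i" by (rule free_complex_en[OF g i(1)])
  obtain xs where xs: "weakly_regular xs" "length xs = f - g + 1"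
    "\<And>x. x \<in> set xs \<Longrightarrow> b * x \<in> radical (determinantal_ideal {..<f} {..<g} \<phi> g)"
    using deep by (auto simp: deep_def)
  show ?thesis
  proof (rule acyclicity[OF xs(1) _ _ j])
    fix k assume "length xs < k"
    then show "en_basis f g i k = {}" using i(2) xs(2) by (simp add: en_basis_def en_length_def)
  next
    fix x k assume x: "x \<in> set xs" and k: "(1::nat) \<le> k"
    have R: "ideal.subspace (radical (annihilator k))" by (rule ideal_radical[OF annihilator_ideal])
    have "contracts {..<f} \<phi> ts u ({}, {#}) \<in> radical (annihilator k)"
      if ts: "set ts \<subseteq> {..<g}" "length ts = g" for ts u
    proof (cases "distinct ts")
      case False
      then show ?thesis
        by (simp only: contracts_not_distinct[OF finite_lessThan] zero_fun_apply ideal.subspace_0[OF R] simp_thms)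
    next
      case True
      \<comment> \<open>A list of length \<open>g\<close> without repetitions uses every row, so
        Cramer's rule applies to its contraction.\<close>
      then have "set ts = {..<g}"
        using ts distinct_card[OF True] by (intro card_subset_eq) auto
      then obtain \<psi> where "dual_vectors {..<f} {..<g} \<phi> \<psi> (contracts {..<f} \<phi> ts u ({}, {#}))"
        using dual_vectors_exist[OF finite_lessThan finite_lessThan True] by blast
      then show ?thesis by (intro radicalI[OF maximal_minor_power_annihilates[OF g i(1) k]])
    qed
    then have "determinantal_ideal {..<f} {..<g} \<phi> g \<subseteq> radical (annihilator k)"
      unfolding determinantal_ideal_def by (intro ideal.span_minimal R) auto
    moreover obtain n where "(b * x) ^ n \<in> determinantal_ideal {..<f} {..<g} \<phi> g"
      using xs(3)[OF x] unfolding radical_def by blast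
    ultimately show "b * x \<in> radical (annihilator k)"
      by (intro radical_power[of "b * x" n]) (rule subsetD)
  qed
qed

text \<open>In positive degrees the modules are those of the Koszul strand. Beyond degree
  \<open>i\<close>, where \<open>en_map\<close> ceases to be \<open>delta\<close>, they vanish, so
  it suffices to compare cycles and boundaries.\<close>

lemma en_acyclic_long:
  fixes \<phi> :: "nat \<Rightarrow> nat \<Rightarrow> 'a::comm_ring_1"
  assumes g: "g \<le> f" and i: "int f - int g < i" and j: "1 \<le> j"
    and deep: "\<And>m. f < m + min (nat i) f \<Longrightarrow> m \<le> g \<Longrightarrow>
      deep b (determinantal_ideal {..<f} {..<g} \<phi> m) (f - m + 1)"
  shows "b \<in> radical (en_annihilator f g \<phi> i j)"
proof -
  have i': "- 1 \<le> i" using i g by linarith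
  interpret E: free_complex "en_basis f g i" "en_map f g \<phi> i" by (rule free_complex_en[OF g i'])
  interpret K: free_complex "koszul_basis {..<f} {..<g} (nat i)" "\<lambda>_. delta {..<f} {..<g} \<phi>"
    by (rule free_complex_koszul) simp_all
  have le: "m \<le> nat i \<longleftrightarrow> int m \<le> i" for m using i g by linarith
  have X: "en_basis f g i k = koszul_basis {..<f} {..<g} (nat i) k" if k: "k \<ge> 1" for k
  proof (cases "int k \<le> i")
    case True
    then show ?thesis by (simp add: en_basis_left[OF g] koszul_basis_def le)
  next
    case False
    have "k > en_length f g i" using False i g by (auto simp: en_length_def)
    then show ?thesis using False i g by (simp add: en_basis_def koszul_basis_def le)
  qed
  have "E.Z j \<subseteq> K.Z j"
  proof
    fix z assume z: "z \<in> E.Z j"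
    show "z \<in> K.Z j"
    proof (cases "int j \<le> i")
      case True
      then show ?thesis using z by (simp add: E.Z_def K.Z_def X[OF j] en_map_def)
    next
      case False
      then have "z = 0" using z i g by (simp add: E.Z_def X[OF j] koszul_basis_def le free_mod_empty)
      then show ?thesis by (simp only: chain.subspace_0[OF K.Z_subspace])
    qed
  qed
  moreover have "K.B j \<subseteq> E.B j"
  proof
    fix y assume y: "y \<in> K.B j"
    show "y \<in> E.B j"
    proof (cases "int (Suc j) \<le> i")
      case True
      then show ?thesis using y by (simp add: E.B_def K.B_def X en_map_def)
    next
      case False
      then have "y = 0" using y i g
        by (auto simp: K.B_def koszul_basis_def le free_mod_empty delta.zero)
      then show ?thesis by (simp only: chain.subspace_0[OF E.B_subspace])
    qed
  qed
  ultimately have "K.annihilator j \<subseteq> E.annihilator j"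
    unfolding K.annihilator_def E.annihilator_def by blast
  moreover have "b \<in> radical (K.annihilator j)"
    by (rule koszul_strand_acyclic) (use g i j deep in auto)
  ultimately show ?thesis using radical_mono by blast
qed

theorem en_acyclic:
  fixes \<phi> :: "nat \<Rightarrow> nat \<Rightarrow> 'a::comm_ring_1"
  assumes g: "g \<le> f" and i: "- 1 \<le> i" and j: "1 \<le> j"
    and deep: "\<And>m. int f - int (en_length f g i) + 1 \<le> int m \<Longrightarrow> m \<le> g \<Longrightarrow>
      deep b (determinantal_ideal {..<f} {..<g} \<phi> m) (f - m + 1)"
  shows "b \<in> radical (en_annihilator f g \<phi> i j)"
proof (cases "i \<le> int f - int g")
  case True
  show ?thesis
    by (rule en_acyclic_short[OF g i True j]) (rule deep, use g True in \<open>auto simp: en_length_def\<close>)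
next
  case False
  show ?thesis
    by (rule en_acyclic_long[OF g _ j]) (use False in simp, rule deep, use False in \<open>auto simp: en_length_def\<close>)
qed


section \<open>Iterated contractions and minors\<close>

text \<open>The rows are taken in the order of \<open>ts\<close>, so that signs agree with those of
  iterated contractions.\<close>

definition list_minor :: "(nat \<Rightarrow> nat \<Rightarrow> 'a::comm_ring_1) \<Rightarrow> nat list \<Rightarrow> nat set \<Rightarrow> 'a" where
  "list_minor \<phi> ts T = Determinant.det (Matrix.mat (length ts) (length ts)
     (\<lambda>(p, q). \<phi> (ts ! p) (sorted_list_of_set T ! q)))"

lemma sorted_list_of_set_remove_nth:
  fixes T :: "nat set"
  assumes T: "finite T" and j: "j < card T" and q: "q < card T - 1"
  shows "sorted_list_of_set (T - {sorted_list_of_set T ! j}) ! q =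
    sorted_list_of_set T ! (if q < j then q else Suc q)"
proof -
  let ?xs = "sorted_list_of_set T"
  have xs: "distinct ?xs" "length ?xs = card T" using T by auto
  have split: "?xs = take j ?xs @ ?xs ! j # drop (Suc j) ?xs" using j xs(2) by (simp add: id_take_nth_drop)
  have "?xs ! j \<notin> set (take j ?xs)" 
    using xs split by (metis distinct.simps(2) distinct_append disjoint_iff list.set_intros(1))
  then have "remove1 (?xs ! j) ?xs = take j ?xs @ drop (Suc j) ?xs"
    using split by (metis remove1.simps(2) remove1_append)
  moreover have "sorted_list_of_set (T - {?xs ! j}) = remove1 (?xs ! j) ?xs"
    using sorted_list_of_set_remove[OF T] .
  ultimately show ?thesis using j q xs(2) by (simp add: nth_append)
qed

lemma card_greater_nth:
  fixes T :: "nat set"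
  assumes T: "finite T" and j: "j < card T"
  shows "card {x \<in> T. sorted_list_of_set T ! j < x} = card T - Suc j"
proof -
  let ?xs = "sorted_list_of_set T"
  have xs: "distinct ?xs" "length ?xs = card T" "sorted_wrt (<) ?xs" "set ?xs = T" using T by auto
  have "{x \<in> T. ?xs ! j < x} = (!) ?xs ` {Suc j..<card T}"
  proof (intro equalityI subsetI)
    fix x assume "x \<in> {x \<in> T. ?xs ! j < x}"
    then obtain k where k: "k < card T" "x = ?xs ! k" "?xs ! j < ?xs ! k"
      using xs by (metis (mono_tags, lifting) in_set_conv_nth mem_Collect_eq)
    have "j < k"
    proof (rule ccontr)
      assume "\<not> j < k"
      then have "?xs ! k \<le> ?xs ! j"
        using j k(1) xs(2) sorted_nth_mono[of ?xs k j] by simp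
      then show False using k(3) by simp
    qed
    then show "x \<in> (!) ?xs ` {Suc j..<card T}" using k by auto
  next
    fix x assume "x \<in> (!) ?xs ` {Suc j..<card T}"
    then obtain k where "k \<in> {Suc j..<card T}" and k': "x = ?xs ! k" by (rule imageE)
    then have k: "j < k" "k < card T" "x = ?xs ! k" by simp_all
    then show "x \<in> {x \<in> T. ?xs ! j < x}"
      using sorted_wrt_nth_less[OF xs(3), of j k] xs by (metis mem_Collect_eq nth_mem)
  qed
  moreover have "inj_on ((!) ?xs) {Suc j..<card T}"
    using xs(1,2) by (intro inj_on_nth) auto
  ultimately show ?thesis by (simp add: card_image)
qed

lemma sum_sorted_list:
  fixes T :: "nat set"
  assumes "finite T"
  shows "(\<Sum>a\<in>T. h a) = (\<Sum>j<card T. h (sorted_list_of_set T ! j))"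
proof -
  have "bij_betw ((!) (sorted_list_of_set T)) {..<card T} T"
    using assms by (intro bij_betw_nth) auto
  then show ?thesis by (rule sum.reindex_bij_betw[symmetric])
qed

lemma list_minor_last_row:
  fixes \<phi> :: "nat \<Rightarrow> nat \<Rightarrow> 'a::comm_ring_1"
  assumes T: "finite T" "card T = Suc (length ts)"
  shows "list_minor \<phi> (ts @ [t]) T =
    (\<Sum>a\<in>T. (- 1) ^ card {x \<in> T. a < x} * (\<phi> t a * list_minor \<phi> ts (T - {a})))"
proof -
  let ?m = "length ts" and ?xs = "sorted_list_of_set T"
  let ?A = "Matrix.mat (Suc ?m) (Suc ?m) (\<lambda>(p, q). \<phi> ((ts @ [t]) ! p) (?xs ! q))"
  have "list_minor \<phi> (ts @ [t]) T = Determinant.det ?A" by (simp add: list_minor_def)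
  also have "\<dots> = (\<Sum>j<Suc ?m. ?A $$ (?m, j) * cofactor ?A ?m j)"
    by (rule laplace_expansion_row) auto
  also have "\<dots> = (\<Sum>j<card T. (- 1) ^ card {x \<in> T. ?xs ! j < x} *
      (\<phi> t (?xs ! j) * list_minor \<phi> ts (T - {?xs ! j})))"
    unfolding T(2)
  proof (rule sum.cong[OF refl])
    fix j assume "j \<in> {..<Suc ?m}"
    then have j: "j < Suc ?m" by simp
    have "mat_delete ?A ?m j = Matrix.mat ?m ?m (\<lambda>(p, q). \<phi> (ts ! p) (sorted_list_of_set (T - {?xs ! j}) ! q))"
      unfolding mat_delete_def using j sorted_list_of_set_remove_nth[OF T(1), of j] T(2)
      by (intro eq_matI) (auto simp: nth_append)
    then have "cofactor ?A ?m j = (- 1) ^ (?m + j) * list_minor \<phi> ts (T - {?xs ! j})"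
      by (simp add: cofactor_def list_minor_def)
    \<comment> \<open>The number of later columns is \<open>?m - j\<close>, which has the parity of
      \<open>?m + j\<close>.\<close>
    moreover have "(- 1 :: 'a) ^ (?m + j) = (- 1) ^ card {x \<in> T. ?xs ! j < x}"
    proof -
      have "?m + j = card {x \<in> T. ?xs ! j < x} + 2 * j"
        using card_greater_nth[OF T(1), of j] j T(2) by simp
      then show ?thesis by (simp only: power_add power_mult power2_minus power_one mult_1_right)
    qed
    moreover have "?A $$ (?m, j) = \<phi> t (?xs ! j)" using j by simp
    ultimately show "?A $$ (?m, j) * cofactor ?A ?m j =
        (- 1) ^ card {x \<in> T. ?xs ! j < x} * (\<phi> t (?xs ! j) * list_minor \<phi> ts (T - {?xs ! j}))"
      by (simp only: mult_ac)
  qed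
  finally show ?thesis unfolding sum_sorted_list[OF T(1)] .
qed

definition inversion_sign :: "nat set \<Rightarrow> nat set \<Rightarrow> 'a::comm_ring_1" where
  "inversion_sign T B = (- 1) ^ card {(t, u). t \<in> T \<and> u \<in> B \<and> u < t}"

text \<open>Besides the pairs not involving \<open>a\<close>, both sides count the elements of
  \<open>B\<close> below \<open>a\<close> and those of \<open>T\<close> above
  \<open>a\<close>.\<close>

lemma inversion_sign_insert:
  assumes T: "finite T" and a: "a \<in> T" "T \<inter> B = {}"
  shows "insertion_sign B a * inversion_sign (T - {a}) (insert a B) =
    (inversion_sign T B * (- 1) ^ card {x \<in> T. a < x} :: 'a::comm_ring_1)"
proof -
  let ?N = "{(t, u). t \<in> T - {a} \<and> u \<in> B \<and> u < t}"
  have fin: "finite {(t, u). t \<in> T \<and> u < t}"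
    by (rule finite_subset[of _ "T \<times> {..Max T}"]) (use T in \<open>auto dest: Max_ge[OF T] less_imp_le intro: order_trans\<close>)
  have fin2: "finite ?N" by (rule finite_subset[OF _ fin]) auto
  have "{(t, u). t \<in> T - {a} \<and> u \<in> insert a B \<and> u < t} = ?N \<union> (\<lambda>t. (t, a)) ` {x \<in> T. a < x}"
    by auto
  moreover have "card (?N \<union> (\<lambda>t. (t, a)) ` {x \<in> T. a < x}) = card ?N + card ((\<lambda>t. (t, a)) ` {x \<in> T. a < x})"
    by (rule card_Un_disjoint) (use a T fin2 in auto)
  moreover have "card ((\<lambda>t. (t, a)) ` {x \<in> T. a < x}) = card {x \<in> T. a < x}"
    by (rule card_image) (auto simp: inj_on_def)
  ultimately have 1: "card {(t, u). t \<in> T - {a} \<and> u \<in> insert a B \<and> u < t} = card ?N + card {x \<in> T. a < x}"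
    by simp
  have "{(t, u). t \<in> T \<and> u \<in> B \<and> u < t} = ?N \<union> Pair a ` {u \<in> B. u < a}"
    using a by auto
  moreover have "card (?N \<union> Pair a ` {u \<in> B. u < a}) = card ?N + card (Pair a ` {u \<in> B. u < a})"
    by (rule card_Un_disjoint) (use fin2 in auto)
  moreover have "card (Pair a ` {u \<in> B. u < a}) = card {u \<in> B. u < a}"
    by (rule card_image) (auto simp: inj_on_def)
  ultimately have 2: "card {(t, u). t \<in> T \<and> u \<in> B \<and> u < t} = card ?N + card {u \<in> B. u < a}"
    by simp
  show ?thesis unfolding inversion_sign_def insertion_sign_def 1 2 power_add by (simp only: mult_ac)
qed

text \<open>An appended row becomes the outermost contraction. Collecting the terms with the same
  \<open>insert a T\<close> is the Laplace expansion along the last row, the signs being matched by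
  \<open>inversion_sign_insert\<close>.\<close>

lemma contracts_rev_apply:
  fixes \<phi> :: "nat \<Rightarrow> nat \<Rightarrow> 'a::comm_ring_1"
  assumes F: "finite F"
  shows "contracts F \<phi> (rev ts) u (B, v) =
    (\<Sum>T | T \<subseteq> F - B \<and> card T = length ts. inversion_sign T B * list_minor \<phi> ts T * u (B \<union> T, v))"
proof (induction ts arbitrary: B rule: rev_induct)
  case Nil
  have "{T. T \<subseteq> F - B \<and> card T = 0} = {{}}"
    using F by (auto simp: card_eq_0_iff intro: finite_subset)
  then show ?case by (simp add: inversion_sign_def list_minor_def)
next
  case (snoc t ts)
  let ?m = "length ts"
  let ?P = "\<lambda>k. {T. T \<subseteq> F - B \<and> card T = k}"
  let ?h = "\<lambda>a T. insertion_sign B a * \<phi> t a * (inversion_sign T (insert a B) * list_minor \<phi> ts T *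
      u (insert a B \<union> T, v))"
  have finP: "finite {T. T \<subseteq> F - C \<and> card T = k}" for C k
    by (rule finite_subset[of _ "Pow F"]) (use F in auto)
  have "contracts F \<phi> (rev (ts @ [t])) u (B, v) =
      (\<Sum>a\<in>F - B. insertion_sign B a * \<phi> t a * contracts F \<phi> (rev ts) u (insert a B, v))"
    by (simp only: rev_append rev.simps append_Nil append_Cons contracts_simps contract_apply)
  also have "\<dots> = (\<Sum>a\<in>F - B. \<Sum>T | T \<subseteq> F - insert a B \<and> card T = ?m. ?h a T)"
    unfolding snoc.IH sum_distrib_left ..
  also have "\<dots> = (\<Sum>(a, T)\<in>Sigma (F - B) (\<lambda>a. {T. T \<subseteq> F - insert a B \<and> card T = ?m}). ?h a T)"
    using F finP by (subst sum.Sigma) auto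
  also have "\<dots> = (\<Sum>(T, a)\<in>Sigma (?P (Suc ?m)) (\<lambda>T. T). ?h a (T - {a}))"
  proof (rule sum.reindex_bij_witness[of _ "\<lambda>(T, a). (a, T - {a})" "\<lambda>(a, T). (insert a T, a)"])
    fix x assume "x \<in> Sigma (F - B) (\<lambda>a. {T. T \<subseteq> F - insert a B \<and> card T = ?m})"
    then obtain a T where x: "x = (a, T)" "a \<in> F - B" "T \<subseteq> F - insert a B" "card T = ?m" by auto
    then have "finite T" "a \<notin> T" using finite_subset[OF _ F, of T] by auto
    then show "(\<lambda>(T, a). (a, T - {a})) ((\<lambda>(a, T). (insert a T, a)) x) = x"
      "(\<lambda>(a, T). (insert a T, a)) x \<in> Sigma (?P (Suc ?m)) (\<lambda>T. T)"
      "(case (\<lambda>(a, T). (insert a T, a)) x of (T, a) \<Rightarrow> ?h a (T - {a})) = (case x of (a, T) \<Rightarrow> ?h a T)"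
      using x by auto
  next
    fix x assume "x \<in> Sigma (?P (Suc ?m)) (\<lambda>T. T)"
    then obtain a T where x: "x = (T, a)" "T \<subseteq> F - B" "card T = Suc ?m" "a \<in> T" by auto
    then have "finite T" using finite_subset[OF _ F, of T] by auto
    then show "(\<lambda>(a, T). (insert a T, a)) ((\<lambda>(T, a). (a, T - {a})) x) = x"
      "(\<lambda>(T, a). (a, T - {a})) x \<in> Sigma (F - B) (\<lambda>a. {T. T \<subseteq> F - insert a B \<and> card T = ?m})"
      using x by auto
  qed
  also have "\<dots> = (\<Sum>T\<in>?P (Suc ?m). \<Sum>a\<in>T. ?h a (T - {a}))"
  proof (rule sum.Sigma[symmetric])
    show "finite (?P (Suc ?m))" by (rule finP)
    show "\<forall>T\<in>?P (Suc ?m). finite T" using finite_subset[OF _ F] by blast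
  qed
  also have "\<dots> = (\<Sum>T\<in>?P (Suc ?m). inversion_sign T B * list_minor \<phi> (ts @ [t]) T * u (B \<union> T, v))"
  proof (rule sum.cong[OF refl])
    fix T assume "T \<in> ?P (Suc ?m)"
    then have T: "T \<subseteq> F - B" "card T = Suc ?m" and fT: "finite T" using finite_subset[OF _ F, of T] by auto
    have "?h a (T - {a}) = inversion_sign T B * ((- 1) ^ card {x \<in> T. a < x} *
        (\<phi> t a * list_minor \<phi> ts (T - {a}))) * u (B \<union> T, v)" if a: "a \<in> T" for a
    proof -
      have "insert a B \<union> (T - {a}) = B \<union> T" using a by auto
      then have "?h a (T - {a}) = (insertion_sign B a * inversion_sign (T - {a}) (insert a B)) *
          (\<phi> t a * list_minor \<phi> ts (T - {a}) * u (B \<union> T, v))"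
        by (simp only: mult_ac)
      also have "insertion_sign B a * inversion_sign (T - {a}) (insert a B) =
          (inversion_sign T B * (- 1) ^ card {x \<in> T. a < x} :: 'a)"
        by (rule inversion_sign_insert[OF fT a]) (use T in auto)
      finally show ?thesis by (simp only: mult_ac)
    qed
    then show "(\<Sum>a\<in>T. ?h a (T - {a})) = inversion_sign T B * list_minor \<phi> (ts @ [t]) T * u (B \<union> T, v)"
      unfolding list_minor_last_row[OF fT T(2)] sum_distrib_left sum_distrib_right
      by (intro sum.cong refl) simp
  qed
  finally show ?case by simp
qed

lemma list_minor_in_determinantal_ideal:
  fixes \<phi> :: "nat \<Rightarrow> nat \<Rightarrow> 'a::comm_ring_1"
  assumes F: "finite F" and ts: "set ts \<subseteq> G" and T: "T \<subseteq> F" "card T = length ts"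
  shows "list_minor \<phi> ts T \<in> determinantal_ideal F G \<phi> (length ts)"
proof -
  let ?u = "\<lambda>(A, v :: nat multiset). if A = T then 1 else 0 :: 'a"
  have fin: "finite {T. T \<subseteq> F - {} \<and> card T = length ts}"
    by (rule finite_subset[of _ "Pow F"]) (use F in auto)
  have "contracts F \<phi> (rev ts) ?u ({}, {#}) =
    (\<Sum>T' | T' \<subseteq> F - {} \<and> card T' = length ts. if T' = T then list_minor \<phi> ts T else 0)"
    unfolding contracts_rev_apply[OF F]
    by (rule sum.cong) (auto simp: inversion_sign_def)
  also have "\<dots> = list_minor \<phi> ts T"
    using T fin by simp
  finally show ?thesis
    using determinantal_idealI[of "rev ts" G "length ts" F \<phi> ?u] ts by simp
qed


section \<open>The Cox ring as a subring of the ring of all polynomials\<close>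

lemma carrier_cox_ring: "p \<in> carrier (cox_ring \<Sigma>) \<longleftrightarrow> (\<forall>t\<in>Poly_Mapping.keys p. Poly_Mapping.keys t \<subseteq> rays \<Sigma>)"
  by (simp add: cox_ring_def)

lemma cox_ring_simps [simp]:
  "x \<otimes>\<^bsub>cox_ring \<Sigma>\<^esub> y = x * y" "x \<oplus>\<^bsub>cox_ring \<Sigma>\<^esub> y = x + y"
  "\<one>\<^bsub>cox_ring \<Sigma>\<^esub> = 1" "\<zero>\<^bsub>cox_ring \<Sigma>\<^esub> = 0"
  by (simp_all add: cox_ring_def)

lemma cox_zero: "0 \<in> carrier (cox_ring \<Sigma>)" and cox_one: "1 \<in> carrier (cox_ring \<Sigma>)"
  by (simp_all add: carrier_cox_ring)

lemma cox_add: "p \<in> carrier (cox_ring \<Sigma>) \<Longrightarrow> q \<in> carrier (cox_ring \<Sigma>) \<Longrightarrow> p + q \<in> carrier (cox_ring \<Sigma>)"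
  using Poly_Mapping.keys_add[of p q] by (auto simp: carrier_cox_ring)

lemma cox_uminus: "p \<in> carrier (cox_ring \<Sigma>) \<Longrightarrow> - p \<in> carrier (cox_ring \<Sigma>)"
  by (simp add: carrier_cox_ring in_keys_iff)

lemma cox_mult: "p \<in> carrier (cox_ring \<Sigma>) \<Longrightarrow> q \<in> carrier (cox_ring \<Sigma>) \<Longrightarrow> p * q \<in> carrier (cox_ring \<Sigma>)"
  unfolding carrier_cox_ring
proof
  fix t assume *: "\<forall>t\<in>Poly_Mapping.keys p. Poly_Mapping.keys t \<subseteq> rays \<Sigma>"
    "\<forall>t\<in>Poly_Mapping.keys q. Poly_Mapping.keys t \<subseteq> rays \<Sigma>" and "t \<in> Poly_Mapping.keys (p * q)"
  then obtain a b where "t = a + b" "a \<in> Poly_Mapping.keys p" "b \<in> Poly_Mapping.keys q"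
    using keys_mult[of p q] by blast
  then show "Poly_Mapping.keys t \<subseteq> rays \<Sigma>"
    using * Poly_Mapping.keys_add[of a b] by blast
qed

lemma cox_sum: "(\<And>x. x \<in> A \<Longrightarrow> h x \<in> carrier (cox_ring \<Sigma>)) \<Longrightarrow> sum h A \<in> carrier (cox_ring \<Sigma>)"
  by (induction A rule: infinite_finite_induct) (auto intro: cox_zero cox_add)

lemma cox_prod: "(\<And>x. x \<in> A \<Longrightarrow> h x \<in> carrier (cox_ring \<Sigma>)) \<Longrightarrow> prod h A \<in> carrier (cox_ring \<Sigma>)"
  by (induction A rule: infinite_finite_induct) (auto intro: cox_one cox_mult)

lemma cox_power: "x \<in> carrier (cox_ring \<Sigma>) \<Longrightarrow> x ^ n \<in> carrier (cox_ring \<Sigma>)"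
  by (induction n) (auto intro: cox_one cox_mult)

lemma cring_cox_ring: "cring (cox_ring \<Sigma>)"
proof (rule cringI)
  show "abelian_group (cox_ring \<Sigma>)"
  proof (rule abelian_groupI)
    fix x assume "x \<in> carrier (cox_ring \<Sigma>)"
    then show "\<exists>y\<in>carrier (cox_ring \<Sigma>). y \<oplus>\<^bsub>cox_ring \<Sigma>\<^esub> x = \<zero>\<^bsub>cox_ring \<Sigma>\<^esub>"
      by (intro bexI[of _ "- x"]) (auto intro: cox_uminus)
  qed (auto intro: cox_add cox_zero simp: add_ac)
  show "Group.comm_monoid (cox_ring \<Sigma>)"
    by (rule comm_monoidI) (auto intro: cox_mult cox_one simp: mult_ac)
qed (auto simp: distrib_right)

interpretation cox: cring "cox_ring \<Sigma>" for \<Sigma> by (rule cring_cox_ring)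

lemma cox_finsum:
  assumes "finite A" "\<And>x. x \<in> A \<Longrightarrow> h x \<in> carrier (cox_ring \<Sigma>)"
  shows "finsum (cox_ring \<Sigma>) h A = sum h A"
  using assms by (induction A rule: finite_induct) (simp_all add: cox.finsum_insert Pi_iff)

lemma cox_finprod:
  assumes "finite A" "\<And>x. x \<in> A \<Longrightarrow> h x \<in> carrier (cox_ring \<Sigma>)"
  shows "finprod (cox_ring \<Sigma>) h A = prod h A"
  using assms by (induction A rule: finite_induct) (simp_all add: cox.finprod_insert Pi_iff)

lemma cox_a_inv: "x \<in> carrier (cox_ring \<Sigma>) \<Longrightarrow> \<ominus>\<^bsub>cox_ring \<Sigma>\<^esub> x = - x"
  by (rule cox.minus_equality) (auto intro: cox_uminus)

lemma cox_ring_sign: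
  fixes \<Sigma> :: "'v::euclidean_space set set"
  shows "ring_sign (cox_ring \<Sigma> :: ('v, 'k::field) cox_poly ring) n = (- 1) ^ n"
proof -
  have "(- 1) [^]\<^bsub>cox_ring \<Sigma>\<^esub> n = ((- 1) ^ n :: ('v, 'k) cox_poly)" for n :: nat
    by (induction n) (simp_all add: cox.nat_pow_Suc mult.commute)
  then show ?thesis by (simp add: ring_sign_def cox_a_inv cox_one)
qed

lemma cox_sign: "(- 1) ^ n \<in> carrier (cox_ring \<Sigma>)"
  by (intro cox_power cox_uminus cox_one)

lemma cox_ring_det:
  assumes "\<And>p q. p < n \<Longrightarrow> q < n \<Longrightarrow> A p q \<in> carrier (cox_ring \<Sigma>)"
  shows "ring_det (cox_ring \<Sigma>) n A = Determinant.det (Matrix.mat n n (\<lambda>(p, q). A p q))"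
proof -
  have prods: "finprod (cox_ring \<Sigma>) (\<lambda>p. A p (\<pi> p)) {..<n} = (\<Prod>p<n. A p (\<pi> p))"
    "(\<Prod>p<n. A p (\<pi> p)) \<in> carrier (cox_ring \<Sigma>)" if "\<pi> permutes {..<n}" for \<pi>
  proof -
    have "A p (\<pi> p) \<in> carrier (cox_ring \<Sigma>)" if "p \<in> {..<n}" for p
      using assms that permutes_in_image[OF \<open>\<pi> permutes {..<n}\<close>, of p] by simp
    then show "finprod (cox_ring \<Sigma>) (\<lambda>p. A p (\<pi> p)) {..<n} = (\<Prod>p<n. A p (\<pi> p))"
      "(\<Prod>p<n. A p (\<pi> p)) \<in> carrier (cox_ring \<Sigma>)" by (auto intro: cox_finprod cox_prod)
  qed
  have "ring_det (cox_ring \<Sigma>) n A =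
    (\<Sum>\<pi> | \<pi> permutes {..<n}. (- 1) ^ (if evenperm \<pi> then 0 else 1) * (\<Prod>p<n. A p (\<pi> p)))"
    unfolding ring_det_def cox_ring_sign
  proof (subst cox_finsum)
    show "finite {\<pi>. \<pi> permutes {..<n}}" by (rule finite_permutations) simp
    show "(- 1) ^ (if evenperm \<pi> then 0 else 1) \<otimes>\<^bsub>cox_ring \<Sigma>\<^esub>
        (\<Otimes>\<^bsub>cox_ring \<Sigma>\<^esub>p\<in>{..<n}. A p (\<pi> p)) \<in> carrier (cox_ring \<Sigma>)"
      if "\<pi> \<in> {\<pi>. \<pi> permutes {..<n}}" for \<pi>
      using that unfolding cox_ring_simps by (intro cox_mult cox_sign) (simp add: prods)
    show "(\<Sum>\<pi> | \<pi> permutes {..<n}. (- 1) ^ (if evenperm \<pi> then 0 else 1) \<otimes>\<^bsub>cox_ring \<Sigma>\<^esub>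
        (\<Otimes>\<^bsub>cox_ring \<Sigma>\<^esub>p\<in>{..<n}. A p (\<pi> p))) =
      (\<Sum>\<pi> | \<pi> permutes {..<n}. (- 1) ^ (if evenperm \<pi> then 0 else 1) * (\<Prod>p<n. A p (\<pi> p)))"
      by (rule sum.cong) (simp_all add: prods)
  qed
  also have "\<dots> = Determinant.det (Matrix.mat n n (\<lambda>(p, q). A p q))"
    unfolding Determinant.det_def
    by (auto simp: sign_def lessThan_atLeast0 intro!: sum.cong prod.cong dest: permutes_in_image)
  finally show ?thesis .
qed

lemma cox_minor:
  assumes "\<And>r c. r \<in> I \<Longrightarrow> c \<in> J \<Longrightarrow> \<phi> r c \<in> carrier (cox_ring \<Sigma>)"
    and "finite I" "finite J" "card I = card J"
  shows "minor (cox_ring \<Sigma>) \<phi> I J = list_minor \<phi> (sorted_list_of_set I) J"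
  unfolding minor_def list_minor_def
  using assms nth_mem[of _ "sorted_list_of_set I"] nth_mem[of _ "sorted_list_of_set J"]
  by (subst cox_ring_det) auto

lemma cox_genideal_subset:
  assumes "S \<subseteq> carrier (cox_ring \<Sigma>)"
  shows "Idl\<^bsub>cox_ring \<Sigma>\<^esub> S \<subseteq> ideal.span S"
proof -
  have "ideal (carrier (cox_ring \<Sigma>) \<inter> ideal.span S) (cox_ring \<Sigma>)"
  proof (rule idealI[OF cox.ring_axioms])
    show "subgroup (carrier (cox_ring \<Sigma>) \<inter> ideal.span S) (add_monoid (cox_ring \<Sigma>))"
    proof (rule cox.add.subgroupI)
      show "carrier (cox_ring \<Sigma>) \<inter> ideal.span S \<noteq> {}"
        using cox_zero ideal.span_zero by blast
      fix x assume x: "x \<in> carrier (cox_ring \<Sigma>) \<inter> ideal.span S"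
      then show "\<ominus>\<^bsub>cox_ring \<Sigma>\<^esub> x \<in> carrier (cox_ring \<Sigma>) \<inter> ideal.span S"
        by (simp add: cox_a_inv cox_uminus ideal.span_neg)
      fix y assume "y \<in> carrier (cox_ring \<Sigma>) \<inter> ideal.span S"
      with x show "x \<oplus>\<^bsub>cox_ring \<Sigma>\<^esub> y \<in> carrier (cox_ring \<Sigma>) \<inter> ideal.span S"
        by (simp add: cox_add ideal.span_add)
    qed simp
  qed (auto intro: cox_mult ideal.span_scale ideal_mult)
  then show ?thesis
    using cox.genideal_minimal[of "carrier (cox_ring \<Sigma>) \<inter> ideal.span S" \<Sigma> S] assms ideal.span_superset by blast
qed

section \<open>Coordinates over the Cox ring\<close>

lemma sum_single_keys: "(\<Sum>t\<in>Poly_Mapping.keys p. Poly_Mapping.single t (Poly_Mapping.lookup p t)) = p"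
proof (rule poly_mapping_eqI)
  fix k
  have "Poly_Mapping.lookup (\<Sum>t\<in>Poly_Mapping.keys p. Poly_Mapping.single t (Poly_Mapping.lookup p t)) k =
    (\<Sum>t\<in>Poly_Mapping.keys p. if t = k then Poly_Mapping.lookup p k else 0)"
    unfolding lookup_sum by (rule sum.cong) (auto simp: lookup_single when_def)
  also have "\<dots> = Poly_Mapping.lookup p k" by (simp add: in_keys_iff)
  finally show "Poly_Mapping.lookup (\<Sum>t\<in>Poly_Mapping.keys p. Poly_Mapping.single t (Poly_Mapping.lookup p t)) k =
    Poly_Mapping.lookup p k" .
qed

text \<open>
  The ring of all polynomials is a free module over the Cox ring, with basis the monomials \<open>\<mu>\<close> in the
  variables which are not rays; \<open>coordinate \<Sigma> \<mu>\<close> is the coordinate function belonging to \<open>\<mu>\<close>.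
\<close>

definition restrict_exp :: "'v set \<Rightarrow> ('v \<Rightarrow>\<^sub>0 nat) \<Rightarrow> 'v \<Rightarrow>\<^sub>0 nat" where
  "restrict_exp S t = Abs_poly_mapping (\<lambda>x. if x \<in> S then Poly_Mapping.lookup t x else 0)"

lemma lookup_restrict_exp:
  "Poly_Mapping.lookup (restrict_exp S t) x = (if x \<in> S then Poly_Mapping.lookup t x else 0)"
proof -
  have "finite {x. (if x \<in> S then Poly_Mapping.lookup t x else 0) \<noteq> 0}"
    by (rule finite_subset[OF _ finite_lookup[of t]]) (auto split: if_splits)
  then show ?thesis by (simp add: restrict_exp_def)
qed

lemma keys_restrict_exp: "Poly_Mapping.keys (restrict_exp S t) = S \<inter> Poly_Mapping.keys t"
  by (auto simp: in_keys_iff lookup_restrict_exp split: if_splits)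

lemma restrict_exp_split: "restrict_exp S t + restrict_exp (- S) t = t"
  by (rule poly_mapping_eqI) (simp add: lookup_add lookup_restrict_exp)

lemma restrict_exp_add: "restrict_exp S (t + u) = restrict_exp S t + restrict_exp S u"
  by (rule poly_mapping_eqI) (simp add: lookup_add lookup_restrict_exp)

lemma restrict_exp_id: "Poly_Mapping.keys t \<subseteq> S \<Longrightarrow> restrict_exp S t = t"
  and restrict_exp_zero: "Poly_Mapping.keys t \<subseteq> - S \<Longrightarrow> restrict_exp S t = 0"
  by (rule poly_mapping_eqI; auto simp: lookup_restrict_exp in_keys_iff subset_iff)+

definition coordinate ::
    "'v::euclidean_space set set \<Rightarrow> ('v set \<Rightarrow>\<^sub>0 nat) \<Rightarrow> ('v, 'k::field) cox_poly \<Rightarrow> ('v, 'k) cox_poly" where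
  "coordinate \<Sigma> \<mu> p = (\<Sum>t | t \<in> Poly_Mapping.keys p \<and> restrict_exp (- rays \<Sigma>) t = \<mu>.
     Poly_Mapping.single (restrict_exp (rays \<Sigma>) t) (Poly_Mapping.lookup p t))"

lemma coordinate_superset:
  assumes "finite K" "Poly_Mapping.keys p \<subseteq> K"
  shows "coordinate \<Sigma> \<mu> p = (\<Sum>t\<in>K. if restrict_exp (- rays \<Sigma>) t = \<mu>
    then Poly_Mapping.single (restrict_exp (rays \<Sigma>) t) (Poly_Mapping.lookup p t) else 0)"
proof -
  have "coordinate \<Sigma> \<mu> p = (\<Sum>t\<in>Poly_Mapping.keys p. if restrict_exp (- rays \<Sigma>) t = \<mu>
    then Poly_Mapping.single (restrict_exp (rays \<Sigma>) t) (Poly_Mapping.lookup p t) else 0)"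
    unfolding coordinate_def by (rule sum.inter_filter) simp
  also have "\<dots> = (\<Sum>t\<in>K. if restrict_exp (- rays \<Sigma>) t = \<mu>
    then Poly_Mapping.single (restrict_exp (rays \<Sigma>) t) (Poly_Mapping.lookup p t) else 0)"
    using assms by (intro sum.mono_neutral_left) (auto simp: in_keys_iff)
  finally show ?thesis .
qed

lemma coordinate_add: "coordinate \<Sigma> \<mu> (p + q) = coordinate \<Sigma> \<mu> p + coordinate \<Sigma> \<mu> q"
proof -
  let ?K = "Poly_Mapping.keys p \<union> Poly_Mapping.keys q"
  have K: "finite ?K" "Poly_Mapping.keys p \<subseteq> ?K" "Poly_Mapping.keys q \<subseteq> ?K" "Poly_Mapping.keys (p + q) \<subseteq> ?K"
    using Poly_Mapping.keys_add[of p q] by auto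
  show ?thesis
    unfolding coordinate_superset[OF K(1,2)] coordinate_superset[OF K(1,3)] coordinate_superset[OF K(1,4)]
      sum.distrib[symmetric]
    by (rule sum.cong) (auto simp: lookup_add single_add)
qed

lemma coordinate_zero: "coordinate \<Sigma> \<mu> 0 = 0"
  by (simp add: coordinate_def)

lemma coordinate_sum: "coordinate \<Sigma> \<mu> (sum h A) = (\<Sum>x\<in>A. coordinate \<Sigma> \<mu> (h x))"
  by (induction A rule: infinite_finite_induct) (simp_all add: coordinate_zero coordinate_add)

lemma coordinate_single:
  "coordinate \<Sigma> \<mu> (Poly_Mapping.single t c) = (if restrict_exp (- rays \<Sigma>) t = \<mu>
    then Poly_Mapping.single (restrict_exp (rays \<Sigma>) t) c else 0)"
  by (subst coordinate_superset[of "{t}"]) auto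

lemma coordinate_mult:
  assumes "s \<in> carrier (cox_ring \<Sigma>)"
  shows "coordinate \<Sigma> \<mu> (s * p) = s * coordinate \<Sigma> \<mu> p"
proof -
  have 1: "coordinate \<Sigma> \<mu> (Poly_Mapping.single t c * Poly_Mapping.single t' c') =
      Poly_Mapping.single t c * coordinate \<Sigma> \<mu> (Poly_Mapping.single t' c')"
    if "Poly_Mapping.keys t \<subseteq> rays \<Sigma>" for t t' and c c' :: 'b
    using that
    by (simp add: mult_single coordinate_single restrict_exp_add restrict_exp_id restrict_exp_zero)
  have "coordinate \<Sigma> \<mu> (s * p) = coordinate \<Sigma> \<mu>
      (\<Sum>t\<in>Poly_Mapping.keys s. \<Sum>t'\<in>Poly_Mapping.keys p. Poly_Mapping.single t (Poly_Mapping.lookup s t) *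
         Poly_Mapping.single t' (Poly_Mapping.lookup p t'))"
    by (simp only: sum_single_keys flip: sum_product)
  also have "\<dots> = (\<Sum>t\<in>Poly_Mapping.keys s. \<Sum>t'\<in>Poly_Mapping.keys p. Poly_Mapping.single t (Poly_Mapping.lookup s t) *
         coordinate \<Sigma> \<mu> (Poly_Mapping.single t' (Poly_Mapping.lookup p t')))"
    unfolding coordinate_sum using assms
    by (intro sum.cong refl 1) (auto simp: carrier_cox_ring)
  also have "\<dots> = s * (\<Sum>t'\<in>Poly_Mapping.keys p. coordinate \<Sigma> \<mu> (Poly_Mapping.single t' (Poly_Mapping.lookup p t')))"
    by (simp only: sum_product[symmetric] sum_single_keys)
  also have "\<dots> = s * coordinate \<Sigma> \<mu> (\<Sum>t'\<in>Poly_Mapping.keys p. Poly_Mapping.single t' (Poly_Mapping.lookup p t'))"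
    by (simp only: coordinate_sum)
  finally show ?thesis by (simp only: sum_single_keys)
qed

lemma coordinate_carrier: "coordinate \<Sigma> \<mu> p \<in> carrier (cox_ring \<Sigma>)"
  unfolding coordinate_def
  by (rule cox_sum) (auto simp: carrier_cox_ring keys_restrict_exp split: if_splits)

lemma coordinate_one: "p \<in> carrier (cox_ring \<Sigma>) \<Longrightarrow> coordinate \<Sigma> 0 p = p"
  using sum_single_keys[of p]
  by (subst coordinate_superset[OF finite_keys order_refl])
    (simp add: carrier_cox_ring restrict_exp_id restrict_exp_zero cong: sum.cong)

lemma coordinate_expansion:
  fixes p :: "('v::euclidean_space, 'k::field) cox_poly"
  shows "(\<Sum>\<mu>\<in>restrict_exp (- rays \<Sigma>) ` Poly_Mapping.keys p. coordinate \<Sigma> \<mu> p * Poly_Mapping.single \<mu> 1) = p"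
proof -
  let ?M = "restrict_exp (- rays \<Sigma>) ` Poly_Mapping.keys p"
  let ?\<Theta> = "\<lambda>q. \<Sum>\<mu>\<in>?M. coordinate \<Sigma> \<mu> q * Poly_Mapping.single \<mu> 1"
  have single: "?\<Theta> (Poly_Mapping.single t c) = Poly_Mapping.single t c" if "t \<in> Poly_Mapping.keys p" for t and c :: 'k
  proof -
    have "?\<Theta> (Poly_Mapping.single t c) = (\<Sum>\<mu>\<in>?M. if restrict_exp (- rays \<Sigma>) t = \<mu> then Poly_Mapping.single t c else 0)"
      using restrict_exp_split[of "rays \<Sigma>" t]
      by (intro sum.cong refl) (auto simp: coordinate_single mult_single)
    then show ?thesis using that by (simp add: eq_commute)
  qed
  have "?\<Theta> (sum h A) = (\<Sum>x\<in>A. ?\<Theta> (h x))" for h :: "('v set \<Rightarrow>\<^sub>0 nat) \<Rightarrow> _" and A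
    unfolding coordinate_sum sum_distrib_right by (rule sum.swap)
  from this[of "\<lambda>t. Poly_Mapping.single t (Poly_Mapping.lookup p t)" "Poly_Mapping.keys p"]
  have "?\<Theta> p = (\<Sum>t\<in>Poly_Mapping.keys p. ?\<Theta> (Poly_Mapping.single t (Poly_Mapping.lookup p t)))"
    unfolding sum_single_keys .
  also have "\<dots> = p"
    using sum_single_keys[of p] single by (simp cong: sum.cong)
  finally show ?thesis .
qed

text \<open>\<open>coordinate\<close> is linear over the Cox ring, which contains the generators; so
  it maps the extended ideal back into the original one.\<close>

lemma coordinate_span:
  assumes S: "S \<subseteq> carrier (cox_ring \<Sigma>)" and y: "y \<in> ideal.span S"
  shows "coordinate \<Sigma> \<mu> y \<in> Idl\<^bsub>cox_ring \<Sigma>\<^esub> S"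
  using y
proof (induction rule: ideal.span_induct_alt)
  case base
  interpret I: ideal "Idl\<^bsub>cox_ring \<Sigma>\<^esub> S" "cox_ring \<Sigma>" by (rule cox.genideal_ideal[OF S])
  show ?case using I.zero_closed by (simp add: coordinate_zero)
next
  case (step c x y)
  interpret I: ideal "Idl\<^bsub>cox_ring \<Sigma>\<^esub> S" "cox_ring \<Sigma>" by (rule cox.genideal_ideal[OF S])
  have x: "x \<in> Idl\<^bsub>cox_ring \<Sigma>\<^esub> S" using cox.genideal_self[OF S] step(1) by blast
  have "coordinate \<Sigma> \<mu> (c * x + y) = coordinate \<Sigma> \<mu> c * x + coordinate \<Sigma> \<mu> y"
    using S step(1) coordinate_mult[of x \<Sigma> \<mu> c] by (auto simp: coordinate_add mult.commute)
  then show ?case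
    using I.a_closed[OF I.I_l_closed[OF x coordinate_carrier] step(2)] by simp
qed

text \<open>Freeness over the Cox ring acts as flatness: a relation between arbitrary polynomials is
  checked coordinate by coordinate, and \<open>coordinate_expansion\<close> recombines the
  results.\<close>

lemma weakly_regular_cox:
  assumes C: "set xs \<subseteq> carrier (cox_ring \<Sigma>)"
    and reg: "\<And>n r. n < length xs \<Longrightarrow> r \<in> carrier (cox_ring \<Sigma>) \<Longrightarrow>
       r * xs ! n \<in> Idl\<^bsub>cox_ring \<Sigma>\<^esub> (set (take n xs)) \<Longrightarrow> r \<in> Idl\<^bsub>cox_ring \<Sigma>\<^esub> (set (take n xs))"
  shows "weakly_regular xs"
  unfolding weakly_regular_def
proof (intro allI impI)
  fix n r assume n: "n < length xs" and r: "r * xs ! n \<in> ideal.span (set (take n xs))"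
  let ?S = "set (take n xs)"
  have S: "?S \<subseteq> carrier (cox_ring \<Sigma>)" using C set_take_subset by fast
  have x: "xs ! n \<in> carrier (cox_ring \<Sigma>)" using C n by auto
  have "coordinate \<Sigma> \<mu> r \<in> ideal.span ?S" for \<mu>
  proof -
    have "coordinate \<Sigma> \<mu> r * xs ! n \<in> Idl\<^bsub>cox_ring \<Sigma>\<^esub> ?S"
      using coordinate_span[OF S r, of \<mu>] coordinate_mult[OF x, of \<mu> r] by (simp add: mult.commute)
    then show ?thesis using reg[OF n coordinate_carrier] cox_genideal_subset[OF S] by blast
  qed
  then have "(\<Sum>\<mu>\<in>restrict_exp (- rays \<Sigma>) ` Poly_Mapping.keys r. coordinate \<Sigma> \<mu> r * Poly_Mapping.single \<mu> 1) \<in> ideal.span ?S"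
    by (intro ideal.span_sum ideal_mult ideal.subspace_span)
  then show "r \<in> ideal.span ?S" by (simp only: coordinate_expansion)
qed


section \<open>Matrices of the differentials\<close>

lemma en_basis_subset: "(A, w) \<in> en_basis f g i j \<Longrightarrow> A \<subseteq> {..<f} \<and> set_mset w \<subseteq> {..<g}"
  by (simp add: en_basis_def split: if_splits)

lemma finite_en_basis: "finite (en_basis f g i j)"
proof -
  have fin: "finite {w. set_mset w \<subseteq> {..<g} \<and> size w = q}" for q
  proof (rule finite_subset)
    show "{w. set_mset w \<subseteq> {..<g} \<and> size w = q} \<subseteq> mset ` {xs. set xs \<subseteq> {..<g} \<and> length xs = q}"
    proof
      fix w assume "w \<in> {w. set_mset w \<subseteq> {..<g} \<and> size w = q}"
      moreover obtain xs where "w = mset xs" by (metis ex_mset)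
      ultimately show "w \<in> mset ` {xs. set xs \<subseteq> {..<g} \<and> length xs = q}" by auto
    qed
    show "finite (mset ` {xs. set xs \<subseteq> {..<g} \<and> length xs = q})"
      by (intro finite_imageI finite_lists_length_eq) simp
  qed
  have "en_basis f g i j \<subseteq> Pow {..<f} \<times>
      ({w. set_mset w \<subseteq> {..<g} \<and> size w = nat (i - int j)} \<union>
       {w. set_mset w \<subseteq> {..<g} \<and> size w = nat (int j - i - 1)})"
  proof
    fix x assume x: "x \<in> en_basis f g i j"
    obtain A w where Aw: "x = (A, w)" by (cases x)
    have "int (size w) = i - int j \<or> int (size w) = int j - i - 1"
      using x unfolding Aw en_basis_def by (simp split: if_splits)
    then have "size w = nat (i - int j) \<or> size w = nat (int j - i - 1)" by linarith
    then show "x \<in> Pow {..<f} \<times>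
      ({w. set_mset w \<subseteq> {..<g} \<and> size w = nat (i - int j)} \<union>
       {w. set_mset w \<subseteq> {..<g} \<and> size w = nat (int j - i - 1)})"
      using en_basis_subset[OF x[unfolded Aw]] unfolding Aw by blast
  qed
  then show ?thesis by (rule finite_subset) (simp add: fin)
qed

lemma sum_fun_apply: "(\<Sum>t\<in>G. h t) x = (\<Sum>t\<in>G. h t x)"
  by (induction G rule: infinite_finite_induct) simp_all

text \<open>Covers \<open>en_delta\<close> and \<open>en_partial\<close> at once: for given row (B,
  v) and \<open>t\<close>, a contributing column has the multiset \<open>nxt t\<close>, and
  \<open>con t\<close> says whether it exists, namely \<open>t \<in># v\<close> for the former and
  always for the latter.\<close>

lemma contract_matrix:
  fixes \<phi> :: "nat \<Rightarrow> nat \<Rightarrow> 'a::comm_ring_1"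
  assumes X: "finite X" "\<And>A w. (A, w) \<in> X \<Longrightarrow> A \<subseteq> F" and F: "finite F" and G: "finite G"
    and u: "u \<in> free_mod X"
    and rel: "\<And>t w. rel t w \<longleftrightarrow> con t \<and> w = nxt t"
  shows "(\<Sum>(A, w)\<in>X. (\<Sum>a\<in>{a \<in> A. B = A - {a}}. \<Sum>t\<in>{t \<in> G. rel t w}. insertion_sign A a * \<phi> t a) * u (A, w)) =
    (\<Sum>t\<in>G. if con t then contract F (\<phi> t) u (B, nxt t) else 0)"
proof -
  let ?h = "\<lambda>a t. insertion_sign B a * \<phi> t a * u (insert a B, nxt t)"
  have "(\<Sum>(A, w)\<in>X. (\<Sum>a\<in>{a \<in> A. B = A - {a}}. \<Sum>t\<in>{t \<in> G. rel t w}. insertion_sign A a * \<phi> t a) * u (A, w)) =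
    (\<Sum>x\<in>X. \<Sum>a\<in>F. \<Sum>t\<in>G. if x = (insert a B, nxt t) then (if a \<notin> B \<and> con t then ?h a t else 0) else 0)"
  proof (rule sum.cong[OF refl])
    fix x assume x: "x \<in> X"
    obtain A w where Aw: "x = (A, w)" by (cases x)
    have A: "A \<subseteq> F" "finite A" using X(2) x Aw finite_subset[OF _ F] by auto
    have eq: "a \<in> A \<and> B = A - {a} \<longleftrightarrow> A = insert a B \<and> a \<notin> B" for a by auto
    have "(\<Sum>a\<in>{a \<in> A. B = A - {a}}. \<Sum>t\<in>{t \<in> G. rel t w}. insertion_sign A a * \<phi> t a) * u (A, w) =
      (\<Sum>a\<in>{a \<in> F. a \<in> A \<and> B = A - {a}}. \<Sum>t\<in>{t \<in> G. rel t w}. insertion_sign A a * \<phi> t a * u (A, w))"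
      unfolding sum_distrib_right by (rule sum.cong) (use A in auto)
    also have "\<dots> = (\<Sum>a\<in>F. \<Sum>t\<in>G. if a \<in> A \<and> B = A - {a} then if rel t w then
        insertion_sign A a * \<phi> t a * u (A, w) else 0 else 0)"
      unfolding sum.inter_filter[OF F] sum.inter_filter[OF G]
    proof (rule sum.cong[OF refl])
      fix a
      show "(if a \<in> A \<and> B = A - {a} then \<Sum>t\<in>G. if rel t w then insertion_sign A a * \<phi> t a * u (A, w) else 0 else 0) =
        (\<Sum>t\<in>G. if a \<in> A \<and> B = A - {a} then if rel t w then insertion_sign A a * \<phi> t a * u (A, w) else 0 else 0)"
        by (cases "a \<in> A \<and> B = A - {a}") (simp_all only: if_True if_False sum.neutral_const simp_thms)
    qed
    also have "\<dots> = (\<Sum>a\<in>F. \<Sum>t\<in>G. if x = (insert a B, nxt t) then (if a \<notin> B \<and> con t then ?h a t else 0) else 0)"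
      unfolding eq rel Aw
      by (intro sum.cong refl) (auto simp: insertion_sign_insert)
    finally show "(case x of (A, w) \<Rightarrow> (\<Sum>a\<in>{a \<in> A. B = A - {a}}. \<Sum>t\<in>{t \<in> G. rel t w}. insertion_sign A a * \<phi> t a) * u (A, w)) =
      (\<Sum>a\<in>F. \<Sum>t\<in>G. if x = (insert a B, nxt t) then (if a \<notin> B \<and> con t then ?h a t else 0) else 0)"
      unfolding Aw by simp
  qed
  also have "\<dots> = (\<Sum>a\<in>F. \<Sum>t\<in>G. \<Sum>x\<in>X. if x = (insert a B, nxt t) then (if a \<notin> B \<and> con t then ?h a t else 0) else 0)"
    by (subst sum.swap, rule sum.cong[OF refl], rule sum.swap)
  also have "\<dots> = (\<Sum>a\<in>F. \<Sum>t\<in>G. if a \<notin> B \<and> con t then ?h a t else 0)"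
  proof (intro sum.cong refl)
    fix a t
    have "u (insert a B, nxt t) = 0" if "(insert a B, nxt t) \<notin> X"
      using u that by (auto simp: coeffs_in_def)
    then show "(\<Sum>x\<in>X. if x = (insert a B, nxt t) then (if a \<notin> B \<and> con t then ?h a t else 0) else 0) =
        (if a \<notin> B \<and> con t then ?h a t else 0)"
      using X(1) by (cases "(insert a B, nxt t) \<in> X") simp_all
  qed
  also have "\<dots> = (\<Sum>t\<in>G. \<Sum>a\<in>F. if a \<notin> B \<and> con t then ?h a t else 0)" by (rule sum.swap)
  also have "\<dots> = (\<Sum>t\<in>G. if con t then contract F (\<phi> t) u (B, nxt t) else 0)"
  proof (rule sum.cong[OF refl])
    fix t
    have "contract F (\<phi> t) u (B, nxt t) = (\<Sum>a\<in>{a \<in> F. a \<notin> B}. ?h a t)"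
      unfolding contract_apply by (rule sum.cong) auto
    then show "(\<Sum>a\<in>F. if a \<notin> B \<and> con t then ?h a t else 0) = (if con t then contract F (\<phi> t) u (B, nxt t) else 0)"
      unfolding sum.inter_filter[OF F] by (cases "con t") simp_all
  qed
  finally show ?thesis .
qed

lemma contracts_matrix:
  fixes \<phi> :: "nat \<Rightarrow> nat \<Rightarrow> 'a::comm_ring_1"
  assumes F: "finite F" and B: "B \<subseteq> F" "card B = p" and u: "u \<in> free_mod (basis F G (length ts + p) 0)"
  shows "(\<Sum>(A, w)\<in>basis F G (length ts + p) 0.
      (if B \<subseteq> A then inversion_sign (A - B) B * list_minor \<phi> ts (A - B) else 0) * u (A, w)) =
    contracts F \<phi> (rev ts) u (B, {#})"
proof -
  let ?X = "basis F G (length ts + p) 0" and ?T = "{T. T \<subseteq> F - B \<and> card T = length ts}"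
  have fB: "finite B" using finite_subset[OF B(1) F] .
  have Xsub: "?X \<subseteq> Pow F \<times> {{#}}" by (auto simp: basis_def)
  have X: "finite ?X" by (rule finite_subset[OF Xsub]) (simp add: F)
  have "(\<Sum>(A, w)\<in>?X. (if B \<subseteq> A then inversion_sign (A - B) B * list_minor \<phi> ts (A - B) else 0) * u (A, w)) =
    (\<Sum>x\<in>?X. if B \<subseteq> fst x then inversion_sign (fst x - B) B * list_minor \<phi> ts (fst x - B) * u x else 0)"
    by (intro sum.cong refl) (simp split: prod.split if_split)
  also have "\<dots> = (\<Sum>x\<in>{x \<in> ?X. B \<subseteq> fst x}. inversion_sign (fst x - B) B * list_minor \<phi> ts (fst x - B) * u x)"
    by (rule sum.inter_filter[symmetric, OF X])
  also have "\<dots> = (\<Sum>T\<in>?T. inversion_sign T B * list_minor \<phi> ts T * u (B \<union> T, {#}))"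
  proof (rule sum.reindex_bij_witness[of _ "\<lambda>T. (B \<union> T, {#})" "\<lambda>x. fst x - B"])
    fix x assume "x \<in> {x \<in> ?X. B \<subseteq> fst x}"
    then obtain A where x: "x = (A, {#})" "A \<subseteq> F" "card A = length ts + p" "B \<subseteq> A"
      by (auto simp: basis_def)
    then have "B \<union> (A - B) = A" by auto
    then show "(B \<union> (fst x - B), {#}) = x" "fst x - B \<in> ?T"
      "inversion_sign (fst x - B) B * list_minor \<phi> ts (fst x - B) * u (B \<union> (fst x - B), {#}) =
        inversion_sign (fst x - B) B * list_minor \<phi> ts (fst x - B) * u x"
      using x B(2) fB by (auto simp: card_Diff_subset)
  next
    fix T assume T: "T \<in> ?T"
    then have "finite T" "B \<inter> T = {}" using finite_subset[OF _ F, of T] by auto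
    then show "fst (B \<union> T, {#}) - B = T" "(B \<union> T, {#}) \<in> {x \<in> ?X. B \<subseteq> fst x}"
      using T B fB by (auto simp: basis_def card_Un_disjoint)
  qed
  finally show ?thesis unfolding contracts_rev_apply[OF F] .
qed


section \<open>Transfer to complexes over the Cox ring\<close>

locale cox_matrix =
  fixes \<Sigma> :: "'v::euclidean_space set set" and f g :: nat
    and \<phi> :: "nat \<Rightarrow> nat \<Rightarrow> ('v, 'k::field) cox_poly" and i :: int
  assumes g: "g \<le> f" and i: "- 1 \<le> i"
    and entries: "t < g \<Longrightarrow> c < f \<Longrightarrow> \<phi> t c \<in> carrier (cox_ring \<Sigma>)"
begin

abbreviation R :: "('v, 'k) cox_poly ring" where "R \<equiv> cox_ring \<Sigma>"
abbreviation C where "C \<equiv> en_complex R f g \<phi> i"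
abbreviation X where "X \<equiv> en_basis f g i"
abbreviation M where "M \<equiv> en_map f g \<phi> i"

sublocale E: free_complex X M
  by (rule free_complex_en[OF g i])

lemma basis_C: "cx_basis C = X"
  by (simp add: en_complex_def)

lemma step_entry:
  assumes "A \<subseteq> {..<f}"
  shows "(\<Oplus>\<^bsub>R\<^esub>a\<in>{a \<in> A. B = A - {a}}. \<Oplus>\<^bsub>R\<^esub>t\<in>{t \<in> {..<g}. P t}. position_sign R A a \<otimes>\<^bsub>R\<^esub> \<phi> t a) =
      (\<Sum>a\<in>{a \<in> A. B = A - {a}}. \<Sum>t\<in>{t \<in> {..<g}. P t}. insertion_sign A a * \<phi> t a)" (is ?eq)
    and "(\<Sum>a\<in>{a \<in> A. B = A - {a}}. \<Sum>t\<in>{t \<in> {..<g}. P t}. insertion_sign A a * \<phi> t a) \<in> carrier R" (is ?mem)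
proof -
  have A: "finite A" using assms by (rule finite_subset) simp
  have mem: "insertion_sign A a * \<phi> t a \<in> carrier R" if "a \<in> A" "t < g" for a t
    unfolding insertion_sign_def using that assms by (intro cox_mult cox_sign entries) auto
  have "(\<Oplus>\<^bsub>R\<^esub>t\<in>{t \<in> {..<g}. P t}. position_sign R A a \<otimes>\<^bsub>R\<^esub> \<phi> t a) = (\<Sum>t\<in>{t \<in> {..<g}. P t}. insertion_sign A a * \<phi> t a)"
    if "a \<in> A" for a
    using mem[OF that] by (subst cox_finsum) (simp_all add: position_sign_def cox_ring_sign insertion_sign_def)
  then have "(\<Oplus>\<^bsub>R\<^esub>a\<in>{a \<in> A. B = A - {a}}. \<Oplus>\<^bsub>R\<^esub>t\<in>{t \<in> {..<g}. P t}. position_sign R A a \<otimes>\<^bsub>R\<^esub> \<phi> t a) =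
      (\<Oplus>\<^bsub>R\<^esub>a\<in>{a \<in> A. B = A - {a}}. \<Sum>t\<in>{t \<in> {..<g}. P t}. insertion_sign A a * \<phi> t a)"
    using mem by (intro cox.finsum_cong') (auto intro!: cox_sum)
  also have "\<dots> = (\<Sum>a\<in>{a \<in> A. B = A - {a}}. \<Sum>t\<in>{t \<in> {..<g}. P t}. insertion_sign A a * \<phi> t a)"
    using A mem by (intro cox_finsum) (auto intro!: cox_sum)
  finally show ?eq .
  show ?mem using mem by (intro cox_sum) auto
qed

lemma splice_entry:
  assumes "(A, w) \<in> basis {..<f} {..<g} (g + p) 0" "B \<subseteq> {..<f}" "card B = p"
  shows "en_splice R g \<phi> (B, v) (A, w) =
      (if B \<subseteq> A then inversion_sign (A - B) B * list_minor \<phi> [0..<g] (A - B) else 0)" (is ?eq)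
    and "en_splice R g \<phi> (B, v) (A, w) \<in> carrier R" (is ?mem)
proof -
  have A: "A \<subseteq> {..<f}" "card A = g + p" using assms(1) by (auto simp: basis_iff)
  have fin: "finite A" "finite B" using finite_subset[OF A(1)] finite_subset[OF assms(2)] by auto
  have minor: "minor R \<phi> {..<g} (A - B) = list_minor \<phi> [0..<g] (A - B)" if "B \<subseteq> A"
  proof -
    have "card (A - B) = g" using that fin A assms(3) by (simp add: card_Diff_subset)
    moreover have "\<phi> r c \<in> carrier R" if "r \<in> {..<g}" "c \<in> A - B" for r c
      using that A(1) by (intro entries) auto
    ultimately show ?thesis
      using cox_minor[of "{..<g}" "A - B" \<phi> \<Sigma>] fin by (simp add: lessThan_atLeast0)
  qed
  then show ?eq
    by (simp add: en_splice_def shuffle_sign_def inversion_sign_def cox_ring_sign)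
  have "minor R \<phi> {..<g} (A - B) \<in> carrier R" if "B \<subseteq> A"
  proof -
    let ?xs = "sorted_list_of_set (A - B)"
    have "length ?xs = g" using that fin A assms(3) by (simp add: card_Diff_subset)
    then have "?xs ! q < f" if "q < g" for q
      using nth_mem[of q ?xs] that A fin by auto
    then have ent: "\<phi> p (?xs ! q) \<in> carrier R" if "p < g" "q < g" for p q
      using that by (intro entries) auto
    show ?thesis
      unfolding minor[OF that] list_minor_def Determinant.det_def
      using ent
      by (auto intro!: cox_sum cox_mult cox_prod simp: sign_def cox_one cox_uminus dest: permutes_in_image)
  qed
  then show ?mem
    by (auto simp: en_splice_def shuffle_sign_def cox_ring_sign intro: cox_mult cox_sign cox_zero)
qed

lemma splice_basis:
  assumes j: "int j = i + 1" "1 \<le> j"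
  shows "X j = basis {..<f} {..<g} (g + (j - 1)) 0" "X (j - 1) = basis {..<f} {..<g} (j - 1) 0"
proof -
  have *: "i < int j" "1 \<le> g + j" "g + j - 1 = g + (j - 1)" "j - nat (i + 1) = 0" "int (j - 1) \<le> i" "nat i - (j - 1) = 0"
    using j by linarith+
  show "X j = basis {..<f} {..<g} (g + (j - 1)) 0" using en_basis_right[OF g i *(1,2)] *(3,4) by simp
  show "X (j - 1) = basis {..<f} {..<g} (j - 1) 0" using en_basis_left[OF g *(5)] *(6) by simp
qed

lemma diff_carrier:
  assumes j: "1 \<le> j" and x: "x \<in> X (j - 1)" and y: "y \<in> X j"
  shows "cx_diff C j x y \<in> carrier R"
proof -
  obtain B v A w where xy: "x = (B, v)" "y = (A, w)" by (cases x, cases y)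
  have A: "A \<subseteq> {..<f}" using y xy en_basis_subset by blast
  consider "int j \<le> i" | "int j = i + 1" | "int j > i + 1" by linarith
  then show ?thesis
  proof cases
    case 1
    then show ?thesis
      using step_entry[OF A, where B = B and P = "\<lambda>t. v = add_mset t w"] by (simp only: xy en_complex_def en_delta_def based_complex.simps if_True prod.case)
  next
    case 2
    have "(A, w) \<in> basis {..<f} {..<g} (g + (j - 1)) 0" "B \<subseteq> {..<f}" "card B = j - 1"
      using x y splice_basis[OF 2 j] xy by (auto simp: basis_iff)
    from splice_entry(2)[OF this] show ?thesis using 2 by (simp add: xy en_complex_def)
  next
    case 3
    then show ?thesis
      using step_entry[OF A, where B = B and P = "\<lambda>t. w = add_mset t v"] by (simp add: xy en_complex_def en_partial_def del: lessThan_iff)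
  qed
qed

lemma diff_matrix:
  assumes j: "1 \<le> j" and x: "x \<in> X (j - 1)" and u: "u \<in> free_mod (X j)"
  shows "(\<Sum>y\<in>X j. cx_diff C j x y * u y) = M j u x"
proof -
  obtain B v where xv: "x = (B, v)" by (cases x)
  have Xj: "finite (X j)" "\<And>A w. (A, w) \<in> X j \<Longrightarrow> A \<subseteq> {..<f}"
    using finite_en_basis en_basis_subset by blast+
  consider "int j \<le> i" | "int j = i + 1" | "int j > i + 1" by linarith
  then show ?thesis
  proof cases
    case 1
    have "(\<Sum>y\<in>X j. cx_diff C j x y * u y) = (\<Sum>(A, w)\<in>X j. (\<Sum>a\<in>{a \<in> A. B = A - {a}}.
        \<Sum>t\<in>{t \<in> {..<g}. v = add_mset t w}. insertion_sign A a * \<phi> t a) * u (A, w))"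
      using 1 step_entry(1) Xj(2)
      by (intro sum.cong refl) (auto simp: xv en_complex_def en_delta_def)
    also have "\<dots> = (\<Sum>t<g. if t \<in># v then contract {..<f} (\<phi> t) u (B, v - {#t#}) else 0)"
      by (rule contract_matrix[OF Xj finite_lessThan finite_lessThan u]) auto
    also have "\<dots> = M j u x"
      using 1 by (simp add: en_map_def delta_def sum_fun_apply mulvar_apply xv)
    finally show ?thesis .
  next
    case 2
    note b = splice_basis[OF 2 j]
    have B: "B \<subseteq> {..<f}" "card B = j - 1" "v = {#}" using x xv b(2) by (auto simp: basis_iff)
    have "(\<Sum>y\<in>X j. cx_diff C j x y * u y) = (\<Sum>(A, w)\<in>basis {..<f} {..<g} (length [0..<g] + (j - 1)) 0.
      (if B \<subseteq> A then inversion_sign (A - B) B * list_minor \<phi> [0..<g] (A - B) else 0) * u (A, w))"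
      unfolding b(1) using 2 splice_entry(1)[OF _ B(1,2), of _ _ v]
      by (intro sum.cong) (auto simp: xv en_complex_def)
    also have "\<dots> = contracts {..<f} \<phi> (rev [0..<g]) u (B, {#})"
      by (rule contracts_matrix[OF finite_lessThan B(1,2)]) (use u b(1) in simp)
    finally show ?thesis using 2 B(3) by (simp add: en_map_def xv)
  next
    case 3
    have "(\<Sum>y\<in>X j. cx_diff C j x y * u y) = (\<Sum>(A, w)\<in>X j. (\<Sum>a\<in>{a \<in> A. B = A - {a}}.
        \<Sum>t\<in>{t \<in> {..<g}. w = add_mset t v}. insertion_sign A a * \<phi> t a) * u (A, w))"
      using 3 step_entry(1) Xj(2)
      by (intro sum.cong refl) (auto simp: xv en_complex_def en_partial_def)
    also have "\<dots> = (\<Sum>t<g. if True then contract {..<f} (\<phi> t) u (B, add_mset t v) else 0)"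
      by (rule contract_matrix[OF Xj finite_lessThan finite_lessThan u]) auto
    also have "\<dots> = M j u x"
      using 3 by (simp add: en_map_def partial_def sum_fun_apply shift_apply xv)
    finally show ?thesis .
  qed
qed

text \<open>Members of \<open>chains\<close> are \<open>undefined\<close> off the basis, whereas
  members of \<open>free_mod\<close> vanish there.\<close>

definition extend :: "nat \<Rightarrow> (nat set \<times> nat multiset \<Rightarrow> ('v, 'k) cox_poly) \<Rightarrow> ('v, 'k) cox_poly chain" where
  "extend j z = (\<lambda>p. if p \<in> X j then z p else 0)"

lemma extend_free: "extend j z \<in> free_mod (X j)"
  by (auto simp: extend_def coeffs_in_def)

lemma chains_C: "z \<in> chains R C j \<longleftrightarrow> z \<in> X j \<rightarrow>\<^sub>E carrier R"
  by (simp add: chains_def basis_C)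

lemma boundary_map_C:
  assumes j: "1 \<le> j" and z: "z \<in> chains R C j"
  shows "boundary_map R C j z = restrict (M j (extend j z)) (X (j - 1))"
  unfolding boundary_map_def basis_C
proof (rule restrict_ext)
  fix x assume x: "x \<in> X (j - 1)"
  have "(\<Oplus>\<^bsub>R\<^esub>c\<in>X j. cx_diff C j x c \<otimes>\<^bsub>R\<^esub> z c) = (\<Sum>c\<in>X j. cx_diff C j x c * z c)"
    unfolding cox_ring_simps
    using z diff_carrier[OF j x] by (intro cox_finsum finite_en_basis cox_mult) (auto simp: chains_C)
  also have "\<dots> = (\<Sum>c\<in>X j. cx_diff C j x c * extend j z c)"
    by (rule sum.cong) (auto simp: extend_def)
  finally show "(\<Oplus>\<^bsub>R\<^esub>c\<in>X j. cx_diff C j x c \<otimes>\<^bsub>R\<^esub> z c) = M j (extend j z) x"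
    using diff_matrix[OF j x extend_free] by simp
qed

lemma M_free: "1 \<le> j \<Longrightarrow> u \<in> free_mod (X j) \<Longrightarrow> M j u \<in> free_mod (X (j - 1))"
  using E.d_coeffs[of UNIV u "j - 1"] by simp

lemma M_extend_carrier:
  assumes "1 \<le> j" "z \<in> chains R C j" "x \<in> X (j - 1)"
  shows "M j (extend j z) x \<in> carrier R"
proof -
  have "(\<Sum>y\<in>X j. cx_diff C j x y * extend j z y) \<in> carrier R"
    using assms diff_carrier by (intro cox_sum cox_mult) (auto simp: chains_C extend_def)
  then show ?thesis using diff_matrix[OF assms(1,3) extend_free] by simp
qed

lemma extend_restrict: "u \<in> free_mod (X j) \<Longrightarrow> extend j (restrict u (X j)) = u"
  by (rule ext) (auto simp: extend_def coeffs_in_def)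

lemma is_complex_C: "is_complex R C"
  unfolding is_complex_def basis_C
proof (intro conjI allI impI ballI subsetI)
  fix j x y assume "1 \<le> j" "x \<in> X (j - 1)" "y \<in> X j"
  then show "cx_diff C j x y \<in> carrier R" by (rule diff_carrier)
next
  fix j :: nat and y assume j: "1 \<le> j" and "y \<in> boundaries R C j"
  then obtain w where w: "w \<in> chains R C (Suc j)" and y: "y = boundary_map R C (Suc j) w"
    by (auto simp: boundaries_def)
  have y': "y = restrict (M (Suc j) (extend (Suc j) w)) (X j)"
    using boundary_map_C[of "Suc j" w] w y by simp
  then have yc: "y \<in> chains R C j"
    using M_extend_carrier[of "Suc j" w] w by (auto simp: chains_C)
  have "extend j y = M (Suc j) (extend (Suc j) w)"
    unfolding y' using M_free[of "Suc j" "extend (Suc j) w"] extend_free by (intro extend_restrict) simp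
  moreover obtain j' where "j = Suc j'" using j by (cases j) auto
  ultimately have "M j (extend j y) = 0"
    using E.d_d[of "extend (Suc j) w" j'] extend_free by simp
  then show "y \<in> cycles R C j"
    using yc boundary_map_C[OF j yc] by (auto simp: cycles_def basis_C intro!: restrict_ext)
qed

text \<open>The bounding chain found over all polynomials is projected by
  \<open>coordinate \<Sigma> 0\<close>. This commutes with the differential, whose entries lie in
  the Cox ring, and fixes the values of \<open>s * z\<close>.\<close>

lemma annihilates:
  assumes j: "1 \<le> j" and s: "s \<in> carrier R" "s \<in> E.annihilator j" and z: "z \<in> cycles R C j"
  shows "(\<lambda>c\<in>X j. s * z c) \<in> boundaries R C j"
proof -
  have zc: "z \<in> chains R C j" and bz: "boundary_map R C j z = (\<lambda>r\<in>X (j - 1). 0)"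
    using z by (auto simp: cycles_def basis_C)
  have "M j (extend j z) = 0"
  proof
    fix x
    show "M j (extend j z) x = 0 x"
    proof (cases "x \<in> X (j - 1)")
      case True
      then show ?thesis using fun_cong[OF bz[unfolded boundary_map_C[OF j zc]], of x] by simp
    next
      case False
      then show ?thesis using M_free[OF j extend_free, of z] by (cases x) (simp add: coeffs_in_def)
    qed
  qed
  then have "extend j z \<in> E.Z j" using extend_free by (simp add: E.Z_def)
  then obtain u where u: "u \<in> free_mod (X (Suc j))" "smul s (extend j z) = M (Suc j) u"
    using s(2) by (auto simp: E.annihilator_def E.B_def)
  define w where "w = (\<lambda>y\<in>X (Suc j). coordinate \<Sigma> 0 (u y))"
  have w: "w \<in> chains R C (Suc j)" by (auto simp: w_def chains_C coordinate_carrier)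
  have "boundary_map R C (Suc j) w = (\<lambda>c\<in>X j. s * z c)"
    unfolding boundary_map_C[of "Suc j", OF _ w, simplified]
  proof (rule restrict_ext)
    fix x assume x: "x \<in> X j"
    have "M (Suc j) (extend (Suc j) w) x = (\<Sum>y\<in>X (Suc j). cx_diff C (Suc j) x y * coordinate \<Sigma> 0 (u y))"
      using diff_matrix[of "Suc j" x "extend (Suc j) w"] x extend_free
      by (simp add: extend_def w_def cong: sum.cong)
    also have "\<dots> = coordinate \<Sigma> 0 (\<Sum>y\<in>X (Suc j). cx_diff C (Suc j) x y * u y)"
      unfolding coordinate_sum
      using diff_carrier[of "Suc j" x] x by (intro sum.cong refl coordinate_mult[symmetric]) simp
    also have "(\<Sum>y\<in>X (Suc j). cx_diff C (Suc j) x y * u y) = M (Suc j) u x"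
      using diff_matrix[of "Suc j" x u] x u(1) by simp
    also have "\<dots> = s * z x"
      using fun_cong[OF u(2), of x] x by (simp only: smul_apply extend_def if_True)
    also have "coordinate \<Sigma> 0 (s * z x) = s * z x"
      using zc x s(1) by (intro coordinate_one cox_mult) (auto simp: chains_C)
    finally show "M (Suc j) (extend (Suc j) w) x = s * z x" .
  qed
  then show ?thesis using w unfolding boundaries_def by (metis imageI)
qed

end


section \<open>Depth of saturated determinantal ideals\<close>

lemma ideal_power_self:
  assumes B: "ideal B (cox_ring \<Sigma>)" and b: "b \<in> B"
  shows "b ^ n \<in> ideal_power (cox_ring \<Sigma>) B n"
proof (induction n)
  case 0
  show ?case by (simp add: cox_one)
next
  case (Suc n)
  then show ?case using ideal_prod.prod[OF b Suc, of "cox_ring \<Sigma>"] by simp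
qed

lemma minors_ideal_subset:
  assumes entries: "\<And>t c. t < g \<Longrightarrow> c < f \<Longrightarrow> \<phi> t c \<in> carrier (cox_ring \<Sigma>)"
  shows "minors_ideal (cox_ring \<Sigma>) g f \<phi> (int m) \<subseteq> determinantal_ideal {..<f} {..<g} \<phi> m"
proof (cases "m = 0")
  case True
  \<comment> \<open>The empty list of contractions makes the ideal for index 0 the whole ring, in
    accordance with \<open>minors_ideal\<close>.\<close>
  have "x \<in> determinantal_ideal {..<f} {..<g} \<phi> 0" for x
    using determinantal_idealI[of "[]" "{..<g}" 0 "{..<f}" \<phi> "\<lambda>_. x"] by simp
  then show ?thesis using True by auto
next
  case False
  let ?S = "{minor (cox_ring \<Sigma>) \<phi> I J |I J. I \<subseteq> {..<g} \<and> J \<subseteq> {..<f} \<and> int (card I) = int m \<and> int (card J) = int m}"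
  have minors: "x \<in> carrier (cox_ring \<Sigma>) \<and> x \<in> determinantal_ideal {..<f} {..<g} \<phi> m" if "x \<in> ?S" for x
  proof -
    from that obtain I J where IJ: "I \<subseteq> {..<g}" "J \<subseteq> {..<f}" "card I = m" "card J = m"
      and x: "x = minor (cox_ring \<Sigma>) \<phi> I J" by auto
    have fin: "finite I" "finite J" using IJ finite_subset by blast+
    have ent: "\<phi> r c \<in> carrier (cox_ring \<Sigma>)" if "r \<in> I" "c \<in> J" for r c using that IJ entries by blast
    have xl: "x = list_minor \<phi> (sorted_list_of_set I) J"
      unfolding x using IJ fin ent by (intro cox_minor) auto
    have "x \<in> determinantal_ideal {..<f} {..<g} \<phi> (length (sorted_list_of_set I))"
      unfolding xl using IJ fin by (intro list_minor_in_determinantal_ideal) auto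
    moreover have "x \<in> carrier (cox_ring \<Sigma>)"
    proof -
      have "\<phi> (sorted_list_of_set I ! p) (sorted_list_of_set J ! q) \<in> carrier (cox_ring \<Sigma>)" if "p < m" "q < m" for p q
        using nth_mem[of p "sorted_list_of_set I"] nth_mem[of q "sorted_list_of_set J"] that IJ fin by (intro ent) auto
      then show ?thesis
        unfolding xl list_minor_def Determinant.det_def using IJ fin
        by (auto intro!: cox_sum cox_mult cox_prod simp: sign_def cox_one cox_uminus dest: permutes_in_image)
    qed
    ultimately show ?thesis using IJ fin by simp
  qed
  have "Idl\<^bsub>cox_ring \<Sigma>\<^esub> ?S \<subseteq> ideal.span ?S" by (rule cox_genideal_subset) (use minors in blast)
  also have "\<dots> \<subseteq> determinantal_ideal {..<f} {..<g} \<phi> m"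
    by (rule ideal.span_minimal[OF _ ideal_determinantal]) (use minors in blast)
  finally show ?thesis using False by (simp add: minors_ideal_def)
qed

text \<open>If all regular sequences in \<open>I\<close> were shorter than \<open>d\<close>, their
  supremum would be at most \<open>d - 1\<close>, which is less than \<open>d\<close> because
  \<open>d\<close> is positive.\<close>

lemma regular_sequence_of_depth:
  assumes "enat d \<le> ideal_depth R I" "I \<noteq> carrier R" "d > 0"
  obtains xs where "regular_sequence R xs" "set xs \<subseteq> I" "d \<le> length xs"
proof -
  have "\<exists>xs. regular_sequence R xs \<and> set xs \<subseteq> I \<and> d \<le> length xs"
  proof (rule ccontr)
    assume neg: "\<nexists>xs. regular_sequence R xs \<and> set xs \<subseteq> I \<and> d \<le> length xs"
    have "ideal_depth R I \<le> enat (d - 1)"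
      unfolding ideal_depth_def using assms(2) neg assms(3) by (auto intro!: SUP_least simp: not_le)
    then have "enat d \<le> enat (d - 1)" using assms(1) by (rule order_trans[rotated])
    then show False using assms(3) by simp
  qed
  then show ?thesis using that by blast
qed

lemma deep_of_depth:
  fixes \<phi> :: "nat \<Rightarrow> nat \<Rightarrow> ('v::euclidean_space, 'k::field) cox_poly"
  assumes entries: "\<And>t c. t < g \<Longrightarrow> c < f \<Longrightarrow> \<phi> t c \<in> carrier (cox_ring \<Sigma>)"
    and B: "ideal B (cox_ring \<Sigma>)" and b: "b \<in> B"
    and depth: "enat (Suc d) \<le> ideal_depth (cox_ring \<Sigma>)
      (saturation (cox_ring \<Sigma>) (minors_ideal (cox_ring \<Sigma>) g f \<phi> (int m)) B)"
  shows "deep b (determinantal_ideal {..<f} {..<g} \<phi> m) (Suc d)"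
proof -
  let ?R = "cox_ring \<Sigma> :: ('v, 'k) cox_poly ring"
  let ?J = "saturation ?R (minors_ideal ?R g f \<phi> (int m)) B" and ?D = "determinantal_ideal {..<f} {..<g} \<phi> m"
  have D: "ideal.subspace ?D" by (rule ideal_determinantal)
  have rad: "b * x \<in> radical ?D" if "x \<in> ?J" for x
  proof -
    from that obtain n where "\<forall>s\<in>ideal_power ?R B n. x * s \<in> minors_ideal ?R g f \<phi> (int m)"
      by (auto simp: saturation_def ideal_colon_def)
    then have "x * b ^ n \<in> minors_ideal ?R g f \<phi> (int m)"
      using ideal_power_self[OF B b] by (rule bspec)
    moreover have "minors_ideal ?R g f \<phi> (int m) \<subseteq> ?D"
      by (rule minors_ideal_subset) (rule entries)
    ultimately have "x * b ^ n \<in> ?D" by (rule subsetD[rotated])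
    \<comment> \<open>The factor completes \<open>x * b ^ n\<close> to a power of
      \<open>b * x\<close>.\<close>
    then have "(b * x ^ n) * (x * b ^ n) \<in> ?D" by (rule ideal.subspace_scale[OF D])
    moreover have "(b * x ^ n) * (x * b ^ n) = (b * x) ^ Suc n"
      by (simp add: power_mult_distrib mult_ac)
    ultimately show ?thesis by (metis radicalI)
  qed
  show ?thesis
  proof (cases "?J = carrier ?R")
    case True
    \<comment> \<open>The depth is infinite by convention here and yields no sequence. Constant 1s
      take its place: membership of 1 in the saturation puts \<open>b\<close> into the radical of
      \<open>?D\<close>.\<close>
    have "weakly_regular (replicate (Suc d) (1 :: ('v, 'k) cox_poly))"
      unfolding weakly_regular_def by (auto simp del: replicate_Suc)
    moreover have "b * 1 \<in> radical ?D" by (rule rad) (simp add: True cox_one)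
    ultimately show ?thesis
      unfolding deep_def by (intro exI[of _ "replicate (Suc d) 1"]) auto
  next
    case False
    obtain xs where xs: "regular_sequence ?R xs" "set xs \<subseteq> ?J" "Suc d \<le> length xs"
      using regular_sequence_of_depth[OF depth False] by auto
    have "weakly_regular xs"
      using xs(1) unfolding regular_sequence_def by (intro weakly_regular_cox[of _ \<Sigma>]) auto
    then have "weakly_regular (take (Suc d) xs)" by (rule weakly_regular_take)
    moreover have "length (take (Suc d) xs) = Suc d" using xs(3) by simp
    moreover have "b * x \<in> radical ?D" if "x \<in> set (take (Suc d) xs)" for x
      using rad that xs(2) set_take_subset by fast
    ultimately show ?thesis unfolding deep_def by blast
  qed
qed


section \<open>Powers of a finitely generated ideal\<close>

lemma ideal_power_products:
  assumes S: "S \<subseteq> carrier (cox_ring \<Sigma>)"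
  shows "ideal_power (cox_ring \<Sigma>) (Idl\<^bsub>cox_ring \<Sigma>\<^esub> S) n \<subseteq>
    ideal.span {prod_mset M |M. set_mset M \<subseteq> S \<and> size M = n}"
proof (induction n)
  case 0
  have "1 \<in> ideal.span {prod_mset M |M. set_mset M \<subseteq> S \<and> size M = 0}"
    by (rule ideal.span_base) (auto intro!: exI[of _ "{#}"])
  then have "x \<in> ideal.span {prod_mset M |M. set_mset M \<subseteq> S \<and> size M = 0}" for x
    using ideal.span_scale[of 1 _ x] by simp
  then show ?case by blast
next
  case (Suc n)
  let ?P = "\<lambda>n. ideal.span {prod_mset M |M. set_mset M \<subseteq> S \<and> size M = n}"
  have mult: "x * y \<in> ?P (Suc n)" if x: "x \<in> ideal.span S" and y: "y \<in> ?P n" for x y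
    using x
  proof (induction rule: ideal.span_induct_alt)
    case base
    show ?case by (simp add: ideal.span_zero)
  next
    case (step c s x)
    have "s * y \<in> ?P (Suc n)"
      using y
    proof (induction rule: ideal.span_induct_alt)
      case base
      show ?case by (simp add: ideal.span_zero)
    next
      case (step c' p y)
      then obtain M where M: "p = prod_mset M" "set_mset M \<subseteq> S" "size M = n" by blast
      have "s * p \<in> ?P (Suc n)"
        using M \<open>s \<in> S\<close> by (intro ideal.span_base) (auto intro!: exI[of _ "add_mset s M"])
      then show ?case
        using ideal.span_add[OF ideal.span_scale[of "s * p" _ c'] step(2)]
        by (simp add: distrib_left mult.left_commute)
    qed
    then show ?case
      using ideal.span_add[OF ideal.span_scale[of "s * y" _ c] step(2)]
      by (simp add: distrib_right mult.assoc)
  qed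
  show ?case
  proof
    fix x assume "x \<in> ideal_power (cox_ring \<Sigma>) (Idl\<^bsub>cox_ring \<Sigma>\<^esub> S) (Suc n)"
    then have "x \<in> ideal_prod (cox_ring \<Sigma>) (Idl\<^bsub>cox_ring \<Sigma>\<^esub> S) (ideal_power (cox_ring \<Sigma>) (Idl\<^bsub>cox_ring \<Sigma>\<^esub> S) n)"
      by simp
    then show "x \<in> ?P (Suc n)"
    proof (induction rule: ideal_prod.induct)
      case (prod i j)
      then show ?case using mult Suc cox_genideal_subset[OF S] by auto
    next
      case (sum s1 s2)
      then show ?case by (simp add: ideal.span_add)
    qed
  qed
qed

text \<open>Passes from the single generators of the irrelevant ideal, each acting nilpotently on
  the homology, to a power of the whole ideal.\<close>

lemma ideal_power_eventually_subset:
  fixes S :: "('v::euclidean_space, 'k::field) cox_poly set"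
  assumes S: "S \<subseteq> carrier (cox_ring \<Sigma>)" "finite S" and A: "ideal.subspace A" and rad: "S \<subseteq> radical A"
  shows "\<exists>n. ideal_power (cox_ring \<Sigma>) (Idl\<^bsub>cox_ring \<Sigma>\<^esub> S) n \<subseteq> A"
proof -
  have "\<forall>s\<in>S. \<exists>k. s ^ k \<in> A" using rad unfolding radical_def by blast
  then obtain e where e: "\<And>s. s \<in> S \<Longrightarrow> s ^ e s \<in> A" by (meson bchoice)
  \<comment> \<open>Pigeonhole: a product of this many factors from \<open>S\<close> contains some
    \<open>s\<close> at least \<open>e s\<close> times.\<close>
  define n where "n = Suc (\<Sum>s\<in>S. e s)"
  have "prod_mset M \<in> A" if M: "set_mset M \<subseteq> S" "size M = n" for M
  proof -
    have "\<exists>s\<in>S. e s \<le> count M s"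
    proof (rule ccontr)
      assume "\<not> (\<exists>s\<in>S. e s \<le> count M s)"
      then have "(\<Sum>s\<in>S. count M s) \<le> (\<Sum>s\<in>S. e s)" by (intro sum_mono) auto
      moreover have "size M = (\<Sum>s\<in>S. count M s)"
        unfolding size_multiset_overloaded_eq using M(1) S(2)
        by (intro sum.mono_neutral_left) (auto simp: not_in_iff)
      ultimately show False using M(2) n_def by simp
    qed
    then obtain s where s: "s \<in> S" "e s \<le> count M s" by blast
    then have "replicate_mset (e s) s \<subseteq># M" by (simp add: count_le_replicate_mset_subset_eq)
    then obtain M' where "M = replicate_mset (e s) s + M'" by (metis subset_mset.add_diff_inverse)
    then have "prod_mset M = s ^ e s * prod_mset M'" by (simp add: prod_mset_replicate_mset)
    then show ?thesis using ideal_mult[OF A e[OF s(1)]] by simp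
  qed
  then have "ideal.span {prod_mset M |M. set_mset M \<subseteq> S \<and> size M = n} \<subseteq> A"
    by (intro ideal.span_minimal A) auto
  then show ?thesis using ideal_power_products[OF S(1)] by blast
qed


section \<open>Gradings\<close>

lemma dual_lattice_add: "m \<in> dual_lattice N \<Longrightarrow> m' \<in> dual_lattice N \<Longrightarrow> m + m' \<in> dual_lattice N"
  by (auto simp: dual_lattice_def span_add inner_add_left)

lemma dual_lattice_neg: "m \<in> dual_lattice N \<Longrightarrow> - m \<in> dual_lattice N"
  by (auto simp: dual_lattice_def span_neg)

lemma subgroup_principal_divisors: "subgroup (principal_divisors N \<Sigma>) (free_Abelian_group (rays \<Sigma>))"
proof (rule group.subgroupI[OF group_free_Abelian_group])
  show "principal_divisors N \<Sigma> \<subseteq> carrier (free_Abelian_group (rays \<Sigma>))"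
    by (auto simp: principal_divisors_def)
  have "0 \<in> dual_lattice N" by (simp add: dual_lattice_def span_zero)
  then have "0 \<in> principal_divisors N \<Sigma>"
    unfolding principal_divisors_def by (intro CollectI conjI bexI[of _ 0]) simp_all
  then show "principal_divisors N \<Sigma> \<noteq> {}" by blast
next
  fix D assume "D \<in> principal_divisors N \<Sigma>"
  then obtain m where D: "Poly_Mapping.keys D \<subseteq> rays \<Sigma>" and m: "m \<in> dual_lattice N"
    "\<forall>\<rho>\<in>rays \<Sigma>. real_of_int (Poly_Mapping.lookup D \<rho>) = m \<bullet> ray_generator N \<rho>"
    by (auto simp: principal_divisors_def)
  then show "inv\<^bsub>free_Abelian_group (rays \<Sigma>)\<^esub> D \<in> principal_divisors N \<Sigma>"
    using dual_lattice_neg[OF m(1)]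
    by (auto simp: principal_divisors_def intro!: bexI[of _ "- m"])
next
  fix D D' assume "D \<in> principal_divisors N \<Sigma>" "D' \<in> principal_divisors N \<Sigma>"
  then obtain m m' where D: "Poly_Mapping.keys D \<subseteq> rays \<Sigma>" "Poly_Mapping.keys D' \<subseteq> rays \<Sigma>"
    and m: "m \<in> dual_lattice N" "m' \<in> dual_lattice N"
    "\<forall>\<rho>\<in>rays \<Sigma>. real_of_int (Poly_Mapping.lookup D \<rho>) = m \<bullet> ray_generator N \<rho>"
    "\<forall>\<rho>\<in>rays \<Sigma>. real_of_int (Poly_Mapping.lookup D' \<rho>) = m' \<bullet> ray_generator N \<rho>"
    by (auto simp: principal_divisors_def)
  then show "D \<otimes>\<^bsub>free_Abelian_group (rays \<Sigma>)\<^esub> D' \<in> principal_divisors N \<Sigma>"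
    using dual_lattice_add[OF m(1,2)] Poly_Mapping.keys_add[of D D']
    by (auto simp: principal_divisors_def lookup_add inner_add_left intro!: bexI[of _ "m + m'"])
qed

lemma normal_principal_divisors: "normal (principal_divisors N \<Sigma>) (free_Abelian_group (rays \<Sigma>))"
  by (rule comm_group.subgroup_imp_normal[OF abelian_free_Abelian_group subgroup_principal_divisors])

lemma comm_group_Pic: "comm_group (Pic N \<Sigma>)"
  unfolding Pic_def
  by (rule comm_group.abelian_FactGroup[OF abelian_free_Abelian_group subgroup_principal_divisors])

interpretation Pic: comm_group "Pic N \<Sigma>" for N \<Sigma> by (rule comm_group_Pic)

lemma monomial_degree_add:
  assumes "Poly_Mapping.keys t \<subseteq> rays \<Sigma>" "Poly_Mapping.keys u \<subseteq> rays \<Sigma>"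
  shows "monomial_degree N \<Sigma> (t + u) = monomial_degree N \<Sigma> t \<otimes>\<^bsub>Pic N \<Sigma>\<^esub> monomial_degree N \<Sigma> u"
proof -
  have map: "Poly_Mapping.map int (t + u) = Poly_Mapping.map int t + Poly_Mapping.map int u"
    by (rule poly_mapping_eqI) (simp add: lookup_add Poly_Mapping.map.rep_eq when_def)
  have "Poly_Mapping.keys (Poly_Mapping.map int t) \<subseteq> rays \<Sigma>" "Poly_Mapping.keys (Poly_Mapping.map int u) \<subseteq> rays \<Sigma>"
    using assms by (auto simp: in_keys_iff Poly_Mapping.map.rep_eq when_def subset_iff split: if_splits)
  then show ?thesis
    unfolding monomial_degree_def divisor_class_def map Pic_def mult_FactGroup
    by (subst normal.rcos_sum[OF normal_principal_divisors]) simp_all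
qed

lemma monomial_degree_zero: "monomial_degree N \<Sigma> 0 = \<one>\<^bsub>Pic N \<Sigma>\<^esub>"
proof -
  have "Poly_Mapping.map int (0 :: 'a set \<Rightarrow>\<^sub>0 nat) = 0"
    by (rule poly_mapping_eqI) (simp add: Poly_Mapping.map.rep_eq)
  then have "monomial_degree N \<Sigma> 0 = principal_divisors N \<Sigma> #>\<^bsub>free_Abelian_group (rays \<Sigma>)\<^esub> \<one>\<^bsub>free_Abelian_group (rays \<Sigma>)\<^esub>"
    by (simp add: monomial_degree_def divisor_class_def)
  also have "\<dots> = principal_divisors N \<Sigma>"
    by (rule group.coset_mult_one[OF group_free_Abelian_group]) (rule subgroup.subset[OF subgroup_principal_divisors])
  finally show ?thesis by (simp add: Pic_def)
qed

lemma homogeneous_zero: "homogeneous N \<Sigma> d 0"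
  by (simp add: homogeneous_def cox_zero)

lemma homogeneous_one: "homogeneous N \<Sigma> \<one>\<^bsub>Pic N \<Sigma>\<^esub> 1"
  by (simp add: homogeneous_def cox_one monomial_degree_zero)

lemma homogeneous_add: "homogeneous N \<Sigma> d p \<Longrightarrow> homogeneous N \<Sigma> d q \<Longrightarrow> homogeneous N \<Sigma> d (p + q)"
  using Poly_Mapping.keys_add[of p q] by (auto simp: homogeneous_def cox_add)

lemma homogeneous_uminus: "homogeneous N \<Sigma> d p \<Longrightarrow> homogeneous N \<Sigma> d (- p)"
  by (simp add: homogeneous_def cox_uminus in_keys_iff)

lemma homogeneous_sign: "homogeneous N \<Sigma> d p \<Longrightarrow> homogeneous N \<Sigma> d ((- 1) ^ n * p)"
  by (induction n) (simp_all add: homogeneous_uminus)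

lemma homogeneous_sum: "(\<And>x. x \<in> A \<Longrightarrow> homogeneous N \<Sigma> d (h x)) \<Longrightarrow> homogeneous N \<Sigma> d (sum h A)"
  by (induction A rule: infinite_finite_induct) (auto intro: homogeneous_zero homogeneous_add)

lemma homogeneous_mult:
  assumes "homogeneous N \<Sigma> d p" "homogeneous N \<Sigma> d' q"
  shows "homogeneous N \<Sigma> (d \<otimes>\<^bsub>Pic N \<Sigma>\<^esub> d') (p * q)"
  unfolding homogeneous_def
proof (intro conjI ballI)
  show "p * q \<in> carrier (cox_ring \<Sigma>)" using assms by (auto simp: homogeneous_def intro: cox_mult)
  fix t assume "t \<in> Poly_Mapping.keys (p * q)"
  then obtain a b where "t = a + b" "a \<in> Poly_Mapping.keys p" "b \<in> Poly_Mapping.keys q"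
    using keys_mult[of p q] by blast
  then show "monomial_degree N \<Sigma> t = d \<otimes>\<^bsub>Pic N \<Sigma>\<^esub> d'"
    using assms by (auto simp: homogeneous_def carrier_cox_ring monomial_degree_add)
qed

lemma homogeneous_prod:
  assumes "finite A" "\<And>x. x \<in> A \<Longrightarrow> homogeneous N \<Sigma> (d x) (h x)" "\<And>x. x \<in> A \<Longrightarrow> d x \<in> carrier (Pic N \<Sigma>)"
  shows "homogeneous N \<Sigma> (finprod (Pic N \<Sigma>) d A) (prod h A)"
  using assms by (induction A rule: finite_induct) (auto simp: homogeneous_one homogeneous_mult Pi_iff)

section \<open>Degree computations in an abelian group\<close>

context comm_group
begin

lemma monomial_add_mset:
  assumes y: "\<And>s. s \<in># add_mset t w \<Longrightarrow> y s \<in> carrier G"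
  shows "(\<Otimes>s\<in>set_mset (add_mset t w). y s [^] count (add_mset t w) s) =
    y t \<otimes> (\<Otimes>s\<in>set_mset w. y s [^] count w s)"
proof -
  let ?S = "set_mset (add_mset t w)"
  have "(\<Otimes>s\<in>?S. y s [^] count (add_mset t w) s) = (\<Otimes>s\<in>?S. (if t = s then y s else \<one>) \<otimes> (y s [^] count w s))"
    using y by (intro finprod_cong') (auto simp: nat_pow_Suc m_comm)
  also have "\<dots> = (\<Otimes>s\<in>?S. if t = s then y s else \<one>) \<otimes> (\<Otimes>s\<in>?S. y s [^] count w s)"
    using y by (intro finprod_multf) auto
  also have "(\<Otimes>s\<in>?S. if t = s then y s else \<one>) = y t"
    using y by (intro finprod_singleton) auto
  also have "(\<Otimes>s\<in>?S. y s [^] count w s) = (\<Otimes>s\<in>set_mset w. y s [^] count w s)"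
    using y by (intro finprod_mono_neutral_cong_right) (auto simp: not_in_iff)
  finally show ?thesis .
qed

text \<open>The three cancellations starting here give the degree of the column divided by that of
  the row, for the entries of \<open>delta\<close>, the splice map and
  \<open>partial\<close>.\<close>

lemma degree_cancel:
  assumes "a \<in> carrier G" "b \<in> carrier G" "c \<in> carrier G" "t \<in> carrier G"
  shows "(a \<otimes> b \<otimes> c) \<otimes> inv (b \<otimes> (t \<otimes> c)) = a \<otimes> inv t"
proof -
  have eq: "a \<otimes> b \<otimes> c = (a \<otimes> inv t) \<otimes> (b \<otimes> (t \<otimes> c))"
  proof -
    have "(a \<otimes> inv t) \<otimes> (b \<otimes> (t \<otimes> c)) = (inv t \<otimes> t) \<otimes> (a \<otimes> b \<otimes> c)"
      using assms by (simp add: m_ac)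
    then show ?thesis using assms by simp
  qed
  show ?thesis
    by (rule inv_solve_right[THEN iffD2, symmetric]) (simp_all only: m_closed inv_closed assms eq)
qed

lemma degree_cancel_splice:
  assumes "a \<in> carrier G" "b \<in> carrier G" "d \<in> carrier G"
  shows "(a \<otimes> b \<otimes> d) \<otimes> inv b = a \<otimes> d"
proof -
  have eq: "a \<otimes> b \<otimes> d = (a \<otimes> d) \<otimes> b" using assms by (simp add: m_ac)
  show ?thesis
    by (rule inv_solve_right[THEN iffD2, symmetric]) (simp_all only: m_closed inv_closed assms eq)
qed

lemma degree_cancel_dual:
  assumes "a \<in> carrier G" "b \<in> carrier G" "c \<in> carrier G" "t \<in> carrier G" "d \<in> carrier G"
  shows "(a \<otimes> b \<otimes> inv (t \<otimes> c) \<otimes> inv d) \<otimes> inv (b \<otimes> inv c \<otimes> inv d) = a \<otimes> inv t"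
proof -
  have eq: "a \<otimes> b \<otimes> inv (t \<otimes> c) \<otimes> inv d = (a \<otimes> inv t) \<otimes> (b \<otimes> inv c \<otimes> inv d)"
    using assms by (simp add: inv_mult m_ac)
  show ?thesis
    by (rule inv_solve_right[THEN iffD2, symmetric]) (simp_all only: m_closed inv_closed assms eq)
qed

lemma finprod_inv:
  assumes "finite A" "\<And>x. x \<in> A \<Longrightarrow> h x \<in> carrier G"
  shows "(\<Otimes>x\<in>A. inv (h x)) = inv (\<Otimes>x\<in>A. h x)"
  using assms by (induction A rule: finite_induct) (auto simp: inv_mult Pi_iff)

end

section \<open>Homogeneity of the differentials\<close>

locale graded_cox_matrix = cox_matrix +
  fixes N :: "'a set" and xdeg ydeg :: "nat \<Rightarrow> ('a set \<Rightarrow>\<^sub>0 int) set"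
  assumes xdeg: "c < f \<Longrightarrow> xdeg c \<in> carrier (Pic N \<Sigma>)"
    and ydeg: "t < g \<Longrightarrow> ydeg t \<in> carrier (Pic N \<Sigma>)"
    and homogeneous_entries: "t < g \<Longrightarrow> c < f \<Longrightarrow>
      homogeneous N \<Sigma> (xdeg c \<otimes>\<^bsub>Pic N \<Sigma>\<^esub> inv\<^bsub>Pic N \<Sigma>\<^esub> ydeg t) (\<phi> t c)"
begin

abbreviation G where "G \<equiv> Pic N \<Sigma>"
abbreviation dg where "dg \<equiv> en_degree G g xdeg ydeg i"
abbreviation xs where "xs A \<equiv> finprod G xdeg A"
abbreviation ys where "ys w \<equiv> \<Otimes>\<^bsub>G\<^esub>t\<in>set_mset w. ydeg t [^]\<^bsub>G\<^esub> count w t"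
abbreviation yall where "yall \<equiv> \<Otimes>\<^bsub>G\<^esub>t\<in>{..<g}. ydeg t"

lemma xs_carrier: "A \<subseteq> {..<f} \<Longrightarrow> xs A \<in> carrier G"
  using xdeg by (intro Pic.finprod_closed) auto

lemma ys_carrier: "set_mset w \<subseteq> {..<g} \<Longrightarrow> ys w \<in> carrier G"
  using ydeg by (intro Pic.finprod_closed) auto

lemma yall_carrier: "yall \<in> carrier G"
  using ydeg by (intro Pic.finprod_closed) auto

lemma dg_carrier: "(A, w) \<in> X j \<Longrightarrow> dg k (A, w) \<in> carrier G"
  using en_basis_subset[of A w f g i j] xs_carrier[of A] ys_carrier[of w] yall_carrier
  by (simp add: en_degree_def Let_def)

lemma xs_insert:
  assumes "A \<subseteq> {..<f}" "a \<in> A" "B = A - {a}"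
  shows "xs A = xdeg a \<otimes>\<^bsub>G\<^esub> xs B"
proof -
  have "finite B" "A = insert a B" "a \<notin> B" using assms finite_subset[OF assms(1)] by auto
  then show ?thesis using assms(1) xdeg by (simp add: Pi_iff subset_iff)
qed

lemma ys_add:
  assumes "set_mset (add_mset t w) \<subseteq> {..<g}"
  shows "ys (add_mset t w) = ydeg t \<otimes>\<^bsub>G\<^esub> ys w"
  using assms ydeg by (intro Pic.monomial_add_mset) auto

text \<open>The degree condition concerns only summands that occur; an entry without summands is 0,
  which is homogeneous of every degree.\<close>

lemma step_homogeneous:
  assumes "A \<subseteq> {..<f}"
    and "\<And>a t. a \<in> A \<Longrightarrow> B = A - {a} \<Longrightarrow> t < g \<Longrightarrow> Q t \<Longrightarrow> d = xdeg a \<otimes>\<^bsub>G\<^esub> inv\<^bsub>G\<^esub> ydeg t"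
  shows "homogeneous N \<Sigma> d (\<Sum>a\<in>{a \<in> A. B = A - {a}}. \<Sum>t\<in>{t \<in> {..<g}. Q t}. insertion_sign A a * \<phi> t a)"
proof (intro homogeneous_sum)
  fix a t assume a: "a \<in> {a \<in> A. B = A - {a}}" and t: "t \<in> {t \<in> {..<g}. Q t}"
  then have "d = xdeg a \<otimes>\<^bsub>G\<^esub> inv\<^bsub>G\<^esub> ydeg t" using assms(2) by simp
  then show "homogeneous N \<Sigma> d (insertion_sign A a * \<phi> t a)"
    unfolding insertion_sign_def using a t assms(1)
    by (auto intro!: homogeneous_sign homogeneous_entries)
qed

text \<open>Every product in the Leibniz formula uses each column of \<open>T\<close> and each row
  once, so its degree does not depend on the permutation.\<close>

lemma list_minor_homogeneous:
  assumes T: "T \<subseteq> {..<f}" "card T = g"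
  shows "homogeneous N \<Sigma> (xs T \<otimes>\<^bsub>G\<^esub> inv\<^bsub>G\<^esub> yall) (list_minor \<phi> [0..<g] T)"
proof -
  let ?s = "sorted_list_of_set T"
  have fin: "finite T" using T(1) by (rule finite_subset) simp
  have bij: "bij_betw ((!) ?s) {..<g} T"
    using fin T(2) by (intro bij_betw_nth) auto
  have "homogeneous N \<Sigma> (xs T \<otimes>\<^bsub>G\<^esub> inv\<^bsub>G\<^esub> yall) (\<Prod>p\<in>{..<g}. \<phi> p (?s ! \<pi> p))" if \<pi>: "\<pi> permutes {..<g}" for \<pi>
  proof -
    have bij': "bij_betw (\<lambda>p. ?s ! \<pi> p) {..<g} T"
      using bij_betw_trans[OF permutes_imp_bij[OF \<pi>] bij] by (simp add: o_def)
    have mem: "?s ! \<pi> p < f" if "p < g" for p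
      using bij_betw_apply[OF bij', of p] that T(1) by auto
    have "homogeneous N \<Sigma> (\<Otimes>\<^bsub>G\<^esub>p\<in>{..<g}. xdeg (?s ! \<pi> p) \<otimes>\<^bsub>G\<^esub> inv\<^bsub>G\<^esub> ydeg p) (\<Prod>p\<in>{..<g}. \<phi> p (?s ! \<pi> p))"
      using mem xdeg ydeg by (intro homogeneous_prod) (auto intro!: homogeneous_entries)
    also have "(\<Otimes>\<^bsub>G\<^esub>p\<in>{..<g}. xdeg (?s ! \<pi> p) \<otimes>\<^bsub>G\<^esub> inv\<^bsub>G\<^esub> ydeg p) =
        (\<Otimes>\<^bsub>G\<^esub>p\<in>{..<g}. xdeg (?s ! \<pi> p)) \<otimes>\<^bsub>G\<^esub> (\<Otimes>\<^bsub>G\<^esub>p\<in>{..<g}. inv\<^bsub>G\<^esub> ydeg p)"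
      using mem xdeg ydeg by (intro Pic.finprod_multf) auto
    also have "(\<Otimes>\<^bsub>G\<^esub>p\<in>{..<g}. inv\<^bsub>G\<^esub> ydeg p) = inv\<^bsub>G\<^esub> yall"
      using ydeg by (intro Pic.finprod_inv) auto
    also have "(\<Otimes>\<^bsub>G\<^esub>p\<in>{..<g}. xdeg (?s ! \<pi> p)) = xs T"
      using Pic.finprod_reindex[of xdeg "\<lambda>p. ?s ! \<pi> p" "{..<g}" N \<Sigma>] bij' T(1) xdeg
      by (auto simp: bij_betw_def subset_iff)
    finally show ?thesis .
  qed
  then have "homogeneous N \<Sigma> (xs T \<otimes>\<^bsub>G\<^esub> inv\<^bsub>G\<^esub> yall) (signof \<pi> * (\<Prod>p = 0..<g. \<phi> p (?s ! \<pi> p)))"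
    if "\<pi> permutes {0..<g}" for \<pi>
    using that by (auto simp: sign_def lessThan_atLeast0 intro: homogeneous_uminus)
  moreover have "list_minor \<phi> [0..<g] T = (\<Sum>\<pi> | \<pi> permutes {0..<g}. signof \<pi> * (\<Prod>p = 0..<g. \<phi> p (?s ! \<pi> p)))"
    unfolding list_minor_def Determinant.det_def
    by (auto intro!: sum.cong prod.cong dest: permutes_in_image)
  ultimately show ?thesis by (simp only:) (rule homogeneous_sum, simp only: mem_Collect_eq)
qed

lemma diff_homogeneous:
  assumes j: "1 \<le> j" and x: "x \<in> X (j - 1)" and y: "y \<in> X j"
  shows "homogeneous N \<Sigma> (dg j y \<otimes>\<^bsub>G\<^esub> inv\<^bsub>G\<^esub> dg (j - 1) x) (cx_diff C j x y)"
proof -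
  obtain B v A w where xy: "x = (B, v)" "y = (A, w)" by (cases x, cases y)
  have A: "A \<subseteq> {..<f}" and w: "set_mset w \<subseteq> {..<g}" and B: "B \<subseteq> {..<f}" and v: "set_mset v \<subseteq> {..<g}"
    using x y xy en_basis_subset by blast+
  note car = xs_carrier[OF A] xs_carrier[OF B] ys_carrier[OF w] ys_carrier[OF v] yall_carrier
  consider "int j \<le> i" | "int j = i + 1" | "int j > i + 1" by linarith
  then show ?thesis
  proof cases
    case 1
    have "dg j y \<otimes>\<^bsub>G\<^esub> inv\<^bsub>G\<^esub> dg (j - 1) x = xdeg a \<otimes>\<^bsub>G\<^esub> inv\<^bsub>G\<^esub> ydeg t"
      if "a \<in> A" "B = A - {a}" "t < g" "v = add_mset t w" for a t
    proof -
      have "dg j y = xdeg a \<otimes>\<^bsub>G\<^esub> xs B \<otimes>\<^bsub>G\<^esub> ys w" "dg (j - 1) x = xs B \<otimes>\<^bsub>G\<^esub> (ydeg t \<otimes>\<^bsub>G\<^esub> ys w)"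
        using 1 j xs_insert[OF A that(1,2)] ys_add[of t w] v that(4)
        by (simp_all add: xy en_degree_def Let_def)
      then show ?thesis
        using Pic.degree_cancel[OF xdeg car(2,3) ydeg[OF that(3)]] that(1) A by auto
    qed
    from step_homogeneous[OF A this, where Q = "\<lambda>t. v = add_mset t w"] 
    have "homogeneous N \<Sigma> (dg j y \<otimes>\<^bsub>G\<^esub> inv\<^bsub>G\<^esub> dg (j - 1) x)
      (\<Sum>a\<in>{a \<in> A. B = A - {a}}. \<Sum>t\<in>{t \<in> {..<g}. v = add_mset t w}. insertion_sign A a * \<phi> t a)" by blast
    then show ?thesis
      using 1 step_entry(1)[OF A, where B = B and P = "\<lambda>t. v = add_mset t w"]
      by (simp only: xy en_complex_def en_delta_def based_complex.simps if_True prod.case)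
  next
    case 2
    note b = splice_basis[OF 2 j]
    have Aw: "(A, w) \<in> basis {..<f} {..<g} (g + (j - 1)) 0" "card B = j - 1" "v = {#}" "w = {#}"
      using x y b xy by (auto simp: basis_iff)
    have ji: "int (j - 1) \<le> i" "\<not> int j \<le> i" using 2 j by auto
    note e = splice_entry(1)[OF Aw(1) B Aw(2), of v]
    have diff: "cx_diff C j x y = en_splice R g \<phi> (B, v) (A, w)" using 2 by (simp add: xy en_complex_def)
    show ?thesis
    proof (cases "B \<subseteq> A")
      case False
      then show ?thesis unfolding diff e by (simp add: homogeneous_zero)
    next
      case True
      have fin: "finite A" "finite B" using finite_subset[OF A] finite_subset[OF B] by auto
      have T: "A - B \<subseteq> {..<f}" "card (A - B) = g" using A Aw fin True by (auto simp: basis_iff card_Diff_subset)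
      have "xs ((A - B) \<union> B) = xs (A - B) \<otimes>\<^bsub>G\<^esub> xs B"
        using fin A B xdeg by (intro Pic.finprod_Un_disjoint) auto
      moreover have "(A - B) \<union> B = A" using True by auto
      ultimately have xsA: "xs A = xs (A - B) \<otimes>\<^bsub>G\<^esub> xs B" by simp
      have "dg j y \<otimes>\<^bsub>G\<^esub> inv\<^bsub>G\<^esub> dg (j - 1) x = (xs (A - B) \<otimes>\<^bsub>G\<^esub> xs B \<otimes>\<^bsub>G\<^esub> inv\<^bsub>G\<^esub> yall) \<otimes>\<^bsub>G\<^esub> inv\<^bsub>G\<^esub> xs B"
      proof -
        have "dg j y = xs A \<otimes>\<^bsub>G\<^esub> inv\<^bsub>G\<^esub> yall"
          using ji(2) car(1) by (simp add: xy(2) en_degree_def Let_def Aw(4))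
        moreover have "dg (j - 1) x = xs B"
          using ji(1) car(2) by (simp add: xy(1) en_degree_def Let_def Aw(3))
        ultimately show ?thesis by (simp only: xsA)
      qed
      also have "\<dots> = xs (A - B) \<otimes>\<^bsub>G\<^esub> inv\<^bsub>G\<^esub> yall"
        using car xs_carrier[OF T(1)] by (intro Pic.degree_cancel_splice) simp_all
      finally show ?thesis
        unfolding diff e if_P[OF True] inversion_sign_def
        by (simp add: homogeneous_sign list_minor_homogeneous[OF T])
    qed
  next
    case 3
    have "dg j y \<otimes>\<^bsub>G\<^esub> inv\<^bsub>G\<^esub> dg (j - 1) x = xdeg a \<otimes>\<^bsub>G\<^esub> inv\<^bsub>G\<^esub> ydeg t"
      if "a \<in> A" "B = A - {a}" "t < g" "w = add_mset t v" for a t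
    proof -
      have "\<not> int j \<le> i" "\<not> int (j - 1) \<le> i" using 3 j by auto
      then have "dg j y = xdeg a \<otimes>\<^bsub>G\<^esub> xs B \<otimes>\<^bsub>G\<^esub> inv\<^bsub>G\<^esub> (ydeg t \<otimes>\<^bsub>G\<^esub> ys v) \<otimes>\<^bsub>G\<^esub> inv\<^bsub>G\<^esub> yall"
        "dg (j - 1) x = xs B \<otimes>\<^bsub>G\<^esub> inv\<^bsub>G\<^esub> ys v \<otimes>\<^bsub>G\<^esub> inv\<^bsub>G\<^esub> yall"
        using xs_insert[OF A that(1,2)] ys_add[of t v] w that(4)
        by (simp_all add: xy en_degree_def Let_def)
      then show ?thesis
        using Pic.degree_cancel_dual[OF xdeg car(2,4) ydeg[OF that(3)] car(5)] that(1) A by auto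
    qed
    from step_homogeneous[OF A this, where Q = "\<lambda>t. w = add_mset t v"]
    have "homogeneous N \<Sigma> (dg j y \<otimes>\<^bsub>G\<^esub> inv\<^bsub>G\<^esub> dg (j - 1) x)
      (\<Sum>a\<in>{a \<in> A. B = A - {a}}. \<Sum>t\<in>{t \<in> {..<g}. w = add_mset t v}. insertion_sign A a * \<phi> t a)" by blast
    moreover have "cx_diff C j x y =
      (\<Sum>a\<in>{a \<in> A. B = A - {a}}. \<Sum>t\<in>{t \<in> {..<g}. w = add_mset t v}. insertion_sign A a * \<phi> t a)"
      unfolding step_entry(1)[OF A, where B = B and P = "\<lambda>t. w = add_mset t v", symmetric]
      using 3 by (simp add: xy en_complex_def en_partial_def del: lessThan_iff)
    ultimately show ?thesis by simp
  qed
qed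

lemma graded_matrix_C:
  assumes j: "1 \<le> j"
  shows "graded_matrix N \<Sigma> (cx_basis C (j - 1)) (dg (j - 1)) (cx_basis C j) (dg j) (cx_diff C j)"
  unfolding graded_matrix_def basis_C
  using finite_en_basis dg_carrier diff_homogeneous[OF j] by auto

end

theorem theorem1p1:
  fixes N :: "'v::euclidean_space set"
    and \<Sigma> :: "'v set set"
    and f g :: nat
    and xdeg ydeg :: "nat \<Rightarrow> ('v set \<Rightarrow>\<^sub>0 int) set"
    and \<phi> :: "nat \<Rightarrow> nat \<Rightarrow> ('v, 'k::alg_closed_field) cox_poly"
    and i :: int
  assumes "smooth_projective_fan N \<Sigma>"
    and "g \<le> f"
    and "graded_matrix N \<Sigma> {..<g} ydeg {..<f} xdeg \<phi>"
    and "i \<ge> -1"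
    and "\<And>m::int. int f - int (en_length f g i) + 1 \<le> m \<Longrightarrow> m \<le> int g \<Longrightarrow>
           ideal_depth (cox_ring \<Sigma>)
             (saturation (cox_ring \<Sigma>) (minors_ideal (cox_ring \<Sigma>) g f \<phi> m) (irrelevant_ideal \<Sigma>))
           \<ge> enat (nat (int f - m + 1))"
  shows "virtual_resolution N \<Sigma> (en_complex (cox_ring \<Sigma>) f g \<phi> i)
           (en_degree (Pic N \<Sigma>) g xdeg ydeg i)"
proof -
  interpret graded_cox_matrix \<Sigma> f g \<phi> i N xdeg ydeg
    using assms(2-4) by unfold_locales (auto simp: graded_matrix_def homogeneous_def)
  define S :: "('v, 'k) cox_poly set" where
    "S = {\<Prod>\<rho>\<in>{\<rho> \<in> rays \<Sigma>. \<not> \<rho> \<subseteq> \<sigma>}. cox_var \<rho> | \<sigma>. \<sigma> \<in> maximal_cones \<Sigma>}"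
  have "finite \<Sigma>" using assms(1) by (simp add: smooth_projective_fan_def fan_def)
  then have fin: "finite S" unfolding S_def maximal_cones_def by simp
  have "cox_var \<rho> \<in> carrier R" if "\<rho> \<in> rays \<Sigma>" for \<rho>
    using that by (simp add: cox_var_def carrier_cox_ring)
  then have S: "S \<subseteq> carrier R" unfolding S_def by (auto intro!: cox_prod)
  have B: "irrelevant_ideal \<Sigma> = Idl\<^bsub>R\<^esub> S" by (simp add: irrelevant_ideal_def S_def)
  have "\<exists>n. annihilates_homology R (ideal_power R (irrelevant_ideal \<Sigma>) n) C j" if j: "1 \<le> j" for j
  proof -
    \<comment> \<open>Exactness where the monomial \<open>s\<close> is invertible, expressed as
      nilpotent action of \<open>s\<close> on the homology; \<open>s\<close> takes the role of
      \<open>b\<close>.\<close>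
    have "s \<in> radical (E.annihilator j)" if s: "s \<in> S" for s
    proof (rule en_acyclic[OF assms(2,4) j])
      fix m assume m: "int f - int (en_length f g i) + 1 \<le> int m" "m \<le> g"
      have "nat (int f - int m + 1) = Suc (f - m)" using m(2) assms(2) by simp
      then have "enat (Suc (f - m)) \<le> ideal_depth R (saturation R (minors_ideal R g f \<phi> (int m)) (Idl\<^bsub>R\<^esub> S))"
        using assms(5)[OF m(1)] m(2) B by simp
      then have "deep s (determinantal_ideal {..<f} {..<g} \<phi> m) (Suc (f - m))"
        using cox.genideal_self[OF S] s
        by (intro deep_of_depth[OF entries cox.genideal_ideal[OF S]]) auto
      then show "deep s (determinantal_ideal {..<f} {..<g} \<phi> m) (f - m + 1)" by simp
    qed
    then have "S \<subseteq> radical (E.annihilator j)" by blast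
    from ideal_power_eventually_subset[OF S fin E.annihilator_ideal this]
    obtain n where n: "ideal_power R (Idl\<^bsub>R\<^esub> S) n \<subseteq> E.annihilator j" by blast
    have I: "ideal (Idl\<^bsub>R\<^esub> S) R" by (rule cox.genideal_ideal[OF S])
    have "ideal (ideal_power R (Idl\<^bsub>R\<^esub> S) n) R"
      by (induction n) (simp_all add: cox.oneideal cox.ideal_prod_is_ideal I)
    then have "ideal_power R (Idl\<^bsub>R\<^esub> S) n \<subseteq> carrier R" by (rule additive_subgroup.a_subset[OF ideal.axioms(1)])
    then show ?thesis
      using n annihilates[OF j] unfolding annihilates_homology_def basis_C B by (intro exI[of _ n]) auto
  qed
  then show ?thesis
    unfolding virtual_resolution_def using graded_matrix_C is_complex_C by blast
qed

end
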